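(* Let $\mathcal{Q}$ be a set of noncommutative polynomials in indeterminates $\{Z_{i,j}\}$, $i\in\{1,\ldots,k\}$, $j\in\{1,\ldots,n_i\}$, with $\mathcal{N}_{\mathcal{Q}}\ne\{0\}$, and let $\mathbf{A}=(A_1,\ldots,A_k)\in B(\mathcal{H})^{n_1}\times_c\cdots\times_cB(\mathcal{H})^{n_k}$, $A_i=(A_{i,1},\ldots,A_{i,n_i})$, be such that each $\sum_{\alpha\in\mathbb{F}_{n_i}^+}a_{i,\alpha}A_{i,\alpha}A_{i,\alpha}^*$ is weakly convergent and $q(\mathbf{A})=0$ for any $q\in\mathcal{Q}$. If $$\sum_{(s_1,\ldots,s_k)\in\mathbb{Z}_+^k}\binom{s_1+m_1-1}{m_1-1}\cdots\binom{s_k+m_k-1}{m_k-1}\Phi_{f_1,A_1}^{s_1}\circ\cdots\circ\Phi_{f_k,A_k}^{s_k}(I)\leq bI$$ for some constant $b>0$, then there exists an invertible operator $Y:\mathcal{H}\to\mathcal{G}$ such that $$A_{i,j}^*=Y^{-1}[(\mathbf{S}_{i,j}^*\otimes I_{\mathcal{H}})|_{\mathcal{G}}]Y$$ for all $i\in\{1,\ldots,k\}$ and $j\in\{1,\ldots,n_i\}$, where $\mathcal{G}\subseteq\mathcal{N}_{\mathcal{Q}}\otimes\mathcal{H}$ is a (closed) subspace invariant under each operator $\mathbf{S}_{i,j}^*\otimes I_{\mathcal{H}}$, and $\mathbf{S}=\{\mathbf{S}_{i,j}\}$ is the universal model associated with the abstract noncommutative variety $\mathcal{V}_{\mathcal{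Q}}$.
   Context: Hilbert spaces are complex, $\mathcal{H}$ separable. $\mathbb{N}=\{1,2,\ldots\}$, $\mathbb{Z}_+=\{0,1,\ldots\}$; fix $k\in\mathbb{N}$ and $n_i,m_i\in\mathbb{N}$. Series of operators converge in the weak operator topology (WOT). $\mathbb{F}_{n_i}^+$ is the free monoid on generators $g_1^i,\ldots,g_{n_i}^i$ with identity $g_0^i$; $|\alpha|$ is word length. For an $n_i$-tuple $(X_{i,1},\ldots,X_{i,n_i})$ and $\alpha=g^i_{j_1}\cdots g^i_{j_p}$, $X_{i,\alpha}:=X_{i,j_1}\cdots X_{i,j_p}$, $X_{i,g_0^i}:=I$. For $(\alpha)=(\alpha_1,\ldots,\alpha_k)$, $X_{(\alpha)}:=X_{1,\alpha_1}\cdots X_{k,\alpha_k}$. Each $f_i=\sum_{\alpha\in\mathbb{F}_{n_i}^+}a_{i,\alpha}Z_{i,\alpha}$ is a positive regular free holomorphic function: a formal power series in noncommuting $Z_{i,1},\ldots,Z_{i,n_i}$ with $a_{i,\alpha}\ge0$, $a_{i,g_0^i}=0$, $a_{i,g_j^i}>0$ for $j=1,\ldots,n_i$, and $\limsup_{p\to\infty}(\sum_{|\alpha|=p}|a_{i,\alpha}|^2)^{1/2p}<\infty$. $B(\mathcal{H})^{n_1}\times_c\cdots\times_cB(\mathcal{H})^{n_k}$ is the set of tuples $\mathbf{X}=(X_1,\ldots,X_k)$, $X_i=(X_{i,1},\ldots,X_{i,n_i})$, such that for $s\ne t$ the entries of $X_s$ commute with those of $X_t$. $\Phi_{f_i,A_i}(Y):=\sum_\alpha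 a_{i,\alpha}A_{i,\alpha}YA_{i,\alpha}^*$ (WOT). Universal model: $F^2(H_{n_i})$ is the full Fock space over an $n_i$-dimensional Hilbert space, with orthonormal basis $\{e^i_\alpha\}_{\alpha\in\mathbb{F}_{n_i}^+}$, $e^i_{g_0^i}=1$. Put $b_{i,g_0^i}^{(m_i)}:=1$ and, for $|\alpha|\ge1$, $$b_{i,\alpha}^{(m_i)}:=\sum_{p=1}^{|\alpha|}\ \sum_{\gamma_1\cdots\gamma_p=\alpha,\ |\gamma_1|\ge1,\ldots,|\gamma_p|\ge1}a_{i,\gamma_1}\cdots a_{i,\gamma_p}\binom{p+m_i-1}{m_i-1}.$$ $W_{i,j}e^i_\alpha:=\sqrt{b_{i,\alpha}^{(m_i)}/b_{i,g_j^i\alpha}^{(m_i)}}\,e^i_{g_j^i\alpha}$, and $\mathbf{W}_{i,j}:=I\otimes\cdots\otimes W_{i,j}\otimes\cdots\otimes I$ ($W_{i,j}$ in the $i$-th position) on $\bigotimes_{i=1}^kF^2(H_{n_i})$. Polynomials are in the algebra $\mathbb{C}\langle Z_{i,j}\rangle$ where $Z_{s,j}$ and $Z_{t,l}$ commute for $s\neq t$ and are otherwise noncommuting. $\mathcal{M}_{\mathcal{Q}}:=\overline{\mathrm{span}}\{\mathbf{W}_{(\alpha)}q(\mathbf{W})\mathbf{W}_{(\beta)}(\mathbb{C}):(\alpha),(\beta)\in\mathbb{F}_{n_1}^+\times\cdots\times\mathbb{F}_{n_k}^+,\ q\in\mathcal{Q}\}$ (where $\mathbb{C}$ denotes the scalar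 multiples of the vacuum $1\otimes\cdots\otimes1$), $\mathcal{N}_{\mathcal{Q}}:=[\bigotimes_iF^2(H_{n_i})]\ominus\mathcal{M}_{\mathcal{Q}}$ (throughout assumed $\neq\{0\}$), which is invariant under each $\mathbf{W}_{i,j}^*$. The universal model of the variety $\mathcal{V}_{\mathcal{Q}}$ is $\mathbf{S}=\{\mathbf{S}_{i,j}\}$, $\mathbf{S}_{i,j}:=P_{\mathcal{N}_{\mathcal{Q}}}\mathbf{W}_{i,j}|_{\mathcal{N}_{\mathcal{Q}}}$. *)

theory Defs
  imports
    "HOL-Analysis.Analysis"
    "HOL-Library.Poly_Mapping"
    "HOL-Library.FuncSet"
begin

section \<open>Complex Hilbert spaces\<close>

text \<open>
  A complex Hilbert space extends the real inner product space \<open>(x, y) \<mapsto> Re \<langle>x, y\<rangle>\<close>, so that the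
  norm, the topology and completeness are those of the library. The complex inner product is linear
  in its first argument. Positive definiteness is inherited: \<open>Re \<langle>x, x\<rangle> = inner x x\<close>, and
  \<open>\<langle>x, x\<rangle>\<close> is real by \<open>cinner_commute\<close>.
\<close>

class complex_hilbert = real_inner + complete_space +
  fixes scaleC :: "complex \<Rightarrow> 'a \<Rightarrow> 'a"  (infixr "*\<^sub>C" 75)
    and cinner :: "'a \<Rightarrow> 'a \<Rightarrow> complex"
  assumes scaleC_add_right: "c *\<^sub>C (x + y) = c *\<^sub>C x + c *\<^sub>C y"
    and scaleC_add_left: "(c + d) *\<^sub>C x = c *\<^sub>C x + d *\<^sub>C x"
    and scaleC_scaleC: "c *\<^sub>C d *\<^sub>C x = (c * d) *\<^sub>C x"
    and scaleC_of_real: "of_real r *\<^sub>C x = r *\<^sub>R x"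
    and cinner_commute: "cinner x y = cnj (cinner y x)"
    and cinner_add_left: "cinner (x + y) z = cinner x z + cinner y z"
    and cinner_scaleC_left: "cinner (c *\<^sub>C x) y = c * cinner x y"
    and Re_cinner: "Re (cinner x y) = inner x y"

lemma scaleC_one [simp]: "1 *\<^sub>C x = (x::'a::complex_hilbert)"
  using scaleC_of_real[of 1 x] by simp

interpretation complex_vector: vector_space "scaleC :: complex \<Rightarrow> 'a \<Rightarrow> 'a::complex_hilbert"
  by standard (simp_all add: scaleC_add_right scaleC_add_left scaleC_scaleC)

lemma cinner_scaleC_right: "cinner x (c *\<^sub>C y) = cnj c * cinner x (y::'a::complex_hilbert)"
  by (metis cinner_commute cinner_scaleC_left complex_cnj_mult)

lemma cinner_add_right: "cinner x (y + z) = cinner x y + cinner x (z::'a::complex_hilbert)"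
  by (metis cinner_commute cinner_add_left complex_cnj_add)

lemma cinner_self: "cinner x x = of_real ((norm (x::'a::complex_hilbert))\<^sup>2)"
proof (rule complex_eqI)
  show "Re (cinner x x) = Re (complex_of_real ((norm x)\<^sup>2))"
    by (simp add: Re_cinner power2_norm_eq_inner)
  have "cinner x x = cnj (cinner x x)" by (rule cinner_commute)
  then have "Im (cinner x x) = Im (cnj (cinner x x))" by simp
  then show "Im (cinner x x) = Im (complex_of_real ((norm x)\<^sup>2))" by simp
qed

lemma norm_scaleC [simp]: "norm (c *\<^sub>C x) = cmod c * norm (x::'a::complex_hilbert)"
proof -
  have "complex_of_real ((norm (c *\<^sub>C x))\<^sup>2) = c * cnj c * cinner x x"
    by (simp only: cinner_self[symmetric] cinner_scaleC_left cinner_scaleC_right ac_simps)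
  also have "\<dots> = complex_of_real ((cmod c * norm x)\<^sup>2)"
    by (simp add: cinner_self complex_norm_square[symmetric] power_mult_distrib)
  finally have "(norm (c *\<^sub>C x))\<^sup>2 = (cmod c * norm x)\<^sup>2"
    using of_real_eq_iff by blast
  then show ?thesis by (simp add: power2_eq_iff_nonneg)
qed

lemma norm_cinner_le: "cmod (cinner x y) \<le> norm x * norm (y::'a::complex_hilbert)"
proof (cases "cinner x y = 0")
  case False
  define c where "c = cnj (cinner x y) / of_real (cmod (cinner x y))"
  have c: "cmod c = 1" using False by (simp add: c_def norm_divide)
  have "cinner (c *\<^sub>C x) y = of_real (cmod (cinner x y))"
    using False by (simp add: cinner_scaleC_left c_def divide_simps complex_norm_square[symmetric] 
        power2_eq_square mult.commute)
  then have "cmod (cinner x y) = inner (c *\<^sub>C x) y"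
    by (metis Re_cinner Re_complex_of_real)
  also have "\<dots> \<le> norm (c *\<^sub>C x) * norm y" by (rule norm_cauchy_schwarz)
  finally show ?thesis by (simp add: c)
qed simp

instantiation complex :: complex_hilbert
begin
definition scaleC_complex :: "complex \<Rightarrow> complex \<Rightarrow> complex" where "scaleC_complex c x = c * x"
definition cinner_complex :: "complex \<Rightarrow> complex \<Rightarrow> complex" where "cinner_complex x y = x * cnj y"
instance
  by standard (auto simp: scaleC_complex_def cinner_complex_def algebra_simps scaleR_conv_of_real
      inner_complex_def)
end

text \<open>
  Operators are functions that are only looked at on a subspace \<open>U\<close>; \<open>U = UNIV\<close> gives the bounded
  operators on the whole space. Likewise \<open>adjoint_on U T\<close> is the adjoint of the operator
  \<open>T : U \<rightarrow> U\<close> on the Hilbert space \<open>U\<close>, and is set to zero off \<open>U\<close>.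
\<close>

definition bounded_clinear_on ::
  "'a::complex_hilbert set \<Rightarrow> ('a \<Rightarrow> 'b::complex_hilbert) \<Rightarrow> bool" where
  "bounded_clinear_on U T \<longleftrightarrow>
     (\<forall>x\<in>U. \<forall>y\<in>U. T (x + y) = T x + T y) \<and>
     (\<forall>c. \<forall>x\<in>U. T (c *\<^sub>C x) = c *\<^sub>C T x) \<and>
     (\<exists>K. \<forall>x\<in>U. norm (T x) \<le> K * norm x)"

definition adjoint_on :: "'a::complex_hilbert set \<Rightarrow> ('a \<Rightarrow> 'a) \<Rightarrow> 'a \<Rightarrow> 'a" where
  "adjoint_on U T y =
     (if y \<in> U then THE z. z \<in> U \<and> (\<forall>x\<in>U. cinner (T x) y = cinner x z) else 0)"

abbreviation adjoint_op :: "('a::complex_hilbert \<Rightarrow> 'a) \<Rightarrow> 'a \<Rightarrow> 'a" where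
  "adjoint_op \<equiv> adjoint_on UNIV"

definition closed_csubspace :: "'a::complex_hilbert set \<Rightarrow> bool" where
  "closed_csubspace U \<longleftrightarrow> complex_vector.subspace U \<and> closed U"

definition proj_on :: "'a::complex_hilbert set \<Rightarrow> 'a \<Rightarrow> 'a" where
  "proj_on U x = (THE y. y \<in> U \<and> (\<forall>z\<in>U. cinner (x - y) z = 0))"

definition op_le :: "('a::complex_hilbert \<Rightarrow> 'a) \<Rightarrow> ('a \<Rightarrow> 'a) \<Rightarrow> bool" where
  "op_le S T \<longleftrightarrow> (\<forall>x. Im (cinner (T x - S x) x) = 0 \<and> 0 \<le> Re (cinner (T x - S x) x))"

text \<open>
  Series in the weak operator topology, as unordered sums; for series of positive operators this
  does not depend on any ordering of the index set.
\<close>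

definition wot_has_sum ::
  "('i \<Rightarrow> 'a::complex_hilbert \<Rightarrow> 'a) \<Rightarrow> 'i set \<Rightarrow> ('a \<Rightarrow> 'a) \<Rightarrow> bool" where
  "wot_has_sum F I T \<longleftrightarrow> bounded_clinear_on UNIV T \<and>
     (\<forall>x y. ((\<lambda>i. cinner (F i x) y) has_sum cinner (T x) y) I)"

definition wot_summable :: "('i \<Rightarrow> 'a::complex_hilbert \<Rightarrow> 'a) \<Rightarrow> 'i set \<Rightarrow> bool" where
  "wot_summable F I \<longleftrightarrow> (\<exists>T. wot_has_sum F I T)"

definition wot_sum :: "('i \<Rightarrow> 'a::complex_hilbert \<Rightarrow> 'a) \<Rightarrow> 'i set \<Rightarrow> 'a \<Rightarrow> 'a" where
  "wot_sum F I = (THE T. wot_has_sum F I T)"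


section \<open>Square-summable families\<close>

typedef (overloaded) ('i, 'h) ell2 =
  "{f :: 'i \<Rightarrow> 'h::complex_hilbert. (\<lambda>i. (norm (f i))\<^sup>2) summable_on UNIV}"
  morphisms ell2_nth Abs_ell2
  by (rule exI[of _ "\<lambda>_. 0"]) simp

setup_lifting type_definition_ell2

lemma ell2_summable: "(\<lambda>i. (norm (ell2_nth x i))\<^sup>2) summable_on A"
proof -
  have "(\<lambda>i. (norm (ell2_nth x i))\<^sup>2) summable_on UNIV" using ell2_nth[of x] by simp
  then show ?thesis by (rule summable_on_subset) simp_all
qed

lemma square_summable_add:
  fixes f g :: "'i \<Rightarrow> 'h::real_inner"
  assumes "(\<lambda>i. (norm (f i))\<^sup>2) summable_on A" "(\<lambda>i. (norm (g i))\<^sup>2) summable_on A"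
  shows "(\<lambda>i. (norm (f i + g i))\<^sup>2) summable_on A"
proof (rule summable_on_comparison_test)
  show "(\<lambda>i. 2 * (norm (f i))\<^sup>2 + 2 * (norm (g i))\<^sup>2) summable_on A"
    by (intro summable_on_add summable_on_cmult_right assms)
next
  fix i
  have "(norm (f i + g i))\<^sup>2 \<le> (norm (f i) + norm (g i))\<^sup>2"
    by (simp add: norm_triangle_ineq)
  also have "\<dots> \<le> 2 * (norm (f i))\<^sup>2 + 2 * (norm (g i))\<^sup>2"
    using sum_squares_bound[of "norm (f i)" "norm (g i)"] by (simp add: power2_sum)
  finally show "(norm (f i + g i))\<^sup>2 \<le> 2 * (norm (f i))\<^sup>2 + 2 * (norm (g i))\<^sup>2" .
qed simp

lemma square_summable_mult:
  fixes f g :: "'i \<Rightarrow> 'h::real_inner"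
  assumes "(\<lambda>i. (norm (f i))\<^sup>2) summable_on A" "(\<lambda>i. (norm (g i))\<^sup>2) summable_on A"
  shows "(\<lambda>i. norm (f i) * norm (g i)) summable_on A"
proof (rule summable_on_comparison_test)
  show "(\<lambda>i. (norm (f i))\<^sup>2 + (norm (g i))\<^sup>2) summable_on A"
    by (intro summable_on_add assms)
  show "norm (f i) * norm (g i) \<le> (norm (f i))\<^sup>2 + (norm (g i))\<^sup>2" for i
    using sum_squares_bound[of "norm (f i)" "norm (g i)"] 
      mult_nonneg_nonneg[OF norm_ge_zero[of "f i"] norm_ge_zero[of "g i"]] by linarith
qed simp

lemma ell2_inner_summable:
  "(\<lambda>i. inner (ell2_nth x i) (ell2_nth y i)) summable_on A"
  by (rule abs_summable_summable, rule Infinite_Sum.abs_summable_on_comparison_test'[OF square_summable_mult])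
    (auto intro: ell2_summable Cauchy_Schwarz_ineq2)

lemma ell2_cinner_summable:
  "(\<lambda>i. cinner (ell2_nth x i) (ell2_nth y i)) summable_on A"
  by (rule abs_summable_summable, rule Infinite_Sum.abs_summable_on_comparison_test'[OF square_summable_mult])
    (auto intro: ell2_summable norm_cinner_le)

instantiation ell2 :: (type, complex_hilbert) real_inner
begin

lift_definition zero_ell2 :: "('a, 'b) ell2" is "\<lambda>_. 0" by simp
lift_definition plus_ell2 :: "('a, 'b) ell2 \<Rightarrow> ('a, 'b) ell2 \<Rightarrow> ('a, 'b) ell2"
  is "\<lambda>f g i. f i + g i" by (simp add: square_summable_add)
lift_definition uminus_ell2 :: "('a, 'b) ell2 \<Rightarrow> ('a, 'b) ell2"
  is "\<lambda>f i. - f i" by simp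
definition minus_ell2 :: "('a, 'b) ell2 \<Rightarrow> ('a, 'b) ell2 \<Rightarrow> ('a, 'b) ell2"
  where "minus_ell2 x y = x + - y"
lift_definition scaleR_ell2 :: "real \<Rightarrow> ('a, 'b) ell2 \<Rightarrow> ('a, 'b) ell2"
  is "\<lambda>r f i. r *\<^sub>R f i" by (simp add: power_mult_distrib summable_on_cmult_right)
definition inner_ell2 :: "('a, 'b) ell2 \<Rightarrow> ('a, 'b) ell2 \<Rightarrow> real"
  where "inner_ell2 x y = (\<Sum>\<^sub>\<infinity>i. inner (ell2_nth x i) (ell2_nth y i))"
definition norm_ell2 :: "('a, 'b) ell2 \<Rightarrow> real" where "norm_ell2 x = sqrt (inner x x)"
definition sgn_ell2 :: "('a, 'b) ell2 \<Rightarrow> ('a, 'b) ell2"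
  where "sgn_ell2 x = inverse (norm x) *\<^sub>R x"
definition dist_ell2 :: "('a, 'b) ell2 \<Rightarrow> ('a, 'b) ell2 \<Rightarrow> real"
  where "dist_ell2 x y = norm (x - y)"
definition uniformity_ell2 :: "(('a, 'b) ell2 \<times> ('a, 'b) ell2) filter"
  where "uniformity_ell2 = (INF e\<in>{0<..}. principal {(x, y). dist x y < e})"
definition open_ell2 :: "('a, 'b) ell2 set \<Rightarrow> bool"
  where "open_ell2 U = (\<forall>x\<in>U. eventually (\<lambda>(x', y). x' = x \<longrightarrow> y \<in> U) uniformity)"

instance
proof
  fix x y z :: "('a, 'b) ell2" and r s :: real
  show "x + y + z = x + (y + z)" by transfer (simp add: add.assoc)
  show "x + y = y + x" by transfer (simp add: add.commute)
  show "0 + x = x" by transfer simp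
  show "- x + x = 0" by transfer simp
  show "x - y = x + - y" by (rule minus_ell2_def)
  show "r *\<^sub>R (x + y) = r *\<^sub>R x + r *\<^sub>R y" by transfer (simp add: scaleR_right_distrib)
  show "(r + s) *\<^sub>R x = r *\<^sub>R x + s *\<^sub>R x" by transfer (simp add: scaleR_left_distrib)
  show "r *\<^sub>R s *\<^sub>R x = (r * s) *\<^sub>R x" by transfer simp
  show "1 *\<^sub>R x = x" by transfer simp
  show "sgn x = inverse (norm x) *\<^sub>R x" by (rule sgn_ell2_def)
  show "dist x y = norm (x - y)" by (rule dist_ell2_def)
  show "(uniformity :: (('a, 'b) ell2 \<times> ('a, 'b) ell2) filter)
      = (INF e\<in>{0<..}. principal {(x, y). dist x y < e})" by (rule uniformity_ell2_def)
  show "open U = (\<forall>x\<in>U. eventually (\<lambda>(x', y). x' = x \<longrightarrow> y \<in> U) uniformity)"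
    for U :: "('a, 'b) ell2 set" by (rule open_ell2_def)
  show "inner x y = inner y x" by (simp add: inner_ell2_def inner_commute)
  show "inner (x + y) z = inner x z + inner y z"
    by (simp add: inner_ell2_def plus_ell2.rep_eq inner_add_left infsum_add ell2_inner_summable)
  show "inner (r *\<^sub>R x) y = r * inner x y"
    by (simp add: inner_ell2_def scaleR_ell2.rep_eq infsum_cmult_right')
  show "0 \<le> inner x x" by (simp add: inner_ell2_def infsum_nonneg)
  show "inner x x = 0 \<longleftrightarrow> x = 0"
  proof
    assume "inner x x = 0"
    then have "inner (ell2_nth x i) (ell2_nth x i) = 0" for i
      using nonneg_infsum_le_0D[OF _ ell2_inner_summable[of x x UNIV], of i]
      by (simp add: inner_ell2_def)
    then show "x = 0" by (auto simp: ell2_nth_inject[symmetric] zero_ell2.rep_eq)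
  qed (simp add: inner_ell2_def zero_ell2.rep_eq)
  show "norm x = sqrt (inner x x)" by (rule norm_ell2_def)
qed

end

lemma ell2_nth_add: "ell2_nth (x + y) i = ell2_nth x i + ell2_nth y i"
  by (simp add: plus_ell2.rep_eq)

lemma ell2_nth_diff: "ell2_nth (x - y) i = ell2_nth x i - ell2_nth y i"
  unfolding minus_ell2_def plus_ell2.rep_eq uminus_ell2.rep_eq by simp

lemma norm_ell2_square: "(norm x)\<^sup>2 = (\<Sum>\<^sub>\<infinity>i. (norm (ell2_nth x i))\<^sup>2)"
  unfolding power2_norm_eq_inner inner_ell2_def by (rule refl)

lemma sum_le_norm_ell2:
  assumes "finite F"
  shows "(\<Sum>i\<in>F. (norm (ell2_nth x i))\<^sup>2) \<le> (norm x)\<^sup>2"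
  unfolding norm_ell2_square
  by (rule finite_sum_le_infsum[OF ell2_summable assms]) simp_all

lemma norm_ell2_nth_le: "norm (ell2_nth x i) \<le> norm x"
proof -
  have "(norm (ell2_nth x i))\<^sup>2 \<le> (norm x)\<^sup>2" using sum_le_norm_ell2[of "{i}" x] by simp
  then show ?thesis by (simp add: power2_le_iff_abs_le)
qed

instance ell2 :: (type, complex_hilbert) complete_space
proof
  fix X :: "nat \<Rightarrow> ('a, 'b) ell2"
  assume X: "Cauchy X"
  have "Cauchy (\<lambda>m. ell2_nth (X m) i)" for i
  proof (rule metric_CauchyI)
    fix e :: real assume "0 < e"
    then obtain M where "\<And>m n. m \<ge> M \<Longrightarrow> n \<ge> M \<Longrightarrow> dist (X m) (X n) < e"
      using metric_CauchyD[OF X] by blast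
    moreover have "dist (ell2_nth (X m) i) (ell2_nth (X n) i) \<le> dist (X m) (X n)" for m n
      using norm_ell2_nth_le[of "X m - X n" i] by (simp add: dist_norm ell2_nth_diff)
    ultimately show "\<exists>M. \<forall>m\<ge>M. \<forall>n\<ge>M. dist (ell2_nth (X m) i) (ell2_nth (X n) i) < e"
      by (intro exI[of _ M] allI impI) (rule le_less_trans, assumption, blast)
  qed
  then have "\<exists>l. (\<lambda>m. ell2_nth (X m) i) \<longlonglongrightarrow> l" for i
    unfolding convergent_def[symmetric] by (rule Cauchy_convergent)
  then obtain f where f: "\<And>i. (\<lambda>m. ell2_nth (X m) i) \<longlonglongrightarrow> f i" by metis
  have bound: "(\<Sum>i\<in>F. (norm (ell2_nth (X m) i - f i))\<^sup>2) \<le> e\<^sup>2"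
    if M: "\<And>m n. m \<ge> M \<Longrightarrow> n \<ge> M \<Longrightarrow> dist (X m) (X n) < e" and "m \<ge> M" "finite F" for M m e F
  proof (rule LIMSEQ_le_const2)
    show "(\<lambda>n. \<Sum>i\<in>F. (norm (ell2_nth (X m) i - ell2_nth (X n) i))\<^sup>2)
        \<longlonglongrightarrow> (\<Sum>i\<in>F. (norm (ell2_nth (X m) i - f i))\<^sup>2)"
      by (intro tendsto_intros f)
    have "(\<Sum>i\<in>F. (norm (ell2_nth (X m) i - ell2_nth (X n) i))\<^sup>2) \<le> e\<^sup>2" if "n \<ge> M" for n
    proof -
      have "(\<Sum>i\<in>F. (norm (ell2_nth (X m) i - ell2_nth (X n) i))\<^sup>2) \<le> (norm (X m - X n))\<^sup>2"
        using sum_le_norm_ell2[OF \<open>finite F\<close>, of "X m - X n"] by (simp add: ell2_nth_diff)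
      also have "\<dots> \<le> e\<^sup>2"
        using M[OF \<open>m \<ge> M\<close> \<open>n \<ge> M\<close>] by (intro power_mono) (auto simp: dist_norm)
      finally show ?thesis .
    qed
    then show "\<exists>N. \<forall>n\<ge>N. (\<Sum>i\<in>F. (norm (ell2_nth (X m) i - ell2_nth (X n) i))\<^sup>2) \<le> e\<^sup>2"
      by blast
  qed
  have diff: "(\<lambda>i. (norm (ell2_nth (X m) i - f i))\<^sup>2) summable_on UNIV"
    if M: "\<And>m n. m \<ge> M \<Longrightarrow> n \<ge> M \<Longrightarrow> dist (X m) (X n) < e" and "m \<ge> M" for M m e
  proof (rule nonneg_bdd_above_summable_on)
    show "bdd_above (sum (\<lambda>i. (norm (ell2_nth (X m) i - f i))\<^sup>2) ` {F. F \<subseteq> UNIV \<and> finite F})"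
      by (rule bdd_aboveI2[where M="e\<^sup>2"], rule bound[OF M \<open>m \<ge> M\<close>]) simp_all
  qed simp
  obtain M1 where M1: "\<And>m n. m \<ge> M1 \<Longrightarrow> n \<ge> M1 \<Longrightarrow> dist (X m) (X n) < 1"
    using metric_CauchyD[OF X, of 1] by auto
  have "(\<lambda>i. (norm (ell2_nth (X M1) i + - (ell2_nth (X M1) i - f i)))\<^sup>2) summable_on UNIV"
    by (rule square_summable_add[OF ell2_summable]) (use diff[OF M1, of M1] in \<open>simp add: norm_minus_commute\<close>)
  then have fs: "(\<lambda>i. (norm (f i))\<^sup>2) summable_on UNIV" by simp
  define y where "y = Abs_ell2 f"
  have y: "ell2_nth y = f" unfolding y_def by (rule Abs_ell2_inverse) (simp add: fs)
  have "X \<longlonglongrightarrow> y"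
  proof (rule metric_LIMSEQ_I)
    fix e :: real assume e: "0 < e"
    then obtain M where M: "\<And>m n. m \<ge> M \<Longrightarrow> n \<ge> M \<Longrightarrow> dist (X m) (X n) < e / 2"
      using metric_CauchyD[OF X, of "e / 2"] by auto
    have "dist (X m) y < e" if "m \<ge> M" for m
    proof -
      have "(norm (X m - y))\<^sup>2 \<le> (e / 2)\<^sup>2"
        unfolding norm_ell2_square ell2_nth_diff y
        by (rule infsum_le_finite_sums[OF diff[OF M that] bound[OF M that]])
      then have "norm (X m - y) \<le> e / 2" using e by (simp add: power2_le_iff_abs_le)
      then show ?thesis using e by (simp add: dist_norm)
    qed
    then show "\<exists>M. \<forall>m\<ge>M. dist (X m) y < e" by blast
  qed
  then show "convergent X" by (rule convergentI)
qed

instantiation ell2 :: (type, complex_hilbert) complex_hilbert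
begin

lift_definition scaleC_ell2 :: "complex \<Rightarrow> ('a, 'b) ell2 \<Rightarrow> ('a, 'b) ell2"
  is "\<lambda>c f i. c *\<^sub>C f i" by (simp add: power_mult_distrib summable_on_cmult_right)
definition cinner_ell2 :: "('a, 'b) ell2 \<Rightarrow> ('a, 'b) ell2 \<Rightarrow> complex"
  where "cinner_ell2 x y = (\<Sum>\<^sub>\<infinity>i. cinner (ell2_nth x i) (ell2_nth y i))"

instance
proof
  fix x y z :: "('a, 'b) ell2" and c d :: complex and r :: real
  show "c *\<^sub>C (x + y) = c *\<^sub>C x + c *\<^sub>C y" by transfer (simp add: scaleC_add_right)
  show "(c + d) *\<^sub>C x = c *\<^sub>C x + d *\<^sub>C x" by transfer (simp add: scaleC_add_left)
  show "c *\<^sub>C d *\<^sub>C x = (c * d) *\<^sub>C x" by transfer (simp add: scaleC_scaleC)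
  show "complex_of_real r *\<^sub>C x = r *\<^sub>R x" by transfer (simp add: scaleC_of_real)
  show "cinner x y = cnj (cinner y x)"
    unfolding cinner_ell2_def infsum_cnj[symmetric] by (subst cinner_commute) (rule refl)
  show "cinner (x + y) z = cinner x z + cinner y z"
    by (simp add: cinner_ell2_def plus_ell2.rep_eq cinner_add_left infsum_add ell2_cinner_summable)
  show "cinner (c *\<^sub>C x) y = c * cinner x y"
    by (simp add: cinner_ell2_def scaleC_ell2.rep_eq cinner_scaleC_left infsum_cmult_right')
  show "Re (cinner x y) = inner x y"
    unfolding cinner_ell2_def inner_ell2_def infsum_Re[OF ell2_cinner_summable, symmetric] Re_cinner
    by (rule refl)
qed

end

definition ket :: "'i \<Rightarrow> ('i, complex) ell2" where
  "ket i = Abs_ell2 (\<lambda>j. if j = i then 1 else 0)"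

lemma finite_support_square_summable:
  assumes "finite {i. f i \<noteq> (0::'h::complex_hilbert)}"
  shows "(\<lambda>i. (norm (f i))\<^sup>2) summable_on UNIV"
proof -
  have "(\<lambda>i. (norm (f i))\<^sup>2) summable_on {i. f i \<noteq> 0}" using assms by simp
  then show ?thesis by (rule summable_on_cong_neutral[THEN iffD1, rotated -1]) auto
qed

lemma ell2_nth_ket: "ell2_nth (ket i) = (\<lambda>j. if j = i then 1 else 0)"
  unfolding ket_def
  by (rule Abs_ell2_inverse) (auto intro!: finite_support_square_summable)

text \<open>
  Identifying \<open>\<ell>\<^sup>2(I) \<otimes> H\<close> with \<open>\<ell>\<^sup>2(I; H)\<close>, the elementary tensor \<open>x \<otimes> h\<close> is the family
  \<open>(x\<^sub>i h)\<^sub>i\<close>, and \<open>N \<otimes> H\<close> for \<open>N \<subseteq> \<ell>\<^sup>2(I)\<close> is the closed span of the elementary tensors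
  \<open>x \<otimes> h\<close> with \<open>x \<in> N\<close>. For a bounded operator \<open>T : N \<rightarrow> N\<close>, the operator \<open>T \<otimes> I\<^sub>H\<close> is the unique
  bounded operator on \<open>N \<otimes> H\<close> that maps \<open>x \<otimes> h\<close> to \<open>T x \<otimes> h\<close>.
\<close>

definition tensor :: "('i, complex) ell2 \<Rightarrow> 'h::complex_hilbert \<Rightarrow> ('i, 'h) ell2" where
  "tensor x h = Abs_ell2 (\<lambda>i. ell2_nth x i *\<^sub>C h)"

lemma ell2_nth_tensor: "ell2_nth (tensor x h) i = ell2_nth x i *\<^sub>C h"
  unfolding tensor_def
  by (subst Abs_ell2_inverse)
    (auto simp: power_mult_distrib intro!: summable_on_cmult_left ell2_summable)

lemma cinner_tensor: "cinner (tensor x h) (tensor y g) = cinner x y * cinner h g"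
  unfolding cinner_ell2_def infsum_cmult_left'[symmetric]
  by (rule infsum_cong)
    (simp add: ell2_nth_tensor cinner_scaleC_left cinner_scaleC_right cinner_complex_def)

definition tensor_space ::
  "('i, complex) ell2 set \<Rightarrow> ('i, 'h::complex_hilbert) ell2 set" where
  "tensor_space N = closure (complex_vector.span {tensor x h | x h. x \<in> N})"

definition tensor_id ::
  "('i, complex) ell2 set \<Rightarrow> (('i, complex) ell2 \<Rightarrow> ('i, complex) ell2) \<Rightarrow>
   ('i, 'h::complex_hilbert) ell2 \<Rightarrow> ('i, 'h) ell2" where
  "tensor_id N T = (THE R.
     bounded_clinear_on (tensor_space N) R \<and>
     R ` tensor_space N \<subseteq> tensor_space N \<and>
     (\<forall>x\<in>N. \<forall>h. R (tensor x h) = tensor (T x) h) \<and>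
     (\<forall>v. v \<notin> tensor_space N \<longrightarrow> R v = 0))"


section \<open>Words and polynomials\<close>

text \<open>
  The word \<open>g\<^bsub>j\<^sub>1\<^esub> \<cdots> g\<^bsub>j\<^sub>p\<^esub>\<close> of the free monoid on \<open>n\<close> generators is the list \<open>[j\<^sub>1, \<dots>, j\<^sub>p]\<close> with
  entries in \<open>{1..n}\<close>. The elements \<open>(\<alpha>\<^sub>1, \<dots>, \<alpha>\<^sub>k)\<close> of the product of \<open>k\<close> such monoids are extensional
  functions on \<open>{1..k}\<close>.
\<close>

definition words :: "nat \<Rightarrow> nat list set" where
  "words n = lists {1..n}"

definition multiwords :: "nat \<Rightarrow> (nat \<Rightarrow> nat) \<Rightarrow> (nat \<Rightarrow> nat list) set" where
  "multiwords k n = (\<Pi>\<^sub>E i\<in>{1..k}. words (n i))"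

definition op_word :: "(nat \<Rightarrow> 'a \<Rightarrow> 'a) \<Rightarrow> nat list \<Rightarrow> 'a \<Rightarrow> 'a" where
  "op_word X w = foldr (\<lambda>j T. X j \<circ> T) w id"

definition op_multiword ::
  "nat \<Rightarrow> (nat \<Rightarrow> nat \<Rightarrow> 'a \<Rightarrow> 'a) \<Rightarrow> (nat \<Rightarrow> nat list) \<Rightarrow> 'a \<Rightarrow> 'a" where
  "op_multiword k X \<alpha> = foldr (\<lambda>i T. op_word (X i) (\<alpha> i) \<circ> T) [1..<Suc k] id"

text \<open>
  In the algebra of polynomials in the \<open>Z\<^sub>i\<^sub>,\<^sub>j\<close>, where \<open>Z\<^sub>s\<^sub>,\<^sub>j\<close> and \<open>Z\<^sub>t\<^sub>,\<^sub>l\<close> commute for \<open>s \<noteq> t\<close>, the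
  monomials \<open>Z\<^sub>(\<^sub>\<alpha>\<^sub>) = Z\<^sub>1\<^sub>,\<^sub>\<alpha>\<^sub>1 \<cdots> Z\<^sub>k\<^sub>,\<^sub>\<alpha>\<^sub>k\<close> form a linear basis. A polynomial is its finitely supported
  family of coefficients.
\<close>

type_synonym nc_poly = "(nat \<Rightarrow> nat list) \<Rightarrow>\<^sub>0 complex"

definition nc_polys :: "nat \<Rightarrow> (nat \<Rightarrow> nat) \<Rightarrow> nc_poly set" where
  "nc_polys k n = {q. Poly_Mapping.keys q \<subseteq> multiwords k n}"

definition poly_op ::
  "nat \<Rightarrow> nc_poly \<Rightarrow> (nat \<Rightarrow> nat \<Rightarrow> 'a \<Rightarrow> 'a) \<Rightarrow> 'a \<Rightarrow> 'a::complex_hilbert" where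
  "poly_op k q X v =
     (\<Sum>\<alpha>\<in>Poly_Mapping.keys q. Poly_Mapping.lookup q \<alpha> *\<^sub>C op_multiword k X \<alpha> v)"


section \<open>Positive regular free holomorphic functions and noncommutative varieties\<close>

definition positive_regular :: "nat \<Rightarrow> (nat list \<Rightarrow> real) \<Rightarrow> bool" where
  "positive_regular n a \<longleftrightarrow>
     (\<forall>\<alpha>\<in>words n. 0 \<le> a \<alpha>) \<and> a [] = 0 \<and> (\<forall>j\<in>{1..n}. 0 < a [j]) \<and>
     limsup (\<lambda>p. ereal ((\<Sum>\<alpha> | \<alpha> \<in> words n \<and> length \<alpha> = p. \<bar>a \<alpha>\<bar>\<^sup>2) powr (1 / (2 * real p)))) < \<infinity>"

definition Phi ::
  "nat \<Rightarrow> (nat list \<Rightarrow> real) \<Rightarrow> (nat \<Rightarrow> 'a \<Rightarrow> 'a) \<Rightarrow> ('a \<Rightarrow> 'a) \<Rightarrow> 'a::complex_hilbert \<Rightarrow> 'a" where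
  "Phi n a A Y =
     wot_sum (\<lambda>\<alpha> x. a \<alpha> *\<^sub>R op_word A \<alpha> (Y (adjoint_op (op_word A \<alpha>) x))) (words n)"

text \<open>The composition \<open>\<Phi>\<^bsub>f\<^sub>1,A\<^sub>1\<^esub>\<^bsup>s\<^sub>1\<^esup> \<circ> \<cdots> \<circ> \<Phi>\<^bsub>f\<^sub>k,A\<^sub>k\<^esub>\<^bsup>s\<^sub>k\<^esup>\<close>.\<close>

definition Phi_multi ::
  "nat \<Rightarrow> (nat \<Rightarrow> nat) \<Rightarrow> (nat \<Rightarrow> nat list \<Rightarrow> real) \<Rightarrow> (nat \<Rightarrow> nat \<Rightarrow> 'a \<Rightarrow> 'a) \<Rightarrow>
   (nat \<Rightarrow> nat) \<Rightarrow> ('a \<Rightarrow> 'a) \<Rightarrow> 'a::complex_hilbert \<Rightarrow> 'a" where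
  "Phi_multi k n a A s =
     foldr (\<lambda>i F. (Phi (n i) (a i) (A i) ^^ s i) \<circ> F) [1..<Suc k] id"

definition b_coeff :: "(nat list \<Rightarrow> real) \<Rightarrow> nat \<Rightarrow> nat list \<Rightarrow> real" where
  "b_coeff a m \<alpha> =
     (if \<alpha> = [] then 1
      else \<Sum>p = 1..length \<alpha>.
             \<Sum>\<gamma> | length \<gamma> = p \<and> concat \<gamma> = \<alpha> \<and> (\<forall>g\<in>set \<gamma>. 1 \<le> length g).
               prod_list (map a \<gamma>) * real ((p + m - 1) choose (m - 1)))"

text \<open>
  The Fock space \<open>F\<^sup>2(H\<^sub>n)\<close> is the subspace of families supported on \<open>words n\<close>, with \<open>e\<^sub>\<alpha> = ket \<alpha>\<close>, and
  the tensor product of the Fock spaces is the subspace of families supported on \<open>multiwords k n\<close>,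
  with \<open>x\<^sub>1 \<otimes> \<cdots> \<otimes> x\<^sub>k = (x\<^sub>1(\<alpha>\<^sub>1) \<cdots> x\<^sub>k(\<alpha>\<^sub>k))\<^sub>(\<^sub>\<alpha>\<^sub>)\<close>, see \<open>elementary\<close> below.
\<close>

definition fock :: "nat \<Rightarrow> (nat list, complex) ell2 set" where
  "fock n = {x. \<forall>\<alpha>. \<alpha> \<notin> words n \<longrightarrow> ell2_nth x \<alpha> = 0}"

definition fock_tensor :: "nat \<Rightarrow> (nat \<Rightarrow> nat) \<Rightarrow> (nat \<Rightarrow> nat list, complex) ell2 set" where
  "fock_tensor k n = {x. \<forall>\<alpha>. \<alpha> \<notin> multiwords k n \<longrightarrow> ell2_nth x \<alpha> = 0}"

definition weighted_shift ::
  "nat \<Rightarrow> (nat list \<Rightarrow> real) \<Rightarrow> nat \<Rightarrow> nat \<Rightarrow>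
   (nat list, complex) ell2 \<Rightarrow> (nat list, complex) ell2" where
  "weighted_shift n a m j x = Abs_ell2 (\<lambda>\<alpha>. case \<alpha> of
       [] \<Rightarrow> 0
     | l # \<beta> \<Rightarrow> if l = j \<and> \<beta> \<in> words n
                then of_real (sqrt (b_coeff a m \<beta> / b_coeff a m (j # \<beta>))) * ell2_nth x \<beta> else 0)"

lemma weighted_shift_ket:
  assumes "\<alpha> \<in> words n"
  shows "weighted_shift n a m j (ket \<alpha>) =
    of_real (sqrt (b_coeff a m \<alpha> / b_coeff a m (j # \<alpha>))) *\<^sub>C ket (j # \<alpha>)"
proof -
  have "(\<lambda>\<beta>. case \<beta> of [] \<Rightarrow> 0 | l # \<beta>' \<Rightarrow> if l = j \<and> \<beta>' \<in> words n
      then of_real (sqrt (b_coeff a m \<beta>' / b_coeff a m (j # \<beta>'))) * ell2_nth (ket \<alpha>) \<beta>' else 0)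
    = ell2_nth (complex_of_real (sqrt (b_coeff a m \<alpha> / b_coeff a m (j # \<alpha>))) *\<^sub>C ket (j # \<alpha>))"
    using assms
    by (auto simp: fun_eq_iff scaleC_ell2.rep_eq ell2_nth_ket scaleC_complex_def split: list.split)
  then show ?thesis unfolding weighted_shift_def by (simp add: ell2_nth_inverse)
qed

text \<open>
  \<open>ampliation i T\<close> is \<open>I \<otimes> \<cdots> \<otimes> T \<otimes> \<cdots> \<otimes> I\<close> with \<open>T\<close> in the \<open>i\<close>-th position: \<open>T\<close> acts on the \<open>i\<close>-th
  variable while the others are kept fixed. See \<open>ampliation_elementary\<close> below.
\<close>

definition slice ::
  "nat \<Rightarrow> (nat \<Rightarrow> 'w) \<Rightarrow> (nat \<Rightarrow> 'w, complex) ell2 \<Rightarrow> ('w, complex) ell2" where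
  "slice i \<alpha> x = Abs_ell2 (\<lambda>w. ell2_nth x (\<alpha>(i := w)))"

definition ampliation ::
  "nat \<Rightarrow> (('w, complex) ell2 \<Rightarrow> ('w, complex) ell2) \<Rightarrow>
   (nat \<Rightarrow> 'w, complex) ell2 \<Rightarrow> (nat \<Rightarrow> 'w, complex) ell2" where
  "ampliation i T x = Abs_ell2 (\<lambda>\<alpha>. ell2_nth (T (slice i \<alpha> x)) (\<alpha> i))"

definition elementary ::
  "nat \<Rightarrow> (nat \<Rightarrow> nat) \<Rightarrow> (nat \<Rightarrow> (nat list, complex) ell2) \<Rightarrow>
   (nat \<Rightarrow> nat list, complex) ell2" where
  "elementary k n x = Abs_ell2
     (\<lambda>\<alpha>. if \<alpha> \<in> multiwords k n then \<Prod>i\<in>{1..k}. ell2_nth (x i) (\<alpha> i) else 0)"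

lemma ell2_nth_elementary:
  "ell2_nth (elementary k n x) \<alpha> =
     (if \<alpha> \<in> multiwords k n then \<Prod>i\<in>{1..k}. ell2_nth (x i) (\<alpha> i) else 0)"
proof -
  let ?f = "\<lambda>\<alpha>. if \<alpha> \<in> multiwords k n then \<Prod>i\<in>{1..k}. ell2_nth (x i) (\<alpha> i) else 0"
  have "sum (\<lambda>\<alpha>. (cmod (?f \<alpha>))\<^sup>2) F \<le> (\<Prod>i\<in>{1..k}. (norm (x i))\<^sup>2)" if F: "finite F" for F
  proof -
    define B where "B = (\<lambda>i. (\<lambda>\<alpha>. \<alpha> i) ` F)"
    have B: "finite (B i)" for i using F by (simp add: B_def)
    have "sum (\<lambda>\<alpha>. (cmod (?f \<alpha>))\<^sup>2) F = sum (\<lambda>\<alpha>. (cmod (?f \<alpha>))\<^sup>2) (F \<inter> multiwords k n)"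
      using F by (intro sum.mono_neutral_right) auto
    also have "\<dots> = (\<Sum>\<alpha>\<in>F \<inter> multiwords k n. \<Prod>i\<in>{1..k}. (cmod (ell2_nth (x i) (\<alpha> i)))\<^sup>2)"
      by (intro sum.cong refl) (simp add: prod_norm[symmetric] prod_power_distrib)
    also have "\<dots> \<le> (\<Sum>\<alpha>\<in>PiE {1..k} B. \<Prod>i\<in>{1..k}. (cmod (ell2_nth (x i) (\<alpha> i)))\<^sup>2)"
      by (intro sum_mono2 finite_PiE B)
        (auto simp: B_def multiwords_def PiE_iff intro!: prod_nonneg)
    also have "\<dots> = (\<Prod>i\<in>{1..k}. \<Sum>w\<in>B i. (cmod (ell2_nth (x i) w))\<^sup>2)"
      by (rule prod_sum_PiE[symmetric]) (simp_all add: B)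
    also have "\<dots> \<le> (\<Prod>i\<in>{1..k}. (norm (x i))\<^sup>2)"
      by (intro prod_mono conjI sum_nonneg sum_le_norm_ell2 B) simp
    finally show ?thesis .
  qed
  then have "(\<lambda>\<alpha>. (cmod (?f \<alpha>))\<^sup>2) summable_on UNIV"
    by (intro nonneg_bdd_above_summable_on bdd_aboveI2[where M="\<Prod>i\<in>{1..k}. (norm (x i))\<^sup>2"]) auto
  then show ?thesis unfolding elementary_def by (subst Abs_ell2_inverse) simp_all
qed

lemma ampliation_elementary:
  assumes i: "i \<in> {1..k}" and x: "x i \<in> fock (n i)" and Tx: "T (x i) \<in> fock (n i)"
    and T: "\<And>c y. T (c *\<^sub>C y) = c *\<^sub>C T y"
  shows "ampliation i T (elementary k n x) = elementary k n (x(i := T (x i)))"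
proof -
  have "ell2_nth (T (slice i \<alpha> (elementary k n x))) (\<alpha> i) =
      ell2_nth (elementary k n (x(i := T (x i)))) \<alpha>" for \<alpha>
  proof -
    define c where "c = (if \<exists>w. \<alpha>(i := w) \<in> multiwords k n
      then \<Prod>l\<in>{1..k} - {i}. ell2_nth (x l) (\<alpha> l) else 0)"
    have prod: "(\<Prod>l\<in>{1..k}. g l) = g i * (\<Prod>l\<in>{1..k} - {i}. g l)" for g :: "nat \<Rightarrow> complex"
      using i by (simp add: prod.remove)
    have mw: "\<alpha>(i := w) \<in> multiwords k n \<longleftrightarrow>
        (\<exists>w. \<alpha>(i := w) \<in> multiwords k n) \<and> w \<in> words (n i)" for w
      using i by (auto simp: multiwords_def PiE_iff extensional_def split: if_splits)
    have "ell2_nth (elementary k n x) (\<alpha>(i := w)) = ell2_nth (c *\<^sub>C x i) w" for w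
      using x mw[of w]
      by (auto simp: ell2_nth_elementary prod c_def scaleC_ell2.rep_eq scaleC_complex_def fock_def
          simp del: One_nat_def)
    then have "slice i \<alpha> (elementary k n x) = c *\<^sub>C x i"
      by (simp add: slice_def ell2_nth_inverse)
    then have "ell2_nth (T (slice i \<alpha> (elementary k n x))) (\<alpha> i) = c * ell2_nth (T (x i)) (\<alpha> i)"
      by (simp add: T scaleC_ell2.rep_eq scaleC_complex_def)
    also have "\<dots> = ell2_nth (elementary k n (x(i := T (x i)))) \<alpha>"
      using Tx mw[of "\<alpha> i"] by (auto simp: ell2_nth_elementary prod c_def fock_def simp del: One_nat_def)
    finally show ?thesis .
  qed
  then show ?thesis by (simp add: ampliation_def ell2_nth_inverse)
qed

definition multishift ::
  "(nat \<Rightarrow> nat) \<Rightarrow> (nat \<Rightarrow> nat) \<Rightarrow> (nat \<Rightarrow> nat list \<Rightarrow> real) \<Rightarrow> nat \<Rightarrow> nat \<Rightarrow>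
   (nat \<Rightarrow> nat list, complex) ell2 \<Rightarrow> (nat \<Rightarrow> nat list, complex) ell2" where
  "multishift n m a i j = ampliation i (weighted_shift (n i) (a i) (m i) j)"

definition vacuum :: "nat \<Rightarrow> (nat \<Rightarrow> nat list, complex) ell2" where
  "vacuum k = ket (\<lambda>i\<in>{1..k}. [])"

definition M_space ::
  "nat \<Rightarrow> (nat \<Rightarrow> nat) \<Rightarrow> (nat \<Rightarrow> nat) \<Rightarrow> (nat \<Rightarrow> nat list \<Rightarrow> real) \<Rightarrow> nc_poly set \<Rightarrow>
   (nat \<Rightarrow> nat list, complex) ell2 set" where
  "M_space k n m a Q = closure (complex_vector.span
     {op_multiword k (multishift n m a) \<alpha>
        (poly_op k q (multishift n m a)
          (op_multiword k (multishift n m a) \<beta> (c *\<^sub>C vacuum k)))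
      | \<alpha> q \<beta> c. \<alpha> \<in> multiwords k n \<and> \<beta> \<in> multiwords k n \<and> q \<in> Q})"

definition N_space ::
  "nat \<Rightarrow> (nat \<Rightarrow> nat) \<Rightarrow> (nat \<Rightarrow> nat) \<Rightarrow> (nat \<Rightarrow> nat list \<Rightarrow> real) \<Rightarrow> nc_poly set \<Rightarrow>
   (nat \<Rightarrow> nat list, complex) ell2 set" where
  "N_space k n m a Q = {x \<in> fock_tensor k n. \<forall>y\<in>M_space k n m a Q. cinner x y = 0}"

definition universal_model ::
  "nat \<Rightarrow> (nat \<Rightarrow> nat) \<Rightarrow> (nat \<Rightarrow> nat) \<Rightarrow> (nat \<Rightarrow> nat list \<Rightarrow> real) \<Rightarrow> nc_poly set \<Rightarrow>
   nat \<Rightarrow> nat \<Rightarrow> (nat \<Rightarrow> nat list, complex) ell2 \<Rightarrow> (nat \<Rightarrow> nat list, complex) ell2" where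
  "universal_model k n m a Q i j x = proj_on (N_space k n m a Q) (multishift n m a i j x)"

text \<open>The operator \<open>S\<^sub>i\<^sub>,\<^sub>j\<^sup>* \<otimes> I\<^sub>H\<close> on \<open>N \<otimes> H\<close>, with the adjoint taken in \<open>N\<close>.\<close>

definition universal_model_adj ::
  "nat \<Rightarrow> (nat \<Rightarrow> nat) \<Rightarrow> (nat \<Rightarrow> nat) \<Rightarrow> (nat \<Rightarrow> nat list \<Rightarrow> real) \<Rightarrow> nc_poly set \<Rightarrow>
   nat \<Rightarrow> nat \<Rightarrow> (nat \<Rightarrow> nat list, 'h::complex_hilbert) ell2 \<Rightarrow> (nat \<Rightarrow> nat list, 'h) ell2" where
  "universal_model_adj k n m a Q i j =
     (let N = N_space k n m a Q
      in tensor_id N (adjoint_on N (universal_model k n m a Q i j)))"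

end

theory Submission
  imports Defs
begin

text \<open>
  Expanding the powers of the \<open>\<Phi>\<^bsub>f\<^sub>i,A\<^sub>i\<^esub>\<close> turns the hypothesis into
  \<open>\<Sum> b\<^sub>(\<^sub>\<alpha>\<^sub>) \<parallel>A\<^sub>(\<^sub>\<alpha>\<^sub>)\<^sup>* h\<parallel>\<^sup>2 \<le> b \<parallel>h\<parallel>\<^sup>2\<close> over all multiwords \<open>(\<alpha>)\<close>, where
  \<open>b\<^sub>(\<^sub>\<alpha>\<^sub>)\<close> is the product of the \<open>b\<^bsub>i,\<alpha>\<^sub>i\<^esub>\<close>. So the Poisson kernel
  \<open>Y h = \<Sum> e\<^sub>(\<^sub>\<alpha>\<^sub>) \<otimes> \<surd>b\<^sub>(\<^sub>\<alpha>\<^sub>) A\<^sub>(\<^sub>\<alpha>\<^sub>)\<^sup>* h\<close> is bounded, and the term of the empty multiword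
  bounds it below by \<open>\<parallel>h\<parallel>\<close>. It satisfies \<open>(\<^bold>W\<^sub>i\<^sub>,\<^sub>j\<^sup>* \<otimes> I) Y = Y A\<^sub>i\<^sub>,\<^sub>j\<^sup>*\<close>. This and \<open>q(A) = 0\<close> put its
  range into \<open>N\<^sub>Q \<otimes> H\<close>, on which \<open>\<^bold>S\<^sub>i\<^sub>,\<^sub>j\<^sup>* \<otimes> I\<close> is the restriction of \<open>\<^bold>W\<^sub>i\<^sub>,\<^sub>j\<^sup>* \<otimes> I\<close>.
\<close>

section \<open>Projections and operators on Hilbert spaces\<close>

text \<open>Positivity shapes the expansion: only lower bounds of quadratic forms by finite partial
  sums are used, so no two infinite operator sums are ever interchanged, and a finite index set may
  be enlarged to a product set at no cost. The binomial coefficients fit because, for m \<ge> 1,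
  \<open>b_coeff a m\<close> lists the coefficients of (1 - f)^(-m), the sum over s of binom(s+m-1,
  m-1) f^s. The square roots in the kernel are forced: the weights of the shifts are quotients of
  consecutive square roots of \<open>b_coeff\<close>, and an adjoint applies the leftmost letter of
  a word first, which is the letter that the shift prepends. The other burden is that
  \<open>wot_sum\<close>, \<open>proj_on\<close>, \<open>adjoint_on\<close> and
  \<open>tensor_id\<close> are definite descriptions and that \<open>Abs_ell2\<close> is meaningful
  only on square-summable families, so existence, uniqueness and summability accompany every
  construction. Membership in the tensor product with \<open>H\<close> is decided by slices, which
  reduce it to scalar-valued families.\<close>

lemma bounded_bilinear_cinner: "bounded_bilinear (cinner :: 'a::complex_hilbert \<Rightarrow> 'a \<Rightarrow> complex)"
proof
  fix x y z :: 'a and r :: real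
  show "cinner (x + y) z = cinner x z + cinner y z" by (rule cinner_add_left)
  show "cinner x (y + z) = cinner x y + cinner x z" by (rule cinner_add_right)
  show "cinner (r *\<^sub>R x) y = r *\<^sub>R cinner x y"
    by (simp add: scaleC_of_real[symmetric] cinner_scaleC_left scaleC_complex_def)
  show "cinner x (r *\<^sub>R y) = r *\<^sub>R cinner x y"
    by (simp add: scaleC_of_real[symmetric] cinner_scaleC_right scaleC_complex_def)
  show "\<exists>K. \<forall>x y::'a. cmod (cinner x y) \<le> norm x * norm y * K"
    by (intro exI[of _ 1]) (simp add: norm_cinner_le)
qed

text \<open>Conjugate-linearity in the second slot is plain linearity over the reals, so the library
  rules for differences, sums and continuity of bounded bilinear maps apply to
  \<open>cinner\<close>.\<close>

interpretation cinner: bounded_bilinear "cinner :: 'a::complex_hilbert \<Rightarrow> 'a \<Rightarrow> complex"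
  by (rule bounded_bilinear_cinner)

lemma bounded_linear_scaleC: "bounded_linear (\<lambda>x::'a::complex_hilbert. c *\<^sub>C x)"
proof (rule bounded_linear_intro[where K="cmod c"])
  show "c *\<^sub>C r *\<^sub>R x = r *\<^sub>R c *\<^sub>C x" for r and x :: 'a
    by (simp add: scaleC_of_real[symmetric] scaleC_scaleC mult.commute)
qed (simp_all add: scaleC_add_right mult.commute)

lemma cinner_eq_zero_iff: "cinner x x = 0 \<longleftrightarrow> x = (0::'a::complex_hilbert)"
  by (simp add: cinner_self)

lemma cinner_ext:
  assumes "\<And>z. cinner x z = cinner y (z::'a::complex_hilbert)"
  shows "x = y"
  using assms[of "x - y"] cinner_eq_zero_iff[of "x - y"] by (simp add: cinner.diff_left)

lemma closed_orthogonal: "closed {x::'a::complex_hilbert. cinner x y = 0}"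
  by (intro closed_Collect_eq continuous_on_const linear_continuous_on cinner.bounded_linear_left)

lemma closed_orthogonal_right: "closed {x::'a::complex_hilbert. cinner y x = 0}"
  by (intro closed_Collect_eq continuous_on_const linear_continuous_on cinner.bounded_linear_right)

text \<open>Testing against the multiple of \<open>z\<close> by \<i> turns the imaginary part of
  \<open>cinner w z\<close> into a real inner product as well. Projections can therefore be found
  with real inner products only.\<close>

lemma orthogonal_of_inner_zero:
  assumes "complex_vector.subspace U" and "\<And>z. z \<in> U \<Longrightarrow> inner w z = 0" and "z \<in> U"
  shows "cinner w (z::'a::complex_hilbert) = 0"
proof -
  have "\<i> *\<^sub>C z \<in> U" using assms(1,3) by (rule complex_vector.subspace_scale)
  then have "inner w z = 0" "inner w (\<i> *\<^sub>C z) = 0" using assms(2,3) by auto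
  then show ?thesis
    by (simp add: Re_cinner[symmetric] cinner_scaleC_right complex_eq_iff)
qed

text \<open>A minimising sequence for the distance is Cauchy by the parallelogram law; the error at
  the nearest point is orthogonal to \<open>U\<close>, since moving inside \<open>U\<close> cannot
  shorten it.\<close>

lemma closed_csubspace_projection_exists:
  fixes U :: "'a::complex_hilbert set"
  assumes "closed_csubspace U"
  shows "\<exists>y\<in>U. \<forall>z\<in>U. cinner (x - y) z = 0"
proof -
  have U: "complex_vector.subspace U" "closed U" using assms by (auto simp: closed_csubspace_def)
  have UR: "r *\<^sub>R u \<in> U" if "u \<in> U" for r u
    using complex_vector.subspace_scale[OF U(1) that, of "of_real r"] by (simp add: scaleC_of_real)
  define d where "d = (INF u\<in>U. (norm (x - u))\<^sup>2)"
  have bdd: "bdd_below ((\<lambda>u. (norm (x - u))\<^sup>2) ` U)" by (rule bdd_belowI2[of _ 0]) simp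
  have d_le: "d \<le> (norm (x - u))\<^sup>2" if "u \<in> U" for u
    unfolding d_def using bdd that by (rule cINF_lower)
  have ne: "U \<noteq> {}" using complex_vector.subspace_0[OF U(1)] by auto
  have "\<exists>u\<in>U. (norm (x - u))\<^sup>2 < d + 1 / real (Suc l)" for l
    using cINF_less_iff[OF ne bdd, of "d + 1 / real (Suc l)"] by (simp add: d_def)
  then obtain u where uU: "\<And>l. u l \<in> U" and u: "\<And>l. (norm (x - u l))\<^sup>2 < d + 1 / real (Suc l)"
    by metis
  have par: "(norm (u p - u q))\<^sup>2 \<le> 2 / real (Suc p) + 2 / real (Suc q)" for p q
  proof -
    \<comment> \<open>The midpoint of \<open>u p\<close> and \<open>u q\<close> lies in
      \<open>U\<close>; its distance enters the parallelogram law for \<open>x - u p\<close> and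
      \<open>x - u q\<close>.\<close>
    have "d \<le> (norm (x - (1/2) *\<^sub>R (u p + u q)))\<^sup>2"
      by (intro d_le UR complex_vector.subspace_add[OF U(1)] uU)
    moreover have "(norm (u p - u q))\<^sup>2 = 2 * (norm (x - u p))\<^sup>2 + 2 * (norm (x - u q))\<^sup>2
        - 4 * (norm (x - (1/2) *\<^sub>R (u p + u q)))\<^sup>2"
      unfolding power2_norm_eq_inner
      by (simp add: inner_diff_left inner_diff_right inner_add_left inner_add_right inner_commute
          algebra_simps)
    ultimately show ?thesis using u[of p] u[of q] by simp
  qed
  have "Cauchy u"
  proof (rule metric_CauchyI)
    fix e :: real assume "0 < e"
    then have "0 < e\<^sup>2 / 4" by simp
    then obtain M where M: "1 / real (Suc M) < e\<^sup>2 / 4" using nat_approx_posE by blast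
    have "dist (u p) (u q) < e" if "p \<ge> M" "q \<ge> M" for p q
    proof -
      have "1 / real (Suc p) \<le> 1 / real (Suc M)" "1 / real (Suc q) \<le> 1 / real (Suc M)"
        using that by (simp_all add: field_simps)
      then have "(norm (u p - u q))\<^sup>2 < e\<^sup>2" using par[of p q] M by simp
      then show ?thesis using \<open>0 < e\<close> by (simp add: dist_norm power2_less_imp_less)
    qed
    then show "\<exists>M. \<forall>p\<ge>M. \<forall>q\<ge>M. dist (u p) (u q) < e" by blast
  qed
  then obtain y where y: "u \<longlonglongrightarrow> y" using Cauchy_convergent convergent_def by blast
  have yU: "y \<in> U" using closed_sequentially[OF U(2)] uU y by blast
  have "(\<lambda>l. (norm (x - u l))\<^sup>2) \<longlonglongrightarrow> (norm (x - y))\<^sup>2" by (intro tendsto_intros y)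
  moreover have "(\<lambda>l. d + 1 / real (Suc l)) \<longlonglongrightarrow> d + 0"
    by (intro tendsto_intros LIMSEQ_Suc[OF lim_1_over_n])
  ultimately have min: "(norm (x - y))\<^sup>2 \<le> d"
    by (intro LIMSEQ_le[where Y="\<lambda>l. d + 1 / real (Suc l)" and y=d]) (use u in \<open>auto intro: less_imp_le simp del: of_nat_Suc\<close>)
  have "inner (x - y) z = 0" if z: "z \<in> U" for z
  proof (cases "z = 0")
    case False
    \<comment> \<open>The minimiser of the quadratic polynomial that gives the squared distance from
      \<open>x\<close> to \<open>y + t *\<^sub>R z\<close>; it lowers the value by
      \<open>(inner (x - y) z)\<^sup>2 / (norm z)\<^sup>2\<close>.\<close>
    define t where "t = inner (x - y) z / (norm z)\<^sup>2"
    have "(norm (x - y))\<^sup>2 \<le> (norm (x - (y + t *\<^sub>R z)))\<^sup>2"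
      using min d_le[OF complex_vector.subspace_add[OF U(1) yU UR[OF z]]] by (rule order_trans)
    also have "\<dots> = (norm (x - y))\<^sup>2 - 2 * t * inner (x - y) z + t\<^sup>2 * (norm z)\<^sup>2"
      unfolding power2_norm_eq_inner
      by (simp add: inner_diff_left inner_diff_right inner_add_left inner_add_right inner_commute
          algebra_simps power2_eq_square)
    also have "\<dots> = (norm (x - y))\<^sup>2 - (inner (x - y) z)\<^sup>2 / (norm z)\<^sup>2"
      using False by (simp add: t_def field_simps power2_eq_square)
    finally have "(inner (x - y) z)\<^sup>2 / (norm z)\<^sup>2 \<le> 0" by simp
    then show ?thesis using False by (simp add: divide_le_0_iff)
  qed simp
  then show ?thesis using orthogonal_of_inner_zero[OF U(1)] yU by blast
qed

lemma proj_on_unique: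
  assumes "closed_csubspace U" "y \<in> U" "\<And>z. z \<in> U \<Longrightarrow> cinner (x - y) z = 0"
  shows "proj_on U x = y"
  unfolding proj_on_def
proof (rule the_equality)
  fix y' assume y': "y' \<in> U \<and> (\<forall>z\<in>U. cinner (x - y') z = 0)"
  have "y' - y \<in> U"
    using assms y' by (simp add: closed_csubspace_def complex_vector.subspace_diff)
  then have "cinner (x - y) (y' - y) - cinner (x - y') (y' - y) = 0" using assms y' by simp
  then have "cinner (y' - y) (y' - y) = 0" by (simp add: cinner.diff_left)
  then show "y' = y" by (simp add: cinner_eq_zero_iff)
qed (use assms in auto)

lemma
  assumes "closed_csubspace U"
  shows proj_on_in: "proj_on U x \<in> U"
    and proj_on_orthogonal: "z \<in> U \<Longrightarrow> cinner (x - proj_on U x) z = 0"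
proof -
  obtain y where y: "y \<in> U" "\<And>z. z \<in> U \<Longrightarrow> cinner (x - y) z = 0"
    using closed_csubspace_projection_exists[OF assms, of x] by blast
  have eq: "proj_on U x = y" by (rule proj_on_unique[OF assms y])
  show "proj_on U x \<in> U" using y(1) eq by simp
  show "cinner (x - proj_on U x) z = 0" if "z \<in> U" using y(2)[OF that] eq by simp
qed

lemma cinner_proj_on:
  assumes "closed_csubspace U" "z \<in> U"
  shows "cinner (proj_on U x) z = cinner x z"
  using proj_on_orthogonal[OF assms, of x] by (simp add: cinner.diff_left)

text \<open>The kernel is closed, so some \<open>w\<close> outside it is orthogonal to it. The
  combination of \<open>x\<close> and \<open>w\<close> with coefficients \<open>\<phi> w\<close> and
  \<open>- \<phi> x\<close> lies in the kernel, and pairing it with \<open>w\<close> expresses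
  \<open>\<phi> x\<close> by \<open>cinner x w\<close>.\<close>

lemma riesz_representation:
  fixes \<phi> :: "'a::complex_hilbert \<Rightarrow> complex"
  assumes add: "\<And>x y. \<phi> (x + y) = \<phi> x + \<phi> y" and scale: "\<And>c x. \<phi> (c *\<^sub>C x) = c * \<phi> x"
    and bound: "\<And>x. cmod (\<phi> x) \<le> K * norm x"
  shows "\<exists>z. \<forall>x. \<phi> x = cinner x z"
proof (cases "\<forall>x. \<phi> x = 0")
  case False
  then obtain x0 where x0: "\<phi> x0 \<noteq> 0" by blast
  have bl: "bounded_linear \<phi>"
    by (rule bounded_linear_intro[where K=K])
      (simp_all add: add bound mult.commute scaleC_of_real[symmetric] scale scaleC_complex_def)
  note diff = linear_diff[OF bounded_linear.linear[OF bl]]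
    and zero = linear_0[OF bounded_linear.linear[OF bl]]
  have "closed {x. \<phi> x = 0}"
    by (intro closed_Collect_eq continuous_intros linear_continuous_on bl)
  moreover have "complex_vector.subspace {x. \<phi> x = 0}"
    by (auto simp: complex_vector.subspace_def add scale zero)
  ultimately have cs: "closed_csubspace {x. \<phi> x = 0}" by (simp add: closed_csubspace_def)
  define w where "w = x0 - proj_on {x. \<phi> x = 0} x0"
  have orth: "cinner z w = 0" if "\<phi> z = 0" for z
    using proj_on_orthogonal[OF cs, of z x0] that cinner_commute[of z w] by (simp add: w_def)
  have "\<phi> (proj_on {x. \<phi> x = 0} x0) = 0" using proj_on_in[OF cs, of x0] by simp
  then have w: "\<phi> w \<noteq> 0" using x0 by (simp add: w_def diff)
  then have nw: "cinner w w \<noteq> 0" by (auto simp: cinner_eq_zero_iff zero)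
  have "\<phi> x = cinner x (cnj (\<phi> w / cinner w w) *\<^sub>C w)" for x
  proof -
    have "cinner (\<phi> w *\<^sub>C x - \<phi> x *\<^sub>C w) w = 0"
      by (intro orth) (simp add: diff scale mult.commute)
    then have "\<phi> w * cinner x w = \<phi> x * cinner w w"
      by (simp add: cinner.diff_left cinner_scaleC_left)
    then have "\<phi> x = \<phi> w / cinner w w * cinner x w" using nw by (simp add: divide_simps)
    then show ?thesis by (simp add: cinner_scaleC_right)
  qed
  then show ?thesis by blast
qed (intro exI[of _ 0], simp add: cinner.zero_right)

section \<open>Bounded operators and sesquilinear forms\<close>

abbreviation (input) bounded_op :: "('a::complex_hilbert \<Rightarrow> 'b::complex_hilbert) \<Rightarrow> bool" where
  "bounded_op \<equiv> bounded_clinear_on UNIV"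

lemma bounded_op_addD: "bounded_op T \<Longrightarrow> T (x + y) = T x + T y"
  by (simp add: bounded_clinear_on_def)

lemma bounded_op_scaleD: "bounded_op T \<Longrightarrow> T (c *\<^sub>C x) = c *\<^sub>C T x"
  by (simp add: bounded_clinear_on_def)

text \<open>On a trivial space the constant in \<open>bounded_clinear_on\<close> may be negative,
  hence the absolute value.\<close>

lemma bounded_op_boundE:
  assumes "bounded_op T"
  obtains K where "0 \<le> K" "\<And>x. norm (T x) \<le> K * norm x"
proof -
  obtain K where K: "\<And>x. norm (T x) \<le> K * norm x"
    using assms by (auto simp: bounded_clinear_on_def)
  show thesis
  proof (rule that[of "\<bar>K\<bar>"])
    show "norm (T x) \<le> \<bar>K\<bar> * norm x" for x
      using K[of x] by (rule order_trans) (simp add: mult_right_mono)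
  qed simp
qed

lemma bounded_op_imp_bounded_linear: "bounded_op T \<Longrightarrow> bounded_linear T"
proof -
  assume T: "bounded_op T"
  then obtain K where "\<And>x. norm (T x) \<le> K * norm x" by (metis bounded_op_boundE)
  then show "bounded_linear T"
    by (intro bounded_linear_intro[where K=K])
      (simp_all add: bounded_op_addD[OF T] bounded_op_scaleD[OF T] mult.commute
        scaleC_of_real[symmetric])
qed

lemma bounded_opI:
  assumes "\<And>x y. T (x + y) = T x + T y" "\<And>c x. T (c *\<^sub>C x) = c *\<^sub>C T x"
    "\<And>x. norm (T x) \<le> K * norm x"
  shows "bounded_op T"
  using assms by (auto simp: bounded_clinear_on_def)

lemma bounded_op_id: "bounded_op id"
  by (rule bounded_opI[where K=1]) simp_all

lemma bounded_op_comp: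
  assumes "bounded_op S" "bounded_op T"
  shows "bounded_op (S \<circ> T)"
proof -
  obtain K L where K: "0 \<le> K" "\<And>x. norm (S x) \<le> K * norm x"
    and L: "0 \<le> L" "\<And>x. norm (T x) \<le> L * norm x"
    using assms by (metis bounded_op_boundE)
  show ?thesis
  proof (rule bounded_opI[where K="K * L"])
    fix x
    have "norm ((S \<circ> T) x) \<le> K * norm (T x)" using K by simp
    also have "\<dots> \<le> K * (L * norm x)" using K L by (intro mult_left_mono)
    finally show "norm ((S \<circ> T) x) \<le> K * L * norm x" by (simp add: mult.assoc)
  qed (simp_all add: assms bounded_op_addD bounded_op_scaleD)
qed

text \<open>Conjugation makes \<open>B x\<close> a linear functional, which Riesz represents by the
  vector \<open>T x\<close>. Adjoints and sums of operator series are both obtained from their forms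
  in this way.\<close>

lemma bounded_sesquilinear_form_op:
  fixes B :: "'a::complex_hilbert \<Rightarrow> 'b::complex_hilbert \<Rightarrow> complex"
  assumes add_left: "\<And>x x' y. B (x + x') y = B x y + B x' y"
    and scale_left: "\<And>c x y. B (c *\<^sub>C x) y = c * B x y"
    and add_right: "\<And>x y y'. B x (y + y') = B x y + B x y'"
    and scale_right: "\<And>c x y. B x (c *\<^sub>C y) = cnj c * B x y"
    and K: "0 \<le> K" and bound: "\<And>x y. cmod (B x y) \<le> K * norm x * norm y"
  shows "\<exists>T. bounded_op T \<and> (\<forall>x y. cinner (T x) y = B x y)"
proof -
  have "\<exists>z. \<forall>y. cnj (B x y) = cinner y z" for x
    by (rule riesz_representation[where K="K * norm x"])
      (simp_all add: add_right scale_right bound)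
  then obtain T where T: "\<And>x y. cnj (B x y) = cinner y (T x)" by metis
  have T': "cinner (T x) y = B x y" for x y
    using T[of x y] by (metis cinner_commute complex_cnj_cnj)
  have "bounded_op T"
  proof (rule bounded_opI[where K=K])
    show "T (x + y) = T x + T y" for x y
      by (rule cinner_ext) (simp add: T' add_left cinner_add_left)
    show "T (c *\<^sub>C x) = c *\<^sub>C T x" for c x
      by (rule cinner_ext) (simp add: T' scale_left cinner_scaleC_left)
    fix x
    have "norm (T x) * norm (T x) = cmod (cinner (T x) (T x))"
      by (simp add: cinner_self norm_power power2_eq_square[symmetric])
    also have "\<dots> \<le> K * norm x * norm (T x)" by (simp add: T' bound)
    finally show "norm (T x) \<le> K * norm x"
      using K by (cases "T x = 0") simp_all
  qed
  then show ?thesis using T' by blast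
qed

section \<open>Adjoints on a subspace and on the whole space\<close>

lemma adjoint_on_eqI:
  assumes U: "complex_vector.subspace U" and y: "y \<in> U" and z: "z \<in> U"
    and eq: "\<And>x. x \<in> U \<Longrightarrow> cinner (T x) y = cinner x z"
  shows "adjoint_on U T y = z"
proof -
  have "z' = z" if z': "z' \<in> U \<and> (\<forall>x\<in>U. cinner (T x) y = cinner x z')" for z'
  proof -
    have "z' - z \<in> U" using U z z' by (simp add: complex_vector.subspace_diff)
    then have "cinner (z' - z) (z' - z) = 0"
      using eq z' by (simp add: cinner.diff_right)
    then show ?thesis by (simp add: cinner_eq_zero_iff)
  qed
  then have "(THE z. z \<in> U \<and> (\<forall>x\<in>U. cinner (T x) y = cinner x z)) = z"
    using z eq by (intro the_equality) auto
  then show ?thesis using y by (simp add: adjoint_on_def)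
qed

text \<open>With \<open>y\<close> as its first argument, \<open>cinner y (T x)\<close> is linear in
  \<open>y\<close> and conjugate-linear in \<open>x\<close>, hence the form of an operator.\<close>

lemma adjoint_op_exists:
  assumes T: "bounded_op T"
  shows "\<exists>S. bounded_op S \<and> (\<forall>x y. cinner (T x) y = cinner x (S y))"
proof -
  obtain K where K: "0 \<le> K" "\<And>x. norm (T x) \<le> K * norm x" using bounded_op_boundE[OF T] by blast
  have "\<exists>S. bounded_op S \<and> (\<forall>y x. cinner (S y) x = cinner y (T x))"
  proof (rule bounded_sesquilinear_form_op)
    fix x y
    have "cmod (cinner y (T x)) \<le> norm y * norm (T x)" by (rule norm_cinner_le)
    also have "\<dots> \<le> norm y * (K * norm x)" using K by (intro mult_left_mono) auto
    finally show "cmod (cinner y (T x)) \<le> K * norm y * norm x" by (simp add: ac_simps)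
  qed (simp_all add: K cinner_add_left cinner_scaleC_left bounded_op_addD[OF T]
      bounded_op_scaleD[OF T] cinner_add_right cinner_scaleC_right)
  then obtain S where S: "bounded_op S" "\<And>y x. cinner (S y) x = cinner y (T x)" by blast
  have "cinner (T x) y = cinner x (S y)" for x y
    using S(2)[of y x] cinner_commute[of "T x" y] cinner_commute[of x "S y"] by simp
  then show ?thesis using S(1) by blast
qed

lemma adjoint_op_eqI:
  assumes "\<And>x y. cinner (T x) y = cinner x (S y)"
  shows "adjoint_op T = S"
proof
  show "adjoint_op T y = S y" for y
    by (rule adjoint_on_eqI) (simp_all add: assms complex_vector.subspace_UNIV)
qed

lemma
  assumes "bounded_op T"
  shows bounded_op_adjoint: "bounded_op (adjoint_op T)"
    and cinner_adjoint_op: "cinner (T x) y = cinner x (adjoint_op T y)"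
proof -
  obtain S where S: "bounded_op S" "\<And>x y. cinner (T x) y = cinner x (S y)"
    using adjoint_op_exists[OF assms] by blast
  have eq: "adjoint_op T = S" by (rule adjoint_op_eqI[OF S(2)])
  show "bounded_op (adjoint_op T)" by (simp only: eq S(1))
  show "cinner (T x) y = cinner x (adjoint_op T y)" by (simp only: eq S(2))
qed

lemma cinner_adjoint_op_right:
  assumes "bounded_op T"
  shows "cinner x (T y) = cinner (adjoint_op T x) y"
  using cinner_adjoint_op[OF assms, of y x] cinner_commute[of x "T y"]
    cinner_commute[of "adjoint_op T x" y] by simp

lemma adjoint_op_id: "adjoint_op id = id"
  by (rule adjoint_op_eqI) simp

lemma adjoint_op_comp:
  assumes "bounded_op S" "bounded_op T"
  shows "adjoint_op (S \<circ> T) = adjoint_op T \<circ> adjoint_op S"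
  by (rule adjoint_op_eqI) (simp add: cinner_adjoint_op[OF assms(1)] cinner_adjoint_op[OF assms(2)])

section \<open>Series in the weak operator topology\<close>

lemma wot_has_sum_unique:
  assumes S: "wot_has_sum F I S" and T: "wot_has_sum F I T"
  shows "S = T"
proof (rule ext, rule cinner_ext)
  fix x z
  have "((\<lambda>i. cinner (F i x) z) has_sum cinner (S x) z) I"
    using S by (simp add: wot_has_sum_def)
  moreover have "((\<lambda>i. cinner (F i x) z) has_sum cinner (T x) z) I"
    using T by (simp add: wot_has_sum_def)
  ultimately show "cinner (S x) z = cinner (T x) z" by (rule has_sum_unique)
qed

lemma wot_has_sum_wot_sum: "wot_summable F I \<Longrightarrow> wot_has_sum F I (wot_sum F I)"
  unfolding wot_summable_def wot_sum_def
  using theI'[of "\<lambda>T. wot_has_sum F I T"] wot_has_sum_unique by metis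

text \<open>On the diagonal the terms are nonnegative reals, for which a partial sum never exceeds
  the total. All later estimates draw on operator series through this inequality.\<close>

lemma wot_has_sum_finite_le:
  assumes "wot_has_sum F I T" "finite J" "J \<subseteq> I" "\<And>i. i \<in> I \<Longrightarrow> 0 \<le> Re (cinner (F i x) x)"
  shows "(\<Sum>i\<in>J. Re (cinner (F i x) x)) \<le> Re (cinner (T x) x)"
proof -
  have "((\<lambda>i. cinner (F i x) x) has_sum cinner (T x) x) I"
    using assms(1) by (simp add: wot_has_sum_def)
  from has_sum_Re[OF this] show ?thesis
    by (rule finite_sum_le_has_sum) (use assms in auto)
qed

text \<open>Convergence with the identity in the middle gives convergence with any bounded
  \<open>P\<close> there: by Cauchy-Schwarz the forms converge absolutely, with total at most
  \<open>L * K * norm x * norm y\<close>, and a bounded form comes from an operator. This is what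
  makes the iterates of \<open>Phi\<close> meaningful.\<close>

lemma wot_summable_sandwich:
  fixes B :: "'i \<Rightarrow> 'a::complex_hilbert \<Rightarrow> 'a"
  assumes B: "\<And>i. i \<in> I \<Longrightarrow> bounded_op (B i)" and c: "\<And>i. i \<in> I \<Longrightarrow> 0 \<le> c i"
    and sum: "wot_summable (\<lambda>i x. c i *\<^sub>R B i (adjoint_op (B i) x)) I"
    and P: "bounded_op P"
  shows "wot_summable (\<lambda>i x. c i *\<^sub>R B i (P (adjoint_op (B i) x))) I"
proof -
  obtain T where T: "wot_has_sum (\<lambda>i x. c i *\<^sub>R B i (adjoint_op (B i) x)) I T"
    using sum by (auto simp: wot_summable_def)
  obtain K where K: "0 \<le> K" "\<And>x. norm (T x) \<le> K * norm x"
    using T bounded_op_boundE by (metis wot_has_sum_def)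
  obtain L where L: "0 \<le> L" "\<And>x. norm (P x) \<le> L * norm x"
    using bounded_op_boundE[OF P] by blast
  have form: "cinner (c i *\<^sub>R B i (P (adjoint_op (B i) x))) y
      = c i * cinner (P (adjoint_op (B i) x)) (adjoint_op (B i) y)" if "i \<in> I" for i P x y
    by (simp add: cinner.scaleR_left cinner_adjoint_op[OF B[OF that]] scaleR_conv_of_real)
  \<comment> \<open>The identity case on the diagonal: the terms become squares whose total is at
    most \<open>Re (cinner (T x) x)\<close>.\<close>
  have sq: "(\<Sum>i\<in>J. (sqrt (c i) * norm (adjoint_op (B i) x))\<^sup>2) \<le> K * (norm x)\<^sup>2"
    if J: "finite J" "J \<subseteq> I" for J x
  proof -
    have Re: "Re (cinner (c i *\<^sub>R B i (adjoint_op (B i) x)) x) = (sqrt (c i) * norm (adjoint_op (B i) x))\<^sup>2"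
      if "i \<in> I" for i
      using form[OF that, of "\<lambda>x. x" x x] c[OF that] by (simp add: cinner_self power_mult_distrib)
    have "(\<Sum>i\<in>J. (sqrt (c i) * norm (adjoint_op (B i) x))\<^sup>2)
        = (\<Sum>i\<in>J. Re (cinner (c i *\<^sub>R B i (adjoint_op (B i) x)) x))"
      by (rule sum.cong) (use Re J in auto)
    also have "\<dots> \<le> Re (cinner (T x) x)"
      by (rule wot_has_sum_finite_le[OF T J]) (simp add: Re)
    also have "\<dots> \<le> norm (T x) * norm x"
      using norm_cinner_le[of "T x" x] complex_Re_le_cmod order_trans by blast
    also have "\<dots> \<le> K * norm x * norm x" using K by (intro mult_right_mono) auto
    finally show ?thesis by (simp add: power2_eq_square mult.assoc)
  qed
  define F where "F i x y = cinner (c i *\<^sub>R B i (P (adjoint_op (B i) x))) y" for i x y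
  have bound: "(\<Sum>i\<in>J. cmod (F i x y)) \<le> L * K * norm x * norm y"
    if J: "finite J" "J \<subseteq> I" for J x y
  proof -
    \<comment> \<open>The weight \<open>c i\<close> is shared as two square roots between the two
      adjoint vectors, so that Cauchy-Schwarz for \<open>L2_set\<close> applies.\<close>
    define u where "u z i = sqrt (c i) * norm (adjoint_op (B i) z)" for z i
    have u: "L2_set (u z) J \<le> sqrt K * norm z" for z
      unfolding L2_set_def
      by (rule real_le_lsqrt) (use sq[OF J] K in \<open>simp_all add: u_def power_mult_distrib sum_nonneg\<close>)
    have "cmod (F i x y) \<le> L * (\<bar>u x i\<bar> * \<bar>u y i\<bar>)" if "i \<in> J" for i
    proof -
      have i: "i \<in> I" using that J by auto
      have "cmod (F i x y) = c i * cmod (cinner (P (adjoint_op (B i) x)) (adjoint_op (B i) y))"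
        using c[OF i] by (simp add: F_def form[OF i] norm_mult)
      also have "\<dots> \<le> c i * (norm (P (adjoint_op (B i) x)) * norm (adjoint_op (B i) y))"
        by (intro mult_left_mono norm_cinner_le c i)
      also have "\<dots> \<le> c i * ((L * norm (adjoint_op (B i) x)) * norm (adjoint_op (B i) y))"
        by (intro mult_left_mono mult_right_mono L c i) simp
      also have "\<dots> = L * (\<bar>u x i\<bar> * \<bar>u y i\<bar>)"
        using c[OF i] real_sqrt_mult_self[of "c i"] by (simp add: u_def abs_mult ac_simps)
      finally show ?thesis .
    qed
    then have "(\<Sum>i\<in>J. cmod (F i x y)) \<le> L * (\<Sum>i\<in>J. \<bar>u x i\<bar> * \<bar>u y i\<bar>)"
      unfolding sum_distrib_left by (rule sum_mono)
    also have "\<dots> \<le> L * (L2_set (u x) J * L2_set (u y) J)"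
      by (intro mult_left_mono L2_set_mult_ineq L)
    also have "\<dots> \<le> L * ((sqrt K * norm x) * (sqrt K * norm y))"
      by (intro mult_left_mono mult_mono u L L2_set_nonneg) (simp add: K)
    also have "\<dots> = L * K * norm x * norm y"
      using K real_sqrt_mult_self[of K] by (simp add: ac_simps)
    finally show ?thesis .
  qed
  have abs: "(\<lambda>i. cmod (F i x y)) summable_on I" for x y
    by (rule nonneg_bdd_above_summable_on)
      (auto intro!: bdd_aboveI2[where M="L * K * norm x * norm y"] bound)
  then have summ: "(\<lambda>i. F i x y) summable_on I" for x y
    by (rule abs_summable_summable)
  have F_eq: "F i x y = c i * cinner (P (adjoint_op (B i) x)) (adjoint_op (B i) y)"
    if "i \<in> I" for i x y
    unfolding F_def by (rule form[OF that])
  have add: "F i (x + x') y = F i x y + F i x' y" "F i (a *\<^sub>C x) y = a * F i x y"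
    "F i x (y + y') = F i x y + F i x y'" "F i x (a *\<^sub>C y) = cnj a * F i x y"
    if i: "i \<in> I" for i x x' y y' a
    using bounded_op_adjoint[OF B[OF i]] P
    by (simp_all add: F_eq[OF i] bounded_op_addD bounded_op_scaleD cinner_add_left
        cinner_add_right cinner_scaleC_left cinner_scaleC_right algebra_simps)
  have "\<exists>S. bounded_op S \<and> (\<forall>x y. cinner (S x) y = infsum (\<lambda>i. F i x y) I)"
  proof (rule bounded_sesquilinear_form_op)
    fix x x' y y' a
    show "infsum (\<lambda>i. F i (x + x') y) I = infsum (\<lambda>i. F i x y) I + infsum (\<lambda>i. F i x' y) I"
      by (subst infsum_add[symmetric, OF summ summ]) (rule infsum_cong, simp add: add)
    show "infsum (\<lambda>i. F i x (y + y')) I = infsum (\<lambda>i. F i x y) I + infsum (\<lambda>i. F i x y') I"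
      by (subst infsum_add[symmetric, OF summ summ]) (rule infsum_cong, simp add: add)
    show "infsum (\<lambda>i. F i (a *\<^sub>C x) y) I = a * infsum (\<lambda>i. F i x y) I"
      by (subst infsum_cmult_right'[symmetric]) (rule infsum_cong, simp add: add)
    show "infsum (\<lambda>i. F i x (a *\<^sub>C y)) I = cnj a * infsum (\<lambda>i. F i x y) I"
      by (subst infsum_cmult_right'[symmetric]) (rule infsum_cong, simp add: add)
    have "cmod (infsum (\<lambda>i. F i x y) I) \<le> infsum (\<lambda>i. cmod (F i x y)) I"
      by (rule norm_infsum_bound) (rule abs)
    also have "\<dots> \<le> L * K * norm x * norm y" by (rule infsum_le_finite_sums[OF abs bound])
    finally show "cmod (infsum (\<lambda>i. F i x y) I) \<le> L * K * norm x * norm y" .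
  qed (simp add: K L)
  then obtain S where S: "bounded_op S" "\<And>x y. cinner (S x) y = infsum (\<lambda>i. F i x y) I" by blast
  have "wot_has_sum (\<lambda>i x. c i *\<^sub>R B i (P (adjoint_op (B i) x))) I S"
    using has_sum_infsum[OF summ] S by (simp add: wot_has_sum_def F_def)
  then show ?thesis by (auto simp: wot_summable_def)
qed

section \<open>The coefficients of the weighted shifts\<close>

text \<open>The coefficient of \<open>w\<close> in the \<open>s\<close>-th power of the series with
  coefficients \<open>a\<close>: the convolution power on the free monoid. Splitting off the
  leftmost factor matches the outermost map in an iterate of \<open>Phi\<close>.\<close>

primrec conv_power :: "('g list \<Rightarrow> real) \<Rightarrow> nat \<Rightarrow> 'g list \<Rightarrow> real" where
  "conv_power a 0 w = (if w = [] then 1 else 0)"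
| "conv_power a (Suc s) w = (\<Sum>i\<le>length w. a (take i w) * conv_power a s (drop i w))"

text \<open>As \<open>a [] = 0\<close>, each factor of a contributing factorization uses up a
  letter. So only finitely many exponents matter for a given word.\<close>

lemma conv_power_eq_0:
  assumes "a [] = 0" and "length w < s"
  shows "conv_power a s w = 0"
  using assms(2)
proof (induction s arbitrary: w)
  case (Suc s)
  have "a (take i w) * conv_power a s (drop i w) = 0" if "i \<le> length w" for i
  proof (cases i)
    case 0
    then show ?thesis using assms(1) by simp
  next
    case (Suc i')
    then have "length (drop i w) < s" using that Suc.prems by simp
    then show ?thesis using Suc.IH by simp
  qed
  then show ?case unfolding conv_power.simps by (intro sum.neutral) simp
qed simp

lemma finite_factorizations: "finite {\<gamma>. length \<gamma> = p \<and> concat \<gamma> = w \<and> (\<forall>g\<in>set \<gamma>. 1 \<le> length g)}"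
proof (rule finite_subset)
  show "{\<gamma>. length \<gamma> = p \<and> concat \<gamma> = w \<and> (\<forall>g\<in>set \<gamma>. 1 \<le> length g)}
      \<subseteq> {\<gamma>. set \<gamma> \<subseteq> {g. set g \<subseteq> set w \<and> length g \<le> length w} \<and> length \<gamma> = p}"
    by (auto simp: length_concat intro!: member_le_sum_list)
  show "finite {\<gamma>. set \<gamma> \<subseteq> {g. set g \<subseteq> set w \<and> length g \<le> length w} \<and> length \<gamma> = p}"
    by (intro finite_lists_length_eq finite_lists_length_le) simp
qed

text \<open>Links the recursion to the explicit sum in \<open>b_coeff\<close>: a factorization into
  \<open>Suc p\<close> nonempty factors is a nonempty prefix, determined by its length, followed by
  a factorization of the rest into \<open>p\<close> factors.\<close>

lemma conv_power_eq_sum_factorizations: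
  assumes "a [] = 0"
  shows "conv_power a p w =
    (\<Sum>\<gamma> | length \<gamma> = p \<and> concat \<gamma> = w \<and> (\<forall>g\<in>set \<gamma>. 1 \<le> length g). prod_list (map a \<gamma>))"
proof (induction p arbitrary: w)
  case 0
  have "{\<gamma>::'a list list. length \<gamma> = 0 \<and> concat \<gamma> = w \<and> (\<forall>g\<in>set \<gamma>. 1 \<le> length g)}
      = (if w = [] then {[]} else {})"
    by auto
  then show ?case by simp
next
  case (Suc p)
  define C where "C q v = {\<gamma>::'a list list. length \<gamma> = q \<and> concat \<gamma> = v \<and> (\<forall>g\<in>set \<gamma>. 1 \<le> length g)}"
    for q v
  have C: "C (Suc p) w = (\<lambda>(i, \<gamma>). take i w # \<gamma>) ` Sigma {1..length w} (\<lambda>i. C p (drop i w))"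
  proof
    show "C (Suc p) w \<subseteq> (\<lambda>(i, \<gamma>). take i w # \<gamma>) ` Sigma {1..length w} (\<lambda>i. C p (drop i w))"
    proof
      fix \<gamma> assume "\<gamma> \<in> C (Suc p) w"
      then obtain g \<gamma>' where "\<gamma> = g # \<gamma>'" "length \<gamma>' = p" "g @ concat \<gamma>' = w" "1 \<le> length g"
        "\<forall>g\<in>set \<gamma>'. 1 \<le> length g"
        by (auto simp: C_def length_Suc_conv)
      then show "\<gamma> \<in> (\<lambda>(i, \<gamma>). take i w # \<gamma>) ` Sigma {1..length w} (\<lambda>i. C p (drop i w))"
        by (intro image_eqI[of _ _ "(length g, \<gamma>')"]) (auto simp: C_def)
    qed
  qed (auto simp: C_def)
  have inj: "inj_on (\<lambda>(i, \<gamma>). take i w # \<gamma>) (Sigma {1..length w} (\<lambda>i. C p (drop i w)))"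
  proof (rule inj_onI)
    fix x y assume x: "x \<in> Sigma {1..length w} (\<lambda>i. C p (drop i w))"
      and y: "y \<in> Sigma {1..length w} (\<lambda>i. C p (drop i w))"
      and eq: "(\<lambda>(i, \<gamma>). take i w # \<gamma>) x = (\<lambda>(i, \<gamma>). take i w # \<gamma>) y"
    obtain i \<gamma> i' \<gamma>' where xy: "x = (i, \<gamma>)" "y = (i', \<gamma>')" by fastforce
    then have "take i w = take i' w" "\<gamma> = \<gamma>'" using eq by auto
    then have "length (take i w) = length (take i' w)" by simp
    then show "x = y" using x y xy \<open>\<gamma> = \<gamma>'\<close> by simp
  qed
  \<comment> \<open>The cut at 0 drops out because \<open>a [] = 0\<close>, in accordance with the
    ban on empty factors.\<close>
  have "conv_power a (Suc p) w = (\<Sum>i\<in>{1..length w}. a (take i w) * conv_power a p (drop i w))"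
    unfolding conv_power.simps
    by (rule sum.mono_neutral_right) (auto simp: assms not_less_eq_eq)
  also have "\<dots> = (\<Sum>i\<in>{1..length w}. \<Sum>\<gamma>\<in>C p (drop i w). a (take i w) * prod_list (map a \<gamma>))"
    by (simp add: Suc.IH sum_distrib_left C_def)
  also have "\<dots> = (\<Sum>(i, \<gamma>)\<in>Sigma {1..length w} (\<lambda>i. C p (drop i w)). a (take i w) * prod_list (map a \<gamma>))"
    by (rule sum.Sigma) (use finite_factorizations in \<open>auto simp: C_def\<close>)
  also have "\<dots> = (\<Sum>\<gamma>\<in>C (Suc p) w. prod_list (map a \<gamma>))"
    unfolding C sum.reindex[OF inj] by (rule sum.cong) auto
  finally show ?case by (simp add: C_def)
qed

text \<open>Including the exponent 0 absorbs the separate value at the empty word: that term is 1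
  there and 0 at every other word.\<close>

lemma b_coeff_eq_conv_power:
  assumes "a [] = 0"
  shows "b_coeff a m w = (\<Sum>p\<le>length w. conv_power a p w * real ((p + m - 1) choose (m - 1)))"
proof (cases "w = []")
  case False
  have "b_coeff a m w = (\<Sum>p = 1..length w. conv_power a p w * real ((p + m - 1) choose (m - 1)))"
    unfolding b_coeff_def conv_power_eq_sum_factorizations[of a, OF assms] using False
    by (simp add: sum_distrib_right)
  also have "\<dots> = (\<Sum>p\<le>length w. conv_power a p w * real ((p + m - 1) choose (m - 1)))"
    by (rule sum.mono_neutral_left) (use False in \<open>auto simp: not_less_eq_eq\<close>)
  finally show ?thesis .
qed (simp add: b_coeff_def)

section \<open>Words and positivity of the weights\<close>

lemma words_Nil [simp]: "[] \<in> words n"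
  by (simp add: words_def)

lemma words_Cons [simp]: "j # w \<in> words n \<longleftrightarrow> j \<in> {1..n} \<and> w \<in> words n"
  by (simp add: words_def)

lemma words_append [simp]: "v @ w \<in> words n \<longleftrightarrow> v \<in> words n \<and> w \<in> words n"
  by (simp add: words_def)

lemma words_take_drop: "w \<in> words n \<Longrightarrow> take i w \<in> words n \<and> drop i w \<in> words n"
  by (metis append_take_drop_id words_append)

lemma conv_power_nonneg:
  assumes "\<forall>w\<in>words n. 0 \<le> a w" and "w \<in> words n"
  shows "0 \<le> conv_power a s w"
  using assms(2)
  by (induction s arbitrary: w) (use assms(1) words_take_drop in \<open>auto intro!: sum_nonneg mult_nonneg_nonneg\<close>)

text \<open>Taking the letter \<open>j\<close> as a factor of its own turns factorizations of
  \<open>w\<close> into \<open>p\<close> factors into ones of \<open>j # w\<close> into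
  \<open>Suc p\<close> factors, and the binomial coefficient does not decrease. This inequality is
  what bounds the shifts.\<close>

lemma b_coeff_Cons_ge:
  assumes a: "positive_regular n a" and w: "j # w \<in> words n"
  shows "a [j] * b_coeff a m w \<le> b_coeff a m (j # w)"
proof -
  have nonneg: "\<forall>w\<in>words n. 0 \<le> a w" and a0: "a [] = 0" using a by (auto simp: positive_regular_def)
  let ?c = "\<lambda>p. real ((p + m - 1) choose (m - 1))"
  have "a [j] * (conv_power a p w * ?c p) \<le> conv_power a (Suc p) (j # w) * ?c (Suc p)" for p
  proof -
    \<comment> \<open>Only the cut after one letter is kept; the other summands are
      nonnegative.\<close>
    have "(\<Sum>i\<in>{1}. a (take i (j # w)) * conv_power a p (drop i (j # w))) \<le> conv_power a (Suc p) (j # w)"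
      unfolding conv_power.simps using nonneg words_take_drop[OF w]
      by (intro sum_mono2) (auto intro!: mult_nonneg_nonneg conv_power_nonneg simp del: take_Suc_Cons drop_Suc_Cons)
    then have "a [j] * conv_power a p w \<le> conv_power a (Suc p) (j # w)" by simp
    moreover have "?c p \<le> ?c (Suc p)" by (intro of_nat_mono binomial_right_mono) simp
    moreover have "0 \<le> conv_power a (Suc p) (j # w)" by (rule conv_power_nonneg[OF nonneg w])
    ultimately have "(a [j] * conv_power a p w) * ?c p \<le> conv_power a (Suc p) (j # w) * ?c (Suc p)"
      by (intro mult_mono) auto
    then show ?thesis by (simp add: mult.assoc)
  qed
  then have "a [j] * b_coeff a m w \<le> (\<Sum>p\<le>length w. conv_power a (Suc p) (j # w) * ?c (Suc p))"
    unfolding b_coeff_eq_conv_power[of a, OF a0] sum_distrib_left by (rule sum_mono)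
  \<comment> \<open>After the index shift the term of exponent 0 is left over, and it is
    nonnegative.\<close>
  also have "\<dots> \<le> b_coeff a m (j # w)"
    unfolding b_coeff_eq_conv_power[of a, OF a0] length_Cons sum.atMost_Suc_shift
    using conv_power_nonneg[OF nonneg w, of 0] by simp
  finally show ?thesis .
qed

text \<open>Starting from 1 at the empty word, each letter contributes at least a factor
  \<open>a [j] > 0\<close>.\<close>

lemma b_coeff_pos:
  assumes a: "positive_regular n a" and "w \<in> words n"
  shows "0 < b_coeff a m w"
  using assms(2)
proof (induction w)
  case (Cons j w)
  then have "0 < a [j] * b_coeff a m w" using a by (auto simp: positive_regular_def)
  then show ?case using b_coeff_Cons_ge[OF a Cons.prems, of m] by linarith
qed (simp add: b_coeff_def)

section \<open>Expansion of the iterated maps\<close>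

lemma op_word_Nil [simp]: "op_word X [] = id"
  by (simp add: op_word_def)

lemma op_word_Cons: "op_word X (j # w) = X j \<circ> op_word X w"
  by (simp add: op_word_def)

lemma op_word_append: "op_word X (v @ w) = op_word X v \<circ> op_word X w"
  by (induction v) (simp_all add: op_word_Cons comp_assoc)

lemma bounded_op_word:
  assumes "\<forall>j\<in>{1..n}. bounded_op (X j)" "w \<in> words n"
  shows "bounded_op (op_word X w)"
  using assms(2)
  by (induction w) (use assms(1) in \<open>auto simp: op_word_Cons bounded_op_id intro: bounded_op_comp\<close>)

text \<open>The real part suffices, since only real parts are compared. Boundedness is included so
  that \<open>Phi\<close> can be applied again.\<close>

definition nonneg_op :: "('a::complex_hilbert \<Rightarrow> 'a) \<Rightarrow> bool" where
  "nonneg_op P \<longleftrightarrow> bounded_op P \<and> (\<forall>x. 0 \<le> Re (cinner (P x) x))"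

lemma nonneg_op_id: "nonneg_op id"
  by (simp add: nonneg_op_def bounded_op_id cinner_self)

context
  fixes n :: nat and a :: "nat list \<Rightarrow> real" and X :: "nat \<Rightarrow> 'a::complex_hilbert \<Rightarrow> 'a"
  assumes a_nonneg: "\<forall>w\<in>words n. 0 \<le> a w"
    and X_bounded: "\<forall>j\<in>{1..n}. bounded_op (X j)"
    and X_summable: "wot_summable
      (\<lambda>w x. a w *\<^sub>R op_word X w (adjoint_op (op_word X w) x)) (words n)"
begin

text \<open>\<open>Phi\<close> is a definite description; the convergence at the identity assumed in
  this context passes to every bounded \<open>P\<close> by the sandwich lemma.\<close>

lemma wot_has_sum_Phi:
  assumes "bounded_op P"
  shows "wot_has_sum (\<lambda>w x. a w *\<^sub>R op_word X w (P (adjoint_op (op_word X w) x))) (words n)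
    (Phi n a X P)"
  unfolding Phi_def
proof (rule wot_has_sum_wot_sum, rule wot_summable_sandwich[OF _ _ X_summable assms])
  show "bounded_op (op_word X w)" if "w \<in> words n" for w
    using X_bounded that by (rule bounded_op_word)
  show "0 \<le> a w" if "w \<in> words n" for w
    using a_nonneg that by blast
qed

lemma Re_cinner_Phi_term:
  assumes "w \<in> words n"
  shows "Re (cinner (a w *\<^sub>R op_word X w (P (adjoint_op (op_word X w) x))) x)
    = a w * Re (cinner (P (adjoint_op (op_word X w) x)) (adjoint_op (op_word X w) x))"
  by (simp add: cinner.scaleR_left cinner_adjoint_op[OF bounded_op_word[OF X_bounded assms]])

lemma Phi_lower_bound:
  assumes P: "nonneg_op P" and W: "finite W" "W \<subseteq> words n"
  shows "(\<Sum>w\<in>W. a w * Re (cinner (P (adjoint_op (op_word X w) x)) (adjoint_op (op_word X w) x)))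
    \<le> Re (cinner (Phi n a X P x) x)"
proof -
  have "(\<Sum>w\<in>W. Re (cinner (a w *\<^sub>R op_word X w (P (adjoint_op (op_word X w) x))) x))
      \<le> Re (cinner (Phi n a X P x) x)"
    using P a_nonneg
    by (intro wot_has_sum_finite_le[OF wot_has_sum_Phi] W)
      (auto simp: nonneg_op_def Re_cinner_Phi_term intro!: mult_nonneg_nonneg)
  moreover have "(\<Sum>w\<in>W. Re (cinner (a w *\<^sub>R op_word X w (P (adjoint_op (op_word X w) x))) x))
      = (\<Sum>w\<in>W. a w * Re (cinner (P (adjoint_op (op_word X w) x)) (adjoint_op (op_word X w) x)))"
    by (rule sum.cong) (use W Re_cinner_Phi_term in auto)
  ultimately show ?thesis by simp
qed

lemma nonneg_op_Phi:
  assumes "nonneg_op P"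
  shows "nonneg_op (Phi n a X P)"
  using wot_has_sum_Phi[of P] Phi_lower_bound[OF assms, of "{}"] assms
  by (auto simp: nonneg_op_def wot_has_sum_def)

lemma nonneg_op_Phi_power:
  "nonneg_op P \<Longrightarrow> nonneg_op ((Phi n a X ^^ s) P)"
  by (induction s) (simp_all add: nonneg_op_Phi)

text \<open>The outermost \<open>Phi\<close> supplies a first factor \<open>v\<close>, and the bound
  for \<open>s\<close> is applied at the vector that the adjoint of \<open>op_word X v\<close> makes
  of \<open>x\<close>; hence \<open>x\<close> varies in the induction. Adjoints reverse products, so
  cutting a word into a prefix and a suffix follows this order.\<close>

lemma Phi_power_lower_bound:
  assumes P: "nonneg_op P" and W: "finite W" "W \<subseteq> words n"
  shows "(\<Sum>w\<in>W. conv_power a s w *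
      Re (cinner (P (adjoint_op (op_word X w) x)) (adjoint_op (op_word X w) x)))
    \<le> Re (cinner ((Phi n a X ^^ s) P x) x)"
  using W
proof (induction s arbitrary: W x)
  case 0
  have "(\<Sum>w\<in>W. conv_power a 0 w *
      Re (cinner (P (adjoint_op (op_word X w) x)) (adjoint_op (op_word X w) x)))
    = (\<Sum>w\<in>W. if w = [] then Re (cinner (P x) x) else 0)"
    by (rule sum.cong) (auto simp: adjoint_op_id)
  then show ?case using P 0 by (simp add: nonneg_op_def)
next
  case (Suc s)
  define q where "q w y = Re (cinner (P (adjoint_op (op_word X w) y)) (adjoint_op (op_word X w) y))"
    for w y
  \<comment> \<open>All prefixes and all suffixes of words in \<open>W\<close>. Every cut of such a
    word gives a pair in \<open>V \<times> U\<close>, though not every pair need arise from a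
    cut.\<close>
  define V where "V = (\<Union>w\<in>W. (\<lambda>i. take i w) ` {..length w})"
  define U where "U = (\<Union>w\<in>W. (\<lambda>i. drop i w) ` {..length w})"
  define f where "f = (\<lambda>(v, u). a v * (conv_power a s u * q u (adjoint_op (op_word X v) x)))"
  have VU: "finite V" "V \<subseteq> words n" "finite U" "U \<subseteq> words n"
    using Suc.prems words_take_drop by (auto simp: V_def U_def)
  have q_append: "q (v @ u) x = q u (adjoint_op (op_word X v) x)"
    if "v \<in> words n" "u \<in> words n" for v u
    using that X_bounded by (simp add: q_def op_word_append adjoint_op_comp bounded_op_word)
  have "(\<Sum>w\<in>W. conv_power a (Suc s) w * q w x)
      = (\<Sum>w\<in>W. \<Sum>i\<in>{..length w}. f (take i w, drop i w))"
  proof (rule sum.cong)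
    fix w assume "w \<in> W"
    then have "q w x = q (drop i w) (adjoint_op (op_word X (take i w)) x)" for i
      using q_append[of "take i w" "drop i w"] words_take_drop Suc.prems by auto
    then show "conv_power a (Suc s) w * q w x = (\<Sum>i\<in>{..length w}. f (take i w, drop i w))"
      by (simp add: f_def sum_distrib_right mult.assoc)
  qed simp
  also have "\<dots> = (\<Sum>(w, i)\<in>(SIGMA w:W. {..length w}). f (take i w, drop i w))"
    by (rule sum.Sigma) (use Suc.prems in auto)
  also have "\<dots> = sum f ((\<lambda>(w, i). (take i w, drop i w)) ` (SIGMA w:W. {..length w}))"
  proof (subst sum.reindex)
    show "inj_on (\<lambda>(w, i). (take i w, drop i w)) (SIGMA w:W. {..length w})"
    proof (rule inj_onI)
      fix x y assume x: "x \<in> (SIGMA w:W. {..length w})" and y: "y \<in> (SIGMA w:W. {..length w})"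
        and eq: "(\<lambda>(w, i). (take i w, drop i w)) x = (\<lambda>(w, i). (take i w, drop i w)) y"
      obtain w j w' j' where xy: "x = (w, j)" "y = (w', j')" by fastforce
      then have take: "take j w = take j' w'" and drop: "drop j w = drop j' w'" using eq by auto
      have "w = w'" using take drop by (metis append_take_drop_id)
      moreover have "min (length w) j = min (length w') j'" using take by (metis length_take)
      ultimately show "x = y" using x y xy by simp
    qed
  qed (auto intro: sum.cong)
  \<comment> \<open>Additional pairs contribute nonnegative terms, and the resulting double sum
    separates into one application of \<open>Phi\<close> and the induction hypothesis.\<close>
  also have "\<dots> \<le> sum f (V \<times> U)"
  proof (rule sum_mono2)
    show "(\<lambda>(w, i). (take i w, drop i w)) ` (SIGMA w:W. {..length w}) \<subseteq> V \<times> U"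
      by (auto simp: V_def U_def)
    fix z assume "z \<in> V \<times> U - (\<lambda>(w, i). (take i w, drop i w)) ` (SIGMA w:W. {..length w})"
    then obtain v u where "z = (v, u)" "v \<in> words n" "u \<in> words n" using VU by auto
    then show "0 \<le> f z"
      using P a_nonneg conv_power_nonneg[OF a_nonneg] by (simp add: f_def q_def nonneg_op_def)
  qed (simp add: VU)
  also have "\<dots> = (\<Sum>v\<in>V. a v * (\<Sum>u\<in>U. conv_power a s u * q u (adjoint_op (op_word X v) x)))"
    by (simp add: sum.cartesian_product[symmetric] f_def sum_distrib_left)
  also have "\<dots> \<le> (\<Sum>v\<in>V. a v * Re (cinner ((Phi n a X ^^ s) P (adjoint_op (op_word X v) x))
      (adjoint_op (op_word X v) x)))"
    by (intro sum_mono mult_left_mono Suc.IH[OF VU(3,4), folded q_def]) (use VU a_nonneg in auto)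
  also have "\<dots> \<le> Re (cinner ((Phi n a X ^^ Suc s) P x) x)"
    using Phi_lower_bound[OF nonneg_op_Phi_power[OF P] VU(1,2)] by simp
  finally show ?case by (simp add: q_def)
qed

end

section \<open>From one coordinate to all \<open>k\<close>\<close>

fun op_along :: "(nat \<Rightarrow> nat \<Rightarrow> 'a \<Rightarrow> 'a) \<Rightarrow> (nat \<Rightarrow> nat list) \<Rightarrow> nat list \<Rightarrow> 'a \<Rightarrow> 'a" where
  "op_along X \<alpha> [] = id"
| "op_along X \<alpha> (i # l) = op_word (X i) (\<alpha> i) \<circ> op_along X \<alpha> l"

text \<open>The list [1..<Suc k] loses its form when its head is removed, hence arbitrary lists of
  coordinates here and in \<open>op_along\<close>. The maps are already applied to the identity
  operator.\<close>

fun Phi_along ::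
  "(nat \<Rightarrow> nat) \<Rightarrow> (nat \<Rightarrow> nat list \<Rightarrow> real) \<Rightarrow> (nat \<Rightarrow> nat \<Rightarrow> 'a \<Rightarrow> 'a) \<Rightarrow> (nat \<Rightarrow> nat) \<Rightarrow> nat list \<Rightarrow>
   'a::complex_hilbert \<Rightarrow> 'a" where
  "Phi_along n a X s [] = id"
| "Phi_along n a X s (i # l) = (Phi (n i) (a i) (X i) ^^ s i) (Phi_along n a X s l)"

lemma op_multiword_eq_op_along: "op_multiword k X \<alpha> = op_along X \<alpha> [1..<Suc k]"
proof -
  have "foldr (\<lambda>i T. op_word (X i) (\<alpha> i) \<circ> T) l id = op_along X \<alpha> l" for l
    by (induct l) simp_all
  then show ?thesis by (simp add: op_multiword_def)
qed

lemma Phi_multi_eq_Phi_along: "Phi_multi k n a X s id = Phi_along n a X s [1..<Suc k]"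
proof -
  have "foldr (\<lambda>i F. (Phi (n i) (a i) (X i) ^^ s i) \<circ> F) l id id = Phi_along n a X s l" for l
    by (induct l) simp_all
  then show ?thesis by (simp add: Phi_multi_def)
qed

lemma op_along_cong: "(\<And>i. i \<in> set l \<Longrightarrow> \<alpha> i = \<beta> i) \<Longrightarrow> op_along X \<alpha> l = op_along X \<beta> l"
  by (induct l) simp_all

lemma bounded_op_along:
  assumes "\<forall>i\<in>set l. \<forall>j\<in>{1..n i}. bounded_op (X i j)" "\<forall>i\<in>set l. \<alpha> i \<in> words (n i)"
  shows "bounded_op (op_along X \<alpha> l)"
  using assms
proof (induct l)
  case Nil
  then show ?case by (simp only: op_along.simps bounded_op_id)
next
  case (Cons i l)
  then show ?case unfolding op_along.simps
    by (intro bounded_op_comp bounded_op_word[where n="n i"]) auto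
qed

text \<open>The value on the remaining coordinates is a nonnegative operator, to which the bound for
  powers in the first coordinate applies. Nonnegativity is part of the conclusion because the next
  coordinate in the induction relies on it.\<close>

lemma Phi_along_lower_bound:
  fixes A :: "nat \<Rightarrow> nat \<Rightarrow> 'a::complex_hilbert \<Rightarrow> 'a"
  assumes "distinct l"
    and "\<forall>i\<in>set l. \<forall>w\<in>words (n i). 0 \<le> a i w"
    and "\<forall>i\<in>set l. \<forall>j\<in>{1..n i}. bounded_op (A i j)"
    and "\<forall>i\<in>set l. wot_summable
          (\<lambda>w x. a i w *\<^sub>R op_word (A i) w (adjoint_op (op_word (A i) w) x)) (words (n i))"
    and "finite F" "F \<subseteq> (\<Pi>\<^sub>E i\<in>set l. words (n i))"
  shows "nonneg_op (Phi_along n a A s l) \<and>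
    (\<Sum>\<alpha>\<in>F. (\<Prod>i\<in>set l. conv_power (a i) (s i) (\<alpha> i)) *
        (norm (adjoint_op (op_along A \<alpha> l) x))\<^sup>2)
    \<le> Re (cinner (Phi_along n a A s l x) x)"
  using assms
proof (induction l arbitrary: F x)
  case Nil
  \<comment> \<open>The function \<open>\<lambda>_. undefined\<close> is the only extensional
    function on the empty set, so \<open>F\<close> has at most one element.\<close>
  have "sum f F \<le> f (\<lambda>_. undefined)" if "\<And>\<alpha>. 0 \<le> f \<alpha>" for f :: "(nat \<Rightarrow> nat list) \<Rightarrow> real"
    using sum_mono2[of "{\<lambda>_. undefined}" F f] Nil that by auto
  from this[of "\<lambda>\<alpha>. (norm x)\<^sup>2"] show ?case
    unfolding op_along.simps Phi_along.simps adjoint_op_id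
    by (intro conjI nonneg_op_id) (simp add: cinner_self)
next
  case (Cons i l)
  define P where "P = Phi_along n a A s l"
  define T where "T \<alpha> = op_along A \<alpha> l" for \<alpha>
  define c where "c \<alpha> = (\<Prod>i\<in>set l. conv_power (a i) (s i) (\<alpha> i))" for \<alpha>
  have i: "i \<notin> set l" "\<forall>w\<in>words (n i). 0 \<le> a i w" "\<forall>j\<in>{1..n i}. bounded_op (A i j)"
    "wot_summable (\<lambda>w x. a i w *\<^sub>R op_word (A i) w (adjoint_op (op_word (A i) w) x)) (words (n i))"
    using Cons.prems by auto
  note F = Cons.prems(5,6)
  have IH: "nonneg_op P \<and> (\<Sum>\<alpha>\<in>F. c \<alpha> * (norm (adjoint_op (T \<alpha>) x))\<^sup>2) \<le> Re (cinner (P x) x)"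
    if "finite F" "F \<subseteq> (\<Pi>\<^sub>E i\<in>set l. words (n i))" for F x
    unfolding P_def T_def c_def by (rule Cons.IH) (use Cons.prems that in auto)
  have P: "nonneg_op P" using IH[of "{}"] by simp
  \<comment> \<open>\<open>W\<close> and \<open>F'\<close> are the projections of \<open>F\<close>
    to the coordinate \<open>i\<close> and to the other coordinates. Extensionality embeds
    \<open>F\<close> into their product, and the pairs added there contribute nonnegative
    terms.\<close>
  define W where "W = (\<lambda>\<alpha>. \<alpha> i) ` F"
  define F' where "F' = (\<lambda>\<alpha>. restrict \<alpha> (set l)) ` F"
  have W: "finite W" "W \<subseteq> words (n i)" using F by (auto simp: W_def)
  have F': "finite F'" "F' \<subseteq> (\<Pi>\<^sub>E i\<in>set l. words (n i))"
    using F by (auto simp: F'_def PiE_iff Pi_iff subset_iff)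
  define g where "g = (\<lambda>(w, \<beta>). conv_power (a i) (s i) w *
    (c \<beta> * (norm (adjoint_op (T \<beta>) (adjoint_op (op_word (A i) w) x)))\<^sup>2))"
  have g: "(\<Prod>i\<in>set (i # l). conv_power (a i) (s i) (\<alpha> i)) *
        (norm (adjoint_op (op_along A \<alpha> (i # l)) x))\<^sup>2
      = g (\<alpha> i, restrict \<alpha> (set l))" if \<alpha>: "\<alpha> \<in> F" for \<alpha>
  proof -
    have mem: "\<alpha> i \<in> words (n i)" "\<forall>j\<in>set l. \<alpha> j \<in> words (n j)"
      using \<alpha> F by (auto simp: PiE_iff subset_iff)
    have "T (restrict \<alpha> (set l)) = T \<alpha>" unfolding T_def by (rule op_along_cong) simp
    moreover have "c (restrict \<alpha> (set l)) = c \<alpha>" by (simp add: c_def)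
    moreover have "adjoint_op (op_word (A i) (\<alpha> i) \<circ> T \<alpha>)
        = adjoint_op (T \<alpha>) \<circ> adjoint_op (op_word (A i) (\<alpha> i))"
      unfolding T_def
      by (intro adjoint_op_comp bounded_op_word bounded_op_along[where n=n]) 
        (use mem Cons.prems in auto)
    ultimately show ?thesis using i(1) by (simp add: g_def T_def[symmetric] c_def[symmetric])
  qed
  have c_nonneg: "0 \<le> c \<beta>" if "\<beta> \<in> F'" for \<beta>
    unfolding c_def
    by (intro prod_nonneg ballI conv_power_nonneg) (use that F' Cons.prems in \<open>auto simp: subset_iff PiE_iff\<close>)
  have inj: "inj_on (\<lambda>\<alpha>. (\<alpha> i, restrict \<alpha> (set l))) F"
  proof (rule inj_onI)
    fix \<alpha> \<beta> assume "\<alpha> \<in> F" "\<beta> \<in> F" and eq: "(\<alpha> i, restrict \<alpha> (set l)) = (\<beta> i, restrict \<beta> (set l))"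
    then have "\<alpha> \<in> extensional (set (i # l))" "\<beta> \<in> extensional (set (i # l))"
      using F by (auto simp: PiE_iff subset_iff)
    moreover have "\<alpha> j = \<beta> j" if "j \<in> set (i # l)" for j
      using eq that by (auto dest: fun_cong[where x=j])
    ultimately show "\<alpha> = \<beta>" by (rule extensionalityI)
  qed
  have "(\<Sum>\<alpha>\<in>F. (\<Prod>i\<in>set (i # l). conv_power (a i) (s i) (\<alpha> i)) *
        (norm (adjoint_op (op_along A \<alpha> (i # l)) x))\<^sup>2)
      = (\<Sum>\<alpha>\<in>F. g (\<alpha> i, restrict \<alpha> (set l)))"
    by (intro sum.cong refl g)
  also have "\<dots> = sum g ((\<lambda>\<alpha>. (\<alpha> i, restrict \<alpha> (set l))) ` F)"
    by (simp add: sum.reindex[OF inj])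
  also have "\<dots> \<le> sum g (W \<times> F')"
    by (rule sum_mono2)
      (use W F' i in \<open>auto simp: W_def F'_def[symmetric] g_def intro!: mult_nonneg_nonneg c_nonneg conv_power_nonneg\<close>,
        auto simp: F'_def)
  also have "\<dots> = (\<Sum>w\<in>W. conv_power (a i) (s i) w *
      (\<Sum>\<beta>\<in>F'. c \<beta> * (norm (adjoint_op (T \<beta>) (adjoint_op (op_word (A i) w) x)))\<^sup>2))"
    by (simp add: sum.cartesian_product[symmetric] g_def sum_distrib_left)
  also have "\<dots> \<le> (\<Sum>w\<in>W. conv_power (a i) (s i) w *
      Re (cinner (P (adjoint_op (op_word (A i) w) x)) (adjoint_op (op_word (A i) w) x)))"
    by (intro sum_mono mult_left_mono conjunct2[OF IH[OF F']] conv_power_nonneg[OF i(2)]) (use W in auto)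
  also have "\<dots> \<le> Re (cinner ((Phi (n i) (a i) (A i) ^^ s i) P x) x)"
    by (rule Phi_power_lower_bound[OF i(2-4) P W])
  finally have "(\<Sum>\<alpha>\<in>F. (\<Prod>i\<in>set (i # l). conv_power (a i) (s i) (\<alpha> i)) *
        (norm (adjoint_op (op_along A \<alpha> (i # l)) x))\<^sup>2)
      \<le> Re (cinner ((Phi (n i) (a i) (A i) ^^ s i) P x) x)" .
  moreover have "Phi_along n a A s (i # l)
      = (Phi (n i) (a i) (A i) ^^ s i) P"
    by (simp add: P_def)
  ultimately show ?case
    using nonneg_op_Phi_power[OF i(2-4) P] by metis
qed

text \<open>Exponents beyond the length of a word contribute 0, so all factors can be summed over
  the same range up to \<open>N\<close>, and their product expands over a finite box.\<close>

lemma b_coeff_prod_eq: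
  fixes N :: nat
  assumes "\<forall>i\<in>I. a i [] = 0" "\<forall>i\<in>I. length (\<alpha> i) \<le> N" "finite I"
  shows "(\<Prod>i\<in>I. b_coeff (a i) (m i) (\<alpha> i)) =
    (\<Sum>s\<in>(\<Pi>\<^sub>E i\<in>I. {..N}). (\<Prod>i\<in>I. real ((s i + m i - 1) choose (m i - 1))) *
       (\<Prod>i\<in>I. conv_power (a i) (s i) (\<alpha> i)))"
proof -
  have "b_coeff (a i) (m i) (\<alpha> i)
      = (\<Sum>p\<le>N. real ((p + m i - 1) choose (m i - 1)) * conv_power (a i) p (\<alpha> i))" if "i \<in> I" for i
    unfolding b_coeff_eq_conv_power[of "a i", OF bspec[OF assms(1) that]] using assms that
    by (intro sum.mono_neutral_cong_left) (auto simp: conv_power_eq_0)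
  then have "(\<Prod>i\<in>I. b_coeff (a i) (m i) (\<alpha> i))
      = (\<Prod>i\<in>I. \<Sum>p\<le>N. real ((p + m i - 1) choose (m i - 1)) * conv_power (a i) p (\<alpha> i))"
    by (rule prod.cong[OF refl])
  then show ?thesis using assms by (simp add: prod_sum_PiE prod.distrib)
qed

text \<open>Finitely many multiwords involve only a finite box of exponents, so the two sums can be
  exchanged. Each inner sum is at most the diagonal form of one term of the given series, and these
  forms are nonnegative.\<close>

lemma b_coeff_weighted_norm_bound:
  fixes A :: "nat \<Rightarrow> nat \<Rightarrow> 'h::complex_hilbert \<Rightarrow> 'h"
  assumes f: "\<forall>i\<in>{1..k}. positive_regular (n i) (a i)"
    and A_bounded: "\<forall>i\<in>{1..k}. \<forall>j\<in>{1..n i}. bounded_op (A i j)"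
    and A_convergent: "\<forall>i\<in>{1..k}. wot_summable
          (\<lambda>\<alpha> x. a i \<alpha> *\<^sub>R op_word (A i) \<alpha> (adjoint_op (op_word (A i) \<alpha>) x)) (words (n i))"
    and sum_convergent: "wot_summable
          (\<lambda>s x. (\<Prod>i=1..k. real ((s i + m i - 1) choose (m i - 1))) *\<^sub>R Phi_multi k n a A s id x)
          ({1..k} \<rightarrow>\<^sub>E UNIV)"
    and sum_bounded: "op_le
          (wot_sum
            (\<lambda>s x. (\<Prod>i=1..k. real ((s i + m i - 1) choose (m i - 1))) *\<^sub>R Phi_multi k n a A s id x)
            ({1..k} \<rightarrow>\<^sub>E UNIV))
          (\<lambda>x. b *\<^sub>R x)"
    and F: "finite F" "F \<subseteq> multiwords k n"
  shows "(\<Sum>\<alpha>\<in>F. (\<Prod>i\<in>{1..k}. b_coeff (a i) (m i) (\<alpha> i)) *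
    (norm (adjoint_op (op_multiword k A \<alpha>) x))\<^sup>2) \<le> b * (norm x)\<^sup>2"
proof -
  have set_eq: "set [1..<Suc k] = {1..k}" by auto
  have a: "\<forall>i\<in>{1..k}. \<forall>w\<in>words (n i). 0 \<le> a i w" "\<forall>i\<in>{1..k}. a i [] = 0"
    using f by (auto simp: positive_regular_def)
  let ?c = "\<lambda>s. \<Prod>i=1..k. real ((s i + m i - 1) choose (m i - 1))"
  let ?d = "\<lambda>s \<alpha>. \<Prod>i=1..k. conv_power (a i) (s i) (\<alpha> i)"
  let ?v = "\<lambda>\<alpha>. (norm (adjoint_op (op_multiword k A \<alpha>) x))\<^sup>2"
  have lower: "nonneg_op (Phi_multi k n a A s id) \<and>
      (\<Sum>\<alpha>\<in>F. ?d s \<alpha> * (norm (adjoint_op (op_multiword k A \<alpha>) x))\<^sup>2)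
      \<le> Re (cinner (Phi_multi k n a A s id x) x)" if "finite F" "F \<subseteq> multiwords k n" for F s x
    using Phi_along_lower_bound[of "[1..<Suc k]" n a A F s x, unfolded set_eq] that
      a(1) A_bounded A_convergent
    unfolding Phi_multi_eq_Phi_along op_multiword_eq_op_along multiwords_def by simp
  have lower0: "0 \<le> Re (cinner (Phi_multi k n a A s id x) x)" for s x
    using lower[of "{}"] by simp
  \<comment> \<open>The total of all lengths occurring in \<open>F\<close> serves as a crude common
    bound.\<close>
  obtain N where N: "\<And>\<alpha> i. \<alpha> \<in> F \<Longrightarrow> i \<in> {1..k} \<Longrightarrow> length (\<alpha> i) \<le> N"
  proof
    show "length (\<alpha> i) \<le> (\<Sum>\<alpha>\<in>F. \<Sum>i\<in>{1..k}. length (\<alpha> i))" if "\<alpha> \<in> F" "i \<in> {1..k}" for \<alpha> i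
    proof -
      have "length (\<alpha> i) \<le> (\<Sum>i\<in>{1..k}. length (\<alpha> i))"
        using that by (intro member_le_sum) auto
      also have "\<dots> \<le> (\<Sum>\<alpha>\<in>F. \<Sum>i\<in>{1..k}. length (\<alpha> i))"
        using that F by (intro member_le_sum[of \<alpha> F "\<lambda>\<alpha>. \<Sum>i\<in>{1..k}. length (\<alpha> i)"]) auto
      finally show ?thesis .
    qed
  qed
  let ?S = "\<Pi>\<^sub>E i\<in>{1..k}. {..N}"
  have S: "finite ?S" "?S \<subseteq> {1..k} \<rightarrow>\<^sub>E UNIV" by (auto intro: finite_PiE)
  let ?T = "wot_sum (\<lambda>s x. ?c s *\<^sub>R Phi_multi k n a A s id x) ({1..k} \<rightarrow>\<^sub>E UNIV)"
  have "(\<Sum>\<alpha>\<in>F. (\<Prod>i\<in>{1..k}. b_coeff (a i) (m i) (\<alpha> i)) * ?v \<alpha>)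
      = (\<Sum>\<alpha>\<in>F. \<Sum>s\<in>?S. ?c s * (?d s \<alpha> * ?v \<alpha>))"
  proof (rule sum.cong)
    fix \<alpha> assume "\<alpha> \<in> F"
    then show "(\<Prod>i\<in>{1..k}. b_coeff (a i) (m i) (\<alpha> i)) * ?v \<alpha> = (\<Sum>s\<in>?S. ?c s * (?d s \<alpha> * ?v \<alpha>))"
      using b_coeff_prod_eq[of "{1..k}" a \<alpha> N m] a(2) N
      by (simp add: sum_distrib_right mult.assoc)
  qed simp
  also have "\<dots> = (\<Sum>s\<in>?S. ?c s * (\<Sum>\<alpha>\<in>F. ?d s \<alpha> * ?v \<alpha>))"
    by (subst sum.swap) (simp add: sum_distrib_left)
  also have "\<dots> \<le> (\<Sum>s\<in>?S. ?c s * Re (cinner (Phi_multi k n a A s id x) x))"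
    by (intro sum_mono mult_left_mono conjunct2[OF lower] F prod_nonneg) auto
  also have "\<dots> = (\<Sum>s\<in>?S. Re (cinner (?c s *\<^sub>R Phi_multi k n a A s id x) x))"
    by (simp add: cinner.scaleR_left)
  also have "\<dots> \<le> Re (cinner (?T x) x)"
    by (rule wot_has_sum_finite_le[OF wot_has_sum_wot_sum[OF sum_convergent] S])
      (auto simp: cinner.scaleR_left intro!: mult_nonneg_nonneg lower0 prod_nonneg)
  also have "\<dots> \<le> Re (cinner (b *\<^sub>R x) x)"
    using sum_bounded by (simp add: op_le_def cinner.diff_left)
  also have "\<dots> = b * (norm x)\<^sup>2" by (simp add: cinner.scaleR_left cinner_self)
  finally show ?thesis .
qed

section \<open>Tensor products with a closed subspace\<close>

lemma ell2_eqI: "(\<And>i. ell2_nth x i = ell2_nth y i) \<Longrightarrow> x = y"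
  by (simp add: ell2_nth_inject[symmetric] fun_eq_iff)

lemma ell2_nth_scaleC: "ell2_nth (c *\<^sub>C x) i = c *\<^sub>C ell2_nth x i"
  by (simp add: scaleC_ell2.rep_eq)

lemma ell2_nth_zero: "ell2_nth 0 i = 0"
  by (simp add: zero_ell2.rep_eq)

lemma ell2_nth_Abs:
  "(\<lambda>i. (norm (f i))\<^sup>2) summable_on UNIV \<Longrightarrow> ell2_nth (Abs_ell2 f) i = f i"
  by (simp add: Abs_ell2_inverse)

lemma cinner_ket_right: "cinner x (ket i) = ell2_nth x i"
proof -
  have "cinner x (ket i) = (\<Sum>\<^sub>\<infinity>j. if j = i then ell2_nth x i else 0)"
    unfolding cinner_ell2_def by (rule infsum_cong) (simp add: ell2_nth_ket cinner_complex_def)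
  also have "\<dots> = (\<Sum>\<^sub>\<infinity>j\<in>{i}. ell2_nth x i)" by (rule infsum_cong_neutral) auto
  finally show ?thesis by simp
qed

lemma ell2_inj_summable:
  assumes "inj h"
  shows "(\<lambda>\<alpha>. (norm (ell2_nth x (h \<alpha>)))\<^sup>2) summable_on UNIV"
    and "(\<Sum>\<^sub>\<infinity>\<alpha>. (norm (ell2_nth x (h \<alpha>)))\<^sup>2) \<le> (norm x)\<^sup>2"
proof -
  show "(\<lambda>\<alpha>. (norm (ell2_nth x (h \<alpha>)))\<^sup>2) summable_on UNIV"
    using summable_on_reindex[OF assms, of "\<lambda>\<alpha>. (norm (ell2_nth x \<alpha>))\<^sup>2"] ell2_summable[of x]
    by (simp add: o_def)
  have "(\<Sum>\<^sub>\<infinity>\<alpha>. (norm (ell2_nth x (h \<alpha>)))\<^sup>2) = (\<Sum>\<^sub>\<infinity>\<alpha>\<in>range h. (norm (ell2_nth x \<alpha>))\<^sup>2)"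
    using infsum_reindex[OF assms, of "\<lambda>\<alpha>. (norm (ell2_nth x \<alpha>))\<^sup>2"] by (simp add: o_def)
  also have "\<dots> \<le> (norm x)\<^sup>2"
    unfolding norm_ell2_square by (rule infsum_mono2) (simp_all add: ell2_summable)
  finally show "(\<Sum>\<^sub>\<infinity>\<alpha>. (norm (ell2_nth x (h \<alpha>)))\<^sup>2) \<le> (norm x)\<^sup>2" .
qed

text \<open>Supplies the summability that \<open>Abs_ell2\<close> needs for shifted families: they
  live on an injective image of the index set and are dominated there, term by term, by a given
  vector.\<close>

lemma square_summable_transport:
  fixes g :: "'j \<Rightarrow> 'a::real_normed_vector"
  assumes h: "inj h" and g0: "\<And>\<beta>. \<beta> \<notin> range h \<Longrightarrow> g \<beta> = 0"
    and bound: "\<And>\<alpha>. (norm (g (h \<alpha>)))\<^sup>2 \<le> C * (norm (ell2_nth x \<alpha>))\<^sup>2"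
  shows "(\<lambda>\<beta>. (norm (g \<beta>))\<^sup>2) summable_on UNIV"
proof -
  have "(\<lambda>\<alpha>. (norm (g (h \<alpha>)))\<^sup>2) summable_on UNIV"
    by (rule summable_on_comparison_test[OF summable_on_cmult_right[OF ell2_summable, of C x]])
      (simp_all add: bound)
  then have "(\<lambda>\<beta>. (norm (g \<beta>))\<^sup>2) summable_on range h"
    using summable_on_reindex[OF h, of "\<lambda>\<beta>. (norm (g \<beta>))\<^sup>2"] by (simp add: o_def)
  then show ?thesis
    by (rule summable_on_cong_neutral[THEN iffD1, rotated -1]) (auto simp: g0)
qed

section \<open>Closed complex subspaces\<close>

lemma closed_csubspace_imp_subspace: "closed_csubspace U \<Longrightarrow> complex_vector.subspace U"
  by (simp add: closed_csubspace_def)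

lemma closed_csubspace_closure:
  assumes "complex_vector.subspace U"
  shows "closed_csubspace (closure U)"
  unfolding closed_csubspace_def
proof (intro conjI complex_vector.subspaceI)
  show "0 \<in> closure U"
    using complex_vector.subspace_0[OF assms] closure_subset by blast
  fix x y c assume x: "x \<in> closure U"
  obtain u where u: "\<And>l. u l \<in> U" "u \<longlonglongrightarrow> x" using x by (auto simp: closure_sequential)
  have "(\<lambda>l. c *\<^sub>C u l) \<longlonglongrightarrow> c *\<^sub>C x"
    by (rule bounded_linear.tendsto[OF bounded_linear_scaleC u(2)])
  moreover have "c *\<^sub>C u l \<in> U" for l
    using complex_vector.subspace_scale[OF assms u(1)] .
  ultimately show "c *\<^sub>C x \<in> closure U"
    unfolding closure_sequential by (intro exI[of _ "\<lambda>l. c *\<^sub>C u l"]) simp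
  assume "y \<in> closure U"
  then obtain v where v: "\<And>l. v l \<in> U" "v \<longlonglongrightarrow> y" by (auto simp: closure_sequential)
  have "(\<lambda>l. u l + v l) \<longlonglongrightarrow> x + y" by (intro tendsto_intros u v)
  moreover have "u l + v l \<in> U" for l
    using complex_vector.subspace_add[OF assms u(1) v(1)] .
  ultimately show "x + y \<in> closure U"
    unfolding closure_sequential by (intro exI[of _ "\<lambda>l. u l + v l"]) simp
qed simp

lemma closure_span_subset:
  assumes "closed_csubspace U" "S \<subseteq> U"
  shows "closure (complex_vector.span S) \<subseteq> U"
  using assms by (intro closure_minimal complex_vector.span_minimal) (auto simp: closed_csubspace_def)

lemma closed_csubspace_Int: "closed_csubspace U \<Longrightarrow> closed_csubspace V \<Longrightarrow> closed_csubspace (U \<inter> V)"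
  by (simp add: closed_csubspace_def complex_vector.subspace_inter closed_Int)

lemma closed_csubspace_orthogonal: "closed_csubspace {x. \<forall>y\<in>S. cinner x y = 0}"
proof -
  have "{x. \<forall>y\<in>S. cinner x y = 0} = (\<Inter>y\<in>S. {x. cinner x y = 0})" by auto
  then have "closed {x. \<forall>y\<in>S. cinner x y = 0}" by (simp add: closed_INT closed_orthogonal)
  then show ?thesis
    by (simp add: closed_csubspace_def complex_vector.subspace_def cinner_add_left
        cinner_scaleC_left cinner.zero_left)
qed

lemma closed_csubspace_orthogonal_right: "closed_csubspace {y. cinner x y = 0}"
  using closed_orthogonal_right[of x]
  by (simp add: closed_csubspace_def complex_vector.subspace_def cinner_add_right
      cinner_scaleC_right cinner.zero_right)

lemma closed_csubspace_vimage:
  assumes T: "bounded_op T" and U: "closed_csubspace U"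
  shows "closed_csubspace (T -` U)"
proof -
  have "closed (T -` U)"
    using U bounded_op_imp_bounded_linear[OF T]
    by (intro continuous_closed_vimage) (auto simp: closed_csubspace_def linear_continuous_at)
  moreover have "T 0 = 0" by (rule linear_0[OF bounded_linear.linear[OF bounded_op_imp_bounded_linear[OF T]]])
  ultimately show ?thesis
    using U by (simp add: closed_csubspace_def complex_vector.subspace_def bounded_op_addD[OF T]
        bounded_op_scaleD[OF T])
qed

text \<open>The slice of \<open>v\<close> by the functional \<open>\<lambda>h. cinner h g\<close>,
  and the adjoint of \<open>\<lambda>x. tensor x g\<close>.\<close>

definition partial_cinner :: "'h::complex_hilbert \<Rightarrow> ('i, 'h) ell2 \<Rightarrow> ('i, complex) ell2" where
  "partial_cinner g v = Abs_ell2 (\<lambda>\<alpha>. cinner (ell2_nth v \<alpha>) g)"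

lemma cmod_cinner_square_le: "(cmod (cinner x g))\<^sup>2 \<le> (norm g)\<^sup>2 * (norm x)\<^sup>2"
  using power_mono[OF norm_cinner_le[of x g], of 2] by (simp add: power_mult_distrib mult.commute)

lemma ell2_nth_partial_cinner: "ell2_nth (partial_cinner g v) \<alpha> = cinner (ell2_nth v \<alpha>) g"
  unfolding partial_cinner_def
  by (rule ell2_nth_Abs, rule square_summable_transport[where h="\<lambda>x. x" and C="(norm g)\<^sup>2" and x=v])
    (simp_all add: cmod_cinner_square_le)

lemma bounded_op_partial_cinner: "bounded_op (partial_cinner g)"
proof (rule bounded_opI[where K="norm g"])
  fix v
  have "(norm (partial_cinner g v))\<^sup>2 \<le> (\<Sum>\<^sub>\<infinity>\<alpha>. (norm g)\<^sup>2 * (norm (ell2_nth v \<alpha>))\<^sup>2)"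
    unfolding norm_ell2_square
    by (intro infsum_mono ell2_summable summable_on_cmult_right)
      (simp add: ell2_nth_partial_cinner cmod_cinner_square_le)
  also have "\<dots> = (norm g * norm v)\<^sup>2"
    by (simp add: infsum_cmult_right' norm_ell2_square power_mult_distrib)
  finally show "norm (partial_cinner g v) \<le> norm g * norm v"
    by (rule power2_le_imp_le) simp
qed (auto intro: ell2_eqI simp: ell2_nth_partial_cinner ell2_nth_add ell2_nth_scaleC cinner_add_left
    cinner_scaleC_left scaleC_complex_def)

lemma cinner_tensor_right: "cinner v (tensor x g) = cinner (partial_cinner g v) x"
  unfolding cinner_ell2_def
  by (rule infsum_cong)
    (simp add: ell2_nth_tensor ell2_nth_partial_cinner cinner_scaleC_right cinner_complex_def)

lemma partial_cinner_tensor: "partial_cinner g (tensor x h) = cinner h g *\<^sub>C x"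
  by (rule ell2_eqI)
    (simp add: ell2_nth_partial_cinner ell2_nth_tensor cinner_scaleC_left ell2_nth_scaleC scaleC_complex_def)

lemma closed_csubspace_tensor_space: "closed_csubspace (tensor_space N)"
  unfolding tensor_space_def by (intro closed_csubspace_closure complex_vector.subspace_span)

lemma tensor_in_tensor_space: "x \<in> N \<Longrightarrow> tensor x h \<in> tensor_space N"
  unfolding tensor_space_def
  by (rule closure_subset[THEN subsetD], rule complex_vector.span_base) auto

text \<open>
  If all partial inner products of \<open>v\<close> lie in \<open>N\<close>, then so do those of \<open>w = v - P v\<close>, with \<open>P\<close> the
  projection onto \<open>N \<otimes> H\<close>. They vanish, as \<open>w\<close> is orthogonal to \<open>N \<otimes> H\<close>.
\<close>

lemma tensor_space_iff:
  fixes v :: "('i, 'h::complex_hilbert) ell2"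
  assumes N: "closed_csubspace N"
  shows "v \<in> tensor_space N \<longleftrightarrow> (\<forall>g. partial_cinner g v \<in> N)"
proof
  note sub = closed_csubspace_imp_subspace[OF N]
  have mem: "partial_cinner g v \<in> N" if "v \<in> tensor_space N" for g and v :: "('i, 'h) ell2"
  proof -
    have "tensor_space N \<subseteq> partial_cinner g -` N"
      unfolding tensor_space_def
      by (intro closure_span_subset closed_csubspace_vimage bounded_op_partial_cinner N)
        (auto simp: partial_cinner_tensor intro: complex_vector.subspace_scale[OF sub])
    then show ?thesis using that by auto
  qed
  show "\<forall>g. partial_cinner g v \<in> N" if "v \<in> tensor_space N" using mem[OF that] by blast
  assume v: "\<forall>g. partial_cinner g v \<in> N"
  define w where "w = v - proj_on (tensor_space N) v"
  have "ell2_nth w \<alpha> = 0" for \<alpha>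
  proof -
    \<comment> \<open>Slicing by the coordinate itself makes entry \<open>\<alpha>\<close> of the
      slice of \<open>w\<close> the squared norm of that coordinate.\<close>
    let ?g = "ell2_nth w \<alpha>"
    have "partial_cinner ?g w = partial_cinner ?g v - partial_cinner ?g (proj_on (tensor_space N) v)"
      unfolding w_def
      by (rule linear_diff[OF bounded_linear.linear[OF bounded_op_imp_bounded_linear[OF bounded_op_partial_cinner]]])
    also have "\<dots> \<in> N"
      using v mem[OF proj_on_in[OF closed_csubspace_tensor_space]] complex_vector.subspace_diff[OF sub]
      by blast
    finally have "cinner w (tensor (partial_cinner ?g w) ?g) = 0"
      unfolding w_def
      by (intro proj_on_orthogonal closed_csubspace_tensor_space tensor_in_tensor_space)
    then have "partial_cinner ?g w = 0" by (simp add: cinner_tensor_right cinner_eq_zero_iff)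
    then have "ell2_nth (partial_cinner ?g w) \<alpha> = 0" by (simp add: ell2_nth_zero)
    then show ?thesis by (simp add: ell2_nth_partial_cinner cinner_eq_zero_iff)
  qed
  then have "w = 0" by (intro ell2_eqI) (simp add: ell2_nth_zero)
  then have "v = proj_on (tensor_space N) v" by (simp add: w_def)
  then show "v \<in> tensor_space N" using proj_on_in[OF closed_csubspace_tensor_space] by metis
qed

text \<open>Linearity gives equality on the span, and boundedness carries it to the closure. This
  settles uniqueness in the description of \<open>tensor_id\<close>.\<close>

lemma tensor_space_operator_unique:
  fixes R R' :: "('i, 'h::complex_hilbert) ell2 \<Rightarrow> 'b::complex_hilbert"
  assumes R: "bounded_clinear_on (tensor_space N) R" and R': "bounded_clinear_on (tensor_space N) R'"
    and eq: "\<And>x h. x \<in> N \<Longrightarrow> R (tensor x h) = R' (tensor x h)"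
    and v: "v \<in> tensor_space N"
  shows "R v = R' v"
proof -
  define U :: "('i, 'h) ell2 set" where "U = complex_vector.span {tensor x h | x h. x \<in> N}"
  have V: "complex_vector.subspace (tensor_space N :: ('i, 'h) ell2 set)"
    by (rule closed_csubspace_imp_subspace, rule closed_csubspace_tensor_space)
  have UV: "U \<subseteq> tensor_space N" unfolding U_def tensor_space_def by (rule closure_subset)
  have "u \<in> tensor_space N \<and> R u = R' u" if "u \<in> U" for u
    using that unfolding U_def
  proof (induct rule: complex_vector.span_induct_alt)
    case base
    have 0: "(0 :: ('i, 'h) ell2) \<in> tensor_space N" by (rule complex_vector.subspace_0[OF V])
    have zero: "S 0 = 0" if "bounded_clinear_on (tensor_space N) S" for S :: "('i, 'h) ell2 \<Rightarrow> 'b"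
    proof -
      have "S (0 *\<^sub>C 0) = 0 *\<^sub>C S 0" using that 0 unfolding bounded_clinear_on_def by blast
      then show ?thesis by simp
    qed
    show ?case using 0 zero[OF R] zero[OF R'] by simp
  next
    case (step c x y)
    then obtain x' h where x: "x = tensor x' h" "x' \<in> N" by auto
    have mem: "x \<in> tensor_space N" "y \<in> tensor_space N" "c *\<^sub>C x \<in> tensor_space N"
      using x step(2) complex_vector.subspace_scale[OF V] by (auto simp: tensor_in_tensor_space)
    have "R (c *\<^sub>C x + y) = c *\<^sub>C R x + R y" "R' (c *\<^sub>C x + y) = c *\<^sub>C R' x + R' y"
      using R R' mem unfolding bounded_clinear_on_def by simp_all
    then show ?case
      using step(2) eq[OF x(2)] x(1) complex_vector.subspace_add[OF V mem(3,2)] by simp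
  qed
  then have eqU: "R u = R' u" if "u \<in> U" for u using that by blast
  \<comment> \<open>The bound on \<open>S\<close> holds only on \<open>tensor_space N\<close>, so
    continuity is derived along sequences in \<open>U\<close>, whose differences from
    \<open>v\<close> stay in that subspace.\<close>
  have lim: "(\<lambda>l. S (u l)) \<longlonglongrightarrow> S v"
    if S: "bounded_clinear_on (tensor_space N) S" and u: "\<And>l. u l \<in> U" "u \<longlonglongrightarrow> v" for S :: "('i, 'h) ell2 \<Rightarrow> 'b" and u
  proof -
    obtain K where K: "\<And>x. x \<in> tensor_space N \<Longrightarrow> norm (S x) \<le> K * norm x"
      using S unfolding bounded_clinear_on_def by blast
    have bound: "norm (S (u l) - S v) \<le> norm (u l - v) * K" for l
    proof -
      have "u l - v \<in> tensor_space N" using u UV v complex_vector.subspace_diff[OF V] by blast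
      moreover have "S (u l - v) = S (u l) - S v"
      proof -
        have "S (u l - v + v) = S (u l - v) + S v"
          using S v \<open>u l - v \<in> tensor_space N\<close> unfolding bounded_clinear_on_def by blast
        then show ?thesis by simp
      qed
      ultimately show ?thesis using K[of "u l - v"] by (simp add: mult.commute)
    qed
    have "(\<lambda>l. norm (u l - v) * K) \<longlonglongrightarrow> norm (v - v) * K" by (intro tendsto_intros u)
    then have "(\<lambda>l. norm (u l - v) * K) \<longlonglongrightarrow> 0" by simp
    then have "(\<lambda>l. S (u l) - S v) \<longlonglongrightarrow> 0"
      by (rule Lim_null_comparison[rotated]) (simp add: bound)
    then show ?thesis by (simp add: LIM_zero_iff)
  qed
  obtain u where u: "\<And>l. u l \<in> U" "u \<longlonglongrightarrow> v"
    using v unfolding tensor_space_def U_def[symmetric] closure_sequential by blast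
  show ?thesis
    using lim[OF R u] lim[OF R' u] eqU[OF u(1)] LIMSEQ_unique by simp
qed

lemma tensor_id_eqI:
  fixes R :: "('i, 'h::complex_hilbert) ell2 \<Rightarrow> ('i, 'h) ell2"
  assumes R: "bounded_clinear_on (tensor_space N) R" "R ` tensor_space N \<subseteq> tensor_space N"
    and eq: "\<And>x h. x \<in> N \<Longrightarrow> R (tensor x h) = tensor (T x) h"
    and v: "v \<in> tensor_space N"
  shows "tensor_id N T v = R v"
proof -
  \<comment> \<open>The description in \<open>tensor_id\<close> demands the value 0 off the tensor
    space.\<close>
  define R0 where "R0 v = (if v \<in> tensor_space N then R v else 0)" for v
  have V: "complex_vector.subspace (tensor_space N :: ('i, 'h) ell2 set)"
    by (rule closed_csubspace_imp_subspace, rule closed_csubspace_tensor_space)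
  have R0: "bounded_clinear_on (tensor_space N) R0"
    using R(1) unfolding bounded_clinear_on_def R0_def
    by (simp add: complex_vector.subspace_add[OF V] complex_vector.subspace_scale[OF V])
  have "tensor_id N T = R0"
    unfolding tensor_id_def
  proof (rule the_equality)
    show "bounded_clinear_on (tensor_space N) R0 \<and> R0 ` tensor_space N \<subseteq> tensor_space N \<and>
      (\<forall>x\<in>N. \<forall>h. R0 (tensor x h) = tensor (T x) h) \<and> (\<forall>v. v \<notin> tensor_space N \<longrightarrow> R0 v = 0)"
      using R0 R(2) eq by (auto simp: R0_def tensor_in_tensor_space)
    fix S :: "('i, 'h) ell2 \<Rightarrow> ('i, 'h) ell2"
    assume S: "bounded_clinear_on (tensor_space N) S \<and> S ` tensor_space N \<subseteq> tensor_space N \<and>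
      (\<forall>x\<in>N. \<forall>h. S (tensor x h) = tensor (T x) h) \<and> (\<forall>v. v \<notin> tensor_space N \<longrightarrow> S v = 0)"
    show "S = R0"
    proof
      fix u
      show "S u = R0 u"
      proof (cases "u \<in> tensor_space N")
        case True
        show ?thesis
        proof (rule tensor_space_operator_unique[OF _ R0 _ True])
          show "S (tensor x h) = R0 (tensor x h)" if "x \<in> N" for x h
            using S that eq tensor_in_tensor_space[OF that, of h] by (simp add: R0_def)
        qed (use S in blast)
      next
        case False
        then show ?thesis using S by (simp add: R0_def)
      qed
    qed
  qed
  then show ?thesis using v by (simp add: R0_def)
qed

section \<open>The universal model\<close>

lemma op_word_commute:
  assumes "\<forall>t\<in>{1..n}. S \<circ> X t = X t \<circ> S" "w \<in> words n"
  shows "S \<circ> op_word X w = op_word X w \<circ> S"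
  using assms(2)
proof (induct w)
  case (Cons t w)
  have IH: "S \<circ> op_word X w = op_word X w \<circ> S" and t: "S \<circ> X t = X t \<circ> S"
    using Cons assms(1) by (auto simp: o_def)
  have "S \<circ> op_word X (t # w) = (S \<circ> X t) \<circ> op_word X w"
    by (simp only: op_word_Cons comp_assoc)
  also have "\<dots> = X t \<circ> (S \<circ> op_word X w)" by (simp only: t comp_assoc)
  also have "\<dots> = op_word X (t # w) \<circ> S" by (simp only: IH op_word_Cons comp_assoc)
  finally show ?case .
qed (simp only: op_word_Nil id_comp comp_id)

text \<open>The new letter moves to the front past the coordinates listed before \<open>i\<close>,
  with which it commutes.\<close>

lemma op_along_prepend:
  assumes "distinct l" "i \<in> set l" "\<forall>s\<in>set l. \<alpha> s \<in> words (n s)"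
    and "\<forall>s\<in>set l. s \<noteq> i \<longrightarrow> (\<forall>t\<in>{1..n s}. X i j \<circ> X s t = X s t \<circ> X i j)"
  shows "op_along X (\<alpha>(i := j # \<alpha> i)) l = X i j \<circ> op_along X \<alpha> l"
  using assms
proof (induct l)
  case (Cons s l)
  show ?case
  proof (cases "s = i")
    case True
    then have "op_along X (\<alpha>(i := j # \<alpha> i)) l = op_along X \<alpha> l"
      using Cons.prems by (intro op_along_cong) auto
    then show ?thesis using True by (simp only: op_along.simps op_word_Cons fun_upd_same comp_assoc)
  next
    case False
    then have "op_along X (\<alpha>(i := j # \<alpha> i)) l = X i j \<circ> op_along X \<alpha> l"
      using Cons.prems by (intro Cons.hyps) auto
    moreover have "X i j \<circ> op_word (X s) (\<alpha> s) = op_word (X s) (\<alpha> s) \<circ> X i j"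
      using Cons.prems False by (intro op_word_commute[where n="n s"]) (auto simp: o_def)
    ultimately show ?thesis using False
      by (simp only: op_along.simps fun_upd_other[OF False] comp_assoc[symmetric])
  qed
qed simp

section \<open>Weighted shifts and their adjoints\<close>

definition shift_weight :: "(nat list \<Rightarrow> real) \<Rightarrow> nat \<Rightarrow> nat \<Rightarrow> nat list \<Rightarrow> real" where
  "shift_weight a m j w = sqrt (b_coeff a m w / b_coeff a m (j # w))"

text \<open>A rearrangement of \<open>b_coeff_Cons_ge\<close>. The constant becomes the bound for
  the squared norm of the backward shift.\<close>

lemma shift_weight_square_le:
  assumes a: "positive_regular n a" and j: "j \<in> {1..n}" and w: "w \<in> words n"
  shows "(shift_weight a m j w)\<^sup>2 \<le> 1 / a [j]"
proof -
  have jw: "j # w \<in> words n" using j w by simp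
  have pos: "0 < b_coeff a m w" "0 < b_coeff a m (j # w)" "0 < a [j]"
    using b_coeff_pos[OF a w] b_coeff_pos[OF a jw] a j by (auto simp: positive_regular_def)
  then show ?thesis
    using b_coeff_Cons_ge[OF a jw, of m] by (simp add: shift_weight_def field_simps)
qed

text \<open>The index map behind the shift. It is injective on all functions, so sums over the whole
  index type can be reindexed along it.\<close>

definition prepend :: "nat \<Rightarrow> nat \<Rightarrow> (nat \<Rightarrow> nat list) \<Rightarrow> nat \<Rightarrow> nat list" where
  "prepend i j \<alpha> = \<alpha>(i := j # \<alpha> i)"

lemma inj_prepend: "inj (prepend i j)"
proof (rule injI, rule ext)
  fix \<alpha> \<beta> l assume eq: "prepend i j \<alpha> = prepend i j \<beta>"
  show "\<alpha> l = \<beta> l"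
    using fun_cong[OF eq, of l] fun_cong[OF eq, of i] by (auto simp: prepend_def split: if_splits)
qed

lemma prepend_eq: "\<beta> i = j # w \<Longrightarrow> prepend i j (\<beta>(i := w)) = \<beta>"
  by (auto simp: prepend_def)

lemma prepend_multiwords:
  "i \<in> {1..k} \<Longrightarrow> j \<in> {1..n i} \<Longrightarrow> prepend i j \<alpha> \<in> multiwords k n \<longleftrightarrow> \<alpha> \<in> multiwords k n"
  by (auto simp: prepend_def multiwords_def PiE_iff extensional_def split: if_splits)

text \<open>The operator \<open>\<^bold>W\<^sub>i\<^sub>,\<^sub>j\<^sup>* \<otimes> I\<^sub>H\<close>; the case \<open>H = \<complex>\<close> is \<open>\<^bold>W\<^sub>i\<^sub>,\<^sub>j\<^sup>*\<close>.\<close>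

definition backward_shift ::
  "(nat \<Rightarrow> nat) \<Rightarrow> (nat \<Rightarrow> nat) \<Rightarrow> (nat \<Rightarrow> nat list \<Rightarrow> real) \<Rightarrow> nat \<Rightarrow> nat \<Rightarrow>
   (nat \<Rightarrow> nat list, 'h::complex_hilbert) ell2 \<Rightarrow> (nat \<Rightarrow> nat list, 'h) ell2" where
  "backward_shift n m a i j v = Abs_ell2 (\<lambda>\<alpha>. if \<alpha> i \<in> words (n i)
     then shift_weight (a i) (m i) j (\<alpha> i) *\<^sub>R ell2_nth v (prepend i j \<alpha>) else 0)"

lemma ell2_nth_slice: "ell2_nth (slice i \<alpha> x) w = ell2_nth x (\<alpha>(i := w))"
proof -
  have "inj (\<lambda>w. \<alpha>(i := w))" by (rule injI) (metis fun_upd_same)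
  then show ?thesis
    unfolding slice_def by (intro ell2_nth_Abs ell2_inj_summable)
qed

context
  fixes k :: nat and n m :: "nat \<Rightarrow> nat" and a :: "nat \<Rightarrow> nat list \<Rightarrow> real" and i j :: nat
  assumes f: "\<forall>i\<in>{1..k}. positive_regular (n i) (a i)"
    and i: "i \<in> {1..k}" and j: "j \<in> {1..n i}"
begin

lemma pos_reg_i: "positive_regular (n i) (a i)"
  using f i by blast

lemma norm_backward_shift_term:
  "(norm (if \<alpha> i \<in> words (n i) then shift_weight (a i) (m i) j (\<alpha> i) *\<^sub>R ell2_nth v (prepend i j \<alpha>)
     else 0))\<^sup>2 \<le> 1 / a i [j] * (norm (ell2_nth v (prepend i j \<alpha>)))\<^sup>2"
proof (cases "\<alpha> i \<in> words (n i)")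
  case True
  then show ?thesis
    using mult_right_mono[OF shift_weight_square_le[OF pos_reg_i j True, of "m i"],
        of "(norm (ell2_nth v (prepend i j \<alpha>)))\<^sup>2"]
    by (simp add: power_mult_distrib)
next
  case False
  have "0 < a i [j]" using pos_reg_i j by (simp add: positive_regular_def)
  then show ?thesis using False by simp
qed

lemma ell2_nth_backward_shift:
  "ell2_nth (backward_shift n m a i j v) \<alpha> = (if \<alpha> i \<in> words (n i)
     then shift_weight (a i) (m i) j (\<alpha> i) *\<^sub>R ell2_nth v (prepend i j \<alpha>) else 0)"
  unfolding backward_shift_def
  by (intro ell2_nth_Abs summable_on_comparison_test[OF summable_on_cmult_right[OF
        ell2_inj_summable(1)[OF inj_prepend, of v i j], of "1 / a i [j]"]] norm_backward_shift_term) simp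

lemma bounded_op_backward_shift: "bounded_op (backward_shift n m a i j)"
proof (rule bounded_opI[where K="sqrt (1 / a i [j])"])
  fix v :: "(nat \<Rightarrow> nat list, 'h::complex_hilbert) ell2"
  have pos: "0 < a i [j]" using pos_reg_i j by (simp add: positive_regular_def)
  have "(norm (backward_shift n m a i j v))\<^sup>2
      \<le> (\<Sum>\<^sub>\<infinity>\<alpha>. 1 / a i [j] * (norm (ell2_nth v (prepend i j \<alpha>)))\<^sup>2)"
    unfolding norm_ell2_square
    by (intro infsum_mono ell2_summable summable_on_cmult_right ell2_inj_summable inj_prepend)
      (simp only: ell2_nth_backward_shift norm_backward_shift_term)
  also have "\<dots> = 1 / a i [j] * (\<Sum>\<^sub>\<infinity>\<alpha>. (norm (ell2_nth v (prepend i j \<alpha>)))\<^sup>2)"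
    by (rule infsum_cmult_right')
  also have "\<dots> \<le> 1 / a i [j] * (norm v)\<^sup>2"
    using pos by (intro mult_left_mono ell2_inj_summable inj_prepend) simp
  also have "\<dots> = (sqrt (1 / a i [j]) * norm v)\<^sup>2" using pos by (simp add: power_mult_distrib)
  finally show "norm (backward_shift n m a i j v) \<le> sqrt (1 / a i [j]) * norm v"
    by (rule power2_le_imp_le) (use pos in simp)
next
  fix v w :: "(nat \<Rightarrow> nat list, 'h::complex_hilbert) ell2" and c
  show "backward_shift n m a i j (v + w) = backward_shift n m a i j v + backward_shift n m a i j w"
    by (rule ell2_eqI) (simp add: ell2_nth_backward_shift ell2_nth_add scaleR_add_right)
  show "backward_shift n m a i j (c *\<^sub>C v) = c *\<^sub>C backward_shift n m a i j v"
    by (rule ell2_eqI)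
      (simp add: ell2_nth_backward_shift ell2_nth_scaleC scaleC_of_real[symmetric] scaleC_scaleC mult.commute)
qed

lemma ell2_nth_weighted_shift:
  "ell2_nth (weighted_shift (n i) (a i) (m i) j x) \<beta> = (case \<beta> of [] \<Rightarrow> 0
     | l # w \<Rightarrow> if l = j \<and> w \<in> words (n i) then of_real (shift_weight (a i) (m i) j w) * ell2_nth x w else 0)"
  unfolding weighted_shift_def shift_weight_def[symmetric]
proof (rule ell2_nth_Abs, rule square_summable_transport[where h="(#) j" and C="1 / a i [j]" and x=x])
  have pos: "0 < a i [j]" using pos_reg_i j by (simp add: positive_regular_def)
  show "(norm (case j # w of [] \<Rightarrow> 0
     | l # w \<Rightarrow> if l = j \<and> w \<in> words (n i) then of_real (shift_weight (a i) (m i) j w) * ell2_nth x w else 0))\<^sup>2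
     \<le> 1 / a i [j] * (norm (ell2_nth x w))\<^sup>2" for w
  proof (cases "w \<in> words (n i)")
    case True
    then show ?thesis
      using mult_right_mono[OF shift_weight_square_le[OF pos_reg_i j True, of "m i"],
          of "(norm (ell2_nth x w))\<^sup>2"]
      by (simp add: norm_mult power_mult_distrib)
  qed (use pos in simp)
qed (auto split: list.split)

text \<open>A slice freezes all coordinates but \<open>i\<close>, so the ampliation shifts the index
  at \<open>i\<close> alone. The support lies in the range of \<open>prepend i j\<close>, which
  yields the summability behind \<open>Abs_ell2\<close>.\<close>

lemma ell2_nth_multishift:
  "ell2_nth (multishift n m a i j x) \<alpha> = (case \<alpha> i of [] \<Rightarrow> 0
     | l # w \<Rightarrow> if l = j \<and> w \<in> words (n i)
         then of_real (shift_weight (a i) (m i) j w) * ell2_nth x (\<alpha>(i := w)) else 0)"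
  (is "_ = ?g \<alpha>")
proof -
  have pos: "0 < a i [j]" using pos_reg_i j by (simp add: positive_regular_def)
  have eq: "ell2_nth (weighted_shift (n i) (a i) (m i) j (slice i \<alpha> x)) (\<alpha> i) = ?g \<alpha>" for \<alpha>
    by (cases "\<alpha> i") (simp_all only: ell2_nth_weighted_shift ell2_nth_slice list.case)
  show ?thesis
    unfolding multishift_def ampliation_def eq
  proof (rule ell2_nth_Abs,
      rule square_summable_transport[where h="prepend i j" and C="1 / a i [j]" and x=x])
    show "?g \<beta> = 0" if "\<beta> \<notin> range (prepend i j)" for \<beta>
    proof -
      have "\<beta> i \<noteq> j # w" for w using that prepend_eq[of \<beta> i j w] by (metis rangeI)
      then show ?thesis by (auto split: list.split)
    qed
    show "(norm (?g (prepend i j \<alpha>)))\<^sup>2 \<le> 1 / a i [j] * (norm (ell2_nth x \<alpha>))\<^sup>2" for \<alpha>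
    proof (cases "\<alpha> i \<in> words (n i)")
      case True
      then show ?thesis
        using mult_right_mono[OF shift_weight_square_le[OF pos_reg_i j True, of "m i"],
            of "(norm (ell2_nth x \<alpha>))\<^sup>2"]
        by (simp add: prepend_def norm_mult power_mult_distrib)
    qed (use pos in \<open>simp add: prepend_def\<close>)
  qed (rule inj_prepend)
qed

text \<open>The shifted vector is supported on the range of \<open>prepend i j\<close>. Reindexing
  along this injection moves the shift to the other side, and the weights are real.\<close>

lemma cinner_multishift: "cinner (multishift n m a i j x) y = cinner x (backward_shift n m a i j y)"
proof -
  let ?g = "\<lambda>\<beta>. cinner (ell2_nth (multishift n m a i j x) \<beta>) (ell2_nth y \<beta>)"
  have "?g \<beta> = 0" if "\<beta> \<notin> range (prepend i j)" for \<beta>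
  proof -
    have "\<beta> i \<noteq> j # w" for w using that prepend_eq[of \<beta> i j w] by (metis rangeI)
    then have "ell2_nth (multishift n m a i j x) \<beta> = 0"
      by (auto simp: ell2_nth_multishift split: list.split)
    then show ?thesis by (simp add: cinner.zero_left)
  qed
  then have "infsum ?g UNIV = infsum ?g (range (prepend i j))"
    by (intro infsum_cong_neutral) auto
  also have "\<dots> = infsum (?g \<circ> prepend i j) UNIV" by (rule infsum_reindex[OF inj_prepend])
  also have "\<dots> = (\<Sum>\<^sub>\<infinity>\<alpha>. cinner (ell2_nth x \<alpha>) (ell2_nth (backward_shift n m a i j y) \<alpha>))"
    by (rule infsum_cong)
      (simp add: ell2_nth_multishift ell2_nth_backward_shift cinner_complex_def,
        simp add: prepend_def scaleR_conv_of_real)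
  finally show ?thesis by (simp add: cinner_ell2_def)
qed

lemma backward_shift_tensor:
  "backward_shift n m a i j (tensor x h) = tensor (backward_shift n m a i j x) h"
  by (rule ell2_eqI)
    (simp add: ell2_nth_backward_shift ell2_nth_tensor scaleC_of_real[symmetric] scaleC_scaleC scaleC_complex_def)

text \<open>The shift acts on indices and the slice on values. With \<open>tensor_space_iff\<close>
  this reduces invariance of the tensor product to the scalar case.\<close>

lemma partial_cinner_backward_shift:
  "partial_cinner g (backward_shift n m a i j v) = backward_shift n m a i j (partial_cinner g v)"
  by (rule ell2_eqI)
    (simp add: ell2_nth_backward_shift ell2_nth_partial_cinner cinner.scaleR_left cinner.zero_left)

end

section \<open>The subspace of the variety and its universal model\<close>

lemma multishift_commute:
  assumes f: "\<forall>i\<in>{1..k}. positive_regular (n i) (a i)"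
    and s: "s \<in> {1..k}" "j \<in> {1..n s}" and t: "t \<in> {1..k}" "l \<in> {1..n t}" and "s \<noteq> t"
  shows "multishift n m a s j \<circ> multishift n m a t l = multishift n m a t l \<circ> multishift n m a s j"
proof (rule ext, rule ell2_eqI)
  show "ell2_nth ((multishift n m a s j \<circ> multishift n m a t l) x) \<alpha>
    = ell2_nth ((multishift n m a t l \<circ> multishift n m a s j) x) \<alpha>" for x \<alpha>
    using \<open>s \<noteq> t\<close>
    by (simp add: ell2_nth_multishift[OF f s] ell2_nth_multishift[OF f t] fun_upd_twist
        split: list.split)
qed

text \<open>Both defining conditions are orthogonality conditions: \<open>fock_tensor\<close> is the
  complement of the basis vectors whose index is not a multiword.\<close>

lemma closed_csubspace_N_space: "closed_csubspace (N_space k n m a Q)"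
proof -
  have "fock_tensor k n = {x. \<forall>y\<in>ket ` (- multiwords k n). cinner x y = 0}"
    by (auto simp: fock_tensor_def cinner_ket_right)
  then have "closed_csubspace (fock_tensor k n)" by (simp only: closed_csubspace_orthogonal)
  moreover have "N_space k n m a Q = fock_tensor k n \<inter> {x. \<forall>y\<in>M_space k n m a Q. cinner x y = 0}"
    by (auto simp: N_space_def)
  ultimately show ?thesis by (simp only: closed_csubspace_Int closed_csubspace_orthogonal)
qed

text \<open>The vectors orthogonal to \<open>x\<close> form a closed subspace, so testing on the
  generators of \<open>M_space\<close> is enough.\<close>

lemma N_space_iff:
  "x \<in> N_space k n m a Q \<longleftrightarrow> x \<in> fock_tensor k n \<and>
    (\<forall>\<alpha>\<in>multiwords k n. \<forall>\<beta>\<in>multiwords k n. \<forall>q\<in>Q. \<forall>c.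
      cinner x (op_multiword k (multishift n m a) \<alpha> (poly_op k q (multishift n m a)
        (op_multiword k (multishift n m a) \<beta> (c *\<^sub>C vacuum k)))) = 0)"
  (is "_ \<longleftrightarrow> _ \<and> ?R")
proof -
  have "(\<forall>y\<in>M_space k n m a Q. cinner x y = 0) \<longleftrightarrow> ?R"
  proof
    assume orth: "\<forall>y\<in>M_space k n m a Q. cinner x y = 0"
    show ?R
    proof (intro ballI allI)
      fix \<alpha> \<beta> q c assume "\<alpha> \<in> multiwords k n" "\<beta> \<in> multiwords k n" "q \<in> Q"
      then have "op_multiword k (multishift n m a) \<alpha> (poly_op k q (multishift n m a)
          (op_multiword k (multishift n m a) \<beta> (c *\<^sub>C vacuum k))) \<in> M_space k n m a Q"
        unfolding M_space_def
        by (intro closure_subset[THEN subsetD] complex_vector.span_base) blast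
      then show "cinner x (op_multiword k (multishift n m a) \<alpha> (poly_op k q (multishift n m a)
          (op_multiword k (multishift n m a) \<beta> (c *\<^sub>C vacuum k)))) = 0"
        using orth by blast
    qed
  next
    assume ?R
    then have "M_space k n m a Q \<subseteq> {y. cinner x y = 0}"
      unfolding M_space_def
      by (intro closure_span_subset closed_csubspace_orthogonal_right) auto
    then show "\<forall>y\<in>M_space k n m a Q. cinner x y = 0" by blast
  qed
  then show ?thesis by (simp add: N_space_def)
qed

lemma op_multiword_prepend:
  assumes i: "i \<in> {1..k}" and \<alpha>: "\<alpha> \<in> multiwords k n"
    and "\<forall>s\<in>{1..k}. s \<noteq> i \<longrightarrow> (\<forall>t\<in>{1..n s}. X i j \<circ> X s t = X s t \<circ> X i j)"
  shows "op_multiword k X (prepend i j \<alpha>) = X i j \<circ> op_multiword k X \<alpha>"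
  unfolding op_multiword_eq_op_along prepend_def
  by (rule op_along_prepend[where n=n]) (use assms in \<open>auto simp: multiwords_def PiE_iff\<close>)

text \<open>Prepending a letter to \<open>\<alpha>\<close> sends generators of
  \<open>M_space\<close> to generators; hence the complement is invariant under the adjoint of the
  shift.\<close>

lemma backward_shift_N_space:
  assumes f: "\<forall>i\<in>{1..k}. positive_regular (n i) (a i)"
    and i: "i \<in> {1..k}" and j: "j \<in> {1..n i}" and x: "x \<in> N_space k n m a Q"
  shows "backward_shift n m a i j x \<in> N_space k n m a Q"
proof -
  let ?W = "multishift n m a"
  have "x \<in> fock_tensor k n" using x by (simp add: N_space_def)
  then have "backward_shift n m a i j x \<in> fock_tensor k n"
    by (auto simp: fock_tensor_def ell2_nth_backward_shift[OF f i j] prepend_multiwords[of i k j n, OF i j])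
  moreover have "cinner (backward_shift n m a i j x) (op_multiword k ?W \<alpha> (poly_op k q ?W
        (op_multiword k ?W \<beta> (c *\<^sub>C vacuum k)))) = 0"
    if \<alpha>: "\<alpha> \<in> multiwords k n" and "\<beta> \<in> multiwords k n" "q \<in> Q" for \<alpha> \<beta> q c
  proof -
    let ?u = "poly_op k q ?W (op_multiword k ?W \<beta> (c *\<^sub>C vacuum k))"
    have eq: "op_multiword k ?W (prepend i j \<alpha>) = ?W i j \<circ> op_multiword k ?W \<alpha>"
      by (rule op_multiword_prepend[OF i \<alpha>]) (use multishift_commute[OF f i j] in auto)
    have "cinner (?W i j (op_multiword k ?W \<alpha> ?u)) x
        = cinner (op_multiword k ?W \<alpha> ?u) (backward_shift n m a i j x)"
      by (rule cinner_multishift[OF f i j])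
    moreover have "cinner x (op_multiword k ?W (prepend i j \<alpha>) ?u) = 0"
      using x that prepend_multiwords[of i k j n, OF i j] unfolding N_space_iff by blast
    then have "cinner x (?W i j (op_multiword k ?W \<alpha> ?u)) = 0" by (simp only: eq o_apply)
    ultimately show ?thesis
      using cinner_commute[of x "?W i j (op_multiword k ?W \<alpha> ?u)"]
        cinner_commute[of "backward_shift n m a i j x" "op_multiword k ?W \<alpha> ?u"] by simp
  qed
  ultimately show ?thesis unfolding N_space_iff by blast
qed

lemma backward_shift_tensor_space:
  assumes f: "\<forall>i\<in>{1..k}. positive_regular (n i) (a i)"
    and i: "i \<in> {1..k}" and j: "j \<in> {1..n i}" and v: "v \<in> tensor_space (N_space k n m a Q)"
  shows "backward_shift n m a i j v \<in> tensor_space (N_space k n m a Q)"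
  using v backward_shift_N_space[OF f i j]
  by (simp add: tensor_space_iff[OF closed_csubspace_N_space] partial_cinner_backward_shift[OF f i j])

lemma universal_model_adj_eq:
  assumes f: "\<forall>i\<in>{1..k}. positive_regular (n i) (a i)"
    and i: "i \<in> {1..k}" and j: "j \<in> {1..n i}" and v: "v \<in> tensor_space (N_space k n m a Q)"
  shows "universal_model_adj k n m a Q i j v = backward_shift n m a i j v"
  unfolding universal_model_adj_def Let_def
proof (rule tensor_id_eqI[OF _ _ _ v])
  let ?N = "N_space k n m a Q"
  show "bounded_clinear_on (tensor_space ?N) (backward_shift n m a i j)"
    using bounded_op_backward_shift[OF f i j, of m] unfolding bounded_clinear_on_def by blast
  show "backward_shift n m a i j ` tensor_space ?N \<subseteq> tensor_space ?N"
    using backward_shift_tensor_space[OF f i j] by blast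
  fix x h assume x: "x \<in> ?N"
  have "adjoint_on ?N (universal_model k n m a Q i j) x = backward_shift n m a i j x"
  proof (rule adjoint_on_eqI[OF closed_csubspace_imp_subspace[OF closed_csubspace_N_space] x])
    show "backward_shift n m a i j x \<in> ?N" by (rule backward_shift_N_space[OF f i j x])
    show "cinner (universal_model k n m a Q i j z) x = cinner z (backward_shift n m a i j x)" for z
      unfolding universal_model_def
      by (simp add: cinner_proj_on[OF closed_csubspace_N_space x] cinner_multishift[OF f i j])
  qed
  then show "backward_shift n m a i j (tensor x h)
      = tensor (adjoint_on ?N (universal_model k n m a Q i j) x) h"
    by (simp add: backward_shift_tensor[OF f i j])
qed

section \<open>The Poisson kernel\<close>

definition poisson_kernel ::
  "nat \<Rightarrow> (nat \<Rightarrow> nat) \<Rightarrow> (nat \<Rightarrow> nat) \<Rightarrow> (nat \<Rightarrow> nat list \<Rightarrow> real) \<Rightarrow>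
   (nat \<Rightarrow> nat \<Rightarrow> 'h \<Rightarrow> 'h) \<Rightarrow> 'h::complex_hilbert \<Rightarrow> (nat \<Rightarrow> nat list, 'h) ell2" where
  "poisson_kernel k n m a A h = Abs_ell2 (\<lambda>\<alpha>. if \<alpha> \<in> multiwords k n
     then sqrt (\<Prod>i\<in>{1..k}. b_coeff (a i) (m i) (\<alpha> i)) *\<^sub>R adjoint_op (op_multiword k A \<alpha>) h
     else 0)"

lemma vacuum_index: "(\<lambda>i\<in>{1..k}. []) \<in> multiwords k n"
  by (auto simp: multiwords_def)

lemma op_multiword_vacuum_index: "op_multiword k X (\<lambda>i\<in>{1..k}. []) = id"
proof -
  have "op_along X (\<lambda>i\<in>{1..k}. []) l = id" if "set l \<subseteq> {1..k}" for l
    using that by (induct l) simp_all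
  from this[of "[1..<Suc k]"] show ?thesis
    unfolding op_multiword_eq_op_along by (simp del: upt_Suc add: atLeastLessThanSuc_atLeastAtMost)
qed

context
  fixes k :: nat and n m :: "nat \<Rightarrow> nat" and a :: "nat \<Rightarrow> nat list \<Rightarrow> real"
    and A :: "nat \<Rightarrow> nat \<Rightarrow> 'h::complex_hilbert \<Rightarrow> 'h" and b :: real
  assumes f: "\<forall>i\<in>{1..k}. positive_regular (n i) (a i)"
    and A_bounded: "\<forall>i\<in>{1..k}. \<forall>j\<in>{1..n i}. bounded_op (A i j)"
    and A_commute: "\<forall>s\<in>{1..k}. \<forall>t\<in>{1..k}. s \<noteq> t \<longrightarrow>
          (\<forall>j\<in>{1..n s}. \<forall>l\<in>{1..n t}. A s j \<circ> A t l = A t l \<circ> A s j)"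
    and b: "0 < b"
    and norm_bound: "\<And>F x. finite F \<Longrightarrow> F \<subseteq> multiwords k n \<Longrightarrow>
      (\<Sum>\<alpha>\<in>F. (\<Prod>i\<in>{1..k}. b_coeff (a i) (m i) (\<alpha> i)) *
        (norm (adjoint_op (op_multiword k A \<alpha>) x))\<^sup>2) \<le> b * (norm x)\<^sup>2"
begin

private abbreviation "b_multi \<alpha> \<equiv> \<Prod>i\<in>{1..k}. b_coeff (a i) (m i) (\<alpha> i)"
private abbreviation "poisson \<equiv> poisson_kernel k n m a A"
private abbreviation "wshift \<equiv> multishift n m a"

lemma b_multi_pos: "\<alpha> \<in> multiwords k n \<Longrightarrow> 0 < b_multi \<alpha>"
  using f by (intro prod_pos) (auto simp: multiwords_def PiE_iff intro!: b_coeff_pos)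

lemma bounded_op_multiword: "\<alpha> \<in> multiwords k n \<Longrightarrow> bounded_op (op_multiword k A \<alpha>)"
  unfolding op_multiword_eq_op_along
  by (rule bounded_op_along[where n=n]) (use A_bounded in \<open>auto simp: multiwords_def PiE_iff\<close>)

lemma poisson_kernel_finite_sum_le:
  assumes "finite F"
  shows "(\<Sum>\<alpha>\<in>F. (norm (if \<alpha> \<in> multiwords k n
     then sqrt (b_multi \<alpha>) *\<^sub>R adjoint_op (op_multiword k A \<alpha>) h else 0))\<^sup>2) \<le> b * (norm h)\<^sup>2"
proof -
  have "(\<Sum>\<alpha>\<in>F. (norm (if \<alpha> \<in> multiwords k n
      then sqrt (b_multi \<alpha>) *\<^sub>R adjoint_op (op_multiword k A \<alpha>) h else 0))\<^sup>2)
    = (\<Sum>\<alpha>\<in>F \<inter> multiwords k n. b_multi \<alpha> * (norm (adjoint_op (op_multiword k A \<alpha>) h))\<^sup>2)"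
  proof (rule sum.mono_neutral_cong_right)
    fix \<alpha> assume "\<alpha> \<in> F \<inter> multiwords k n"
    then have "\<alpha> \<in> multiwords k n" "0 \<le> b_multi \<alpha>" using b_multi_pos less_imp_le by blast+
    then show "(norm (if \<alpha> \<in> multiwords k n
        then sqrt (b_multi \<alpha>) *\<^sub>R adjoint_op (op_multiword k A \<alpha>) h else 0))\<^sup>2
      = b_multi \<alpha> * (norm (adjoint_op (op_multiword k A \<alpha>) h))\<^sup>2"
      by (simp add: power_mult_distrib)
  qed (use assms in auto)
  also have "\<dots> \<le> b * (norm h)\<^sup>2" by (rule norm_bound) (use assms in auto)
  finally show ?thesis .
qed

lemma poisson_kernel_summable:
  "(\<lambda>\<alpha>. (norm (if \<alpha> \<in> multiwords k n
     then sqrt (b_multi \<alpha>) *\<^sub>R adjoint_op (op_multiword k A \<alpha>) h else 0))\<^sup>2) summable_on UNIV"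
  by (rule nonneg_bdd_above_summable_on, simp, rule bdd_aboveI2[where M="b * (norm h)\<^sup>2"])
    (rule poisson_kernel_finite_sum_le, simp)

lemma ell2_nth_poisson_kernel:
  "ell2_nth (poisson h) \<alpha> = (if \<alpha> \<in> multiwords k n
     then sqrt (b_multi \<alpha>) *\<^sub>R adjoint_op (op_multiword k A \<alpha>) h else 0)"
  unfolding poisson_kernel_def by (rule ell2_nth_Abs, rule poisson_kernel_summable)

lemma bounded_op_poisson_kernel: "bounded_op poisson"
proof (rule bounded_opI[where K="sqrt b"])
  fix h h' c
  have "(norm (poisson h))\<^sup>2 \<le> b * (norm h)\<^sup>2"
    unfolding norm_ell2_square ell2_nth_poisson_kernel
    by (rule infsum_le_finite_sums[OF poisson_kernel_summable poisson_kernel_finite_sum_le])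
  also have "\<dots> = (sqrt b * norm h)\<^sup>2" using b by (simp add: power_mult_distrib)
  finally show "norm (poisson h) \<le> sqrt b * norm h" by (rule power2_le_imp_le) (use b in simp)
  have "bounded_op (adjoint_op (op_multiword k A \<alpha>))" if "\<alpha> \<in> multiwords k n" for \<alpha>
    by (intro bounded_op_adjoint bounded_op_multiword that)
  then show "poisson (h + h') = poisson h + poisson h'" "poisson (c *\<^sub>C h) = c *\<^sub>C poisson h"
    by (auto intro!: ell2_eqI simp: ell2_nth_poisson_kernel ell2_nth_add ell2_nth_scaleC
        bounded_op_addD bounded_op_scaleD scaleC_add_right scaleC_of_real[symmetric] scaleC_scaleC
        mult.commute)
qed

lemma poisson_kernel_norm_ge: "norm h \<le> norm (poisson h)"
proof -
  have "b_multi (\<lambda>i\<in>{1..k}. []) = 1" by (simp add: b_coeff_def)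
  then have "ell2_nth (poisson h) (\<lambda>i\<in>{1..k}. []) = h"
    unfolding ell2_nth_poisson_kernel op_multiword_vacuum_index adjoint_op_id
    using vacuum_index[of k n] by simp
  then show ?thesis using norm_ell2_nth_le[of "poisson h" "\<lambda>i\<in>{1..k}. []"] by simp
qed

text \<open>Prepending changes only the factor \<open>i\<close> of the product of the
  \<open>b_coeff\<close>, and the shift weight is exactly the quotient that restores the old square
  root. The adjoint of the new leftmost letter is the one applied to \<open>h\<close> first.\<close>

lemma backward_shift_poisson_kernel:
  assumes i: "i \<in> {1..k}" and j: "j \<in> {1..n i}"
  shows "backward_shift n m a i j (poisson h) = poisson (adjoint_op (A i j) h)"
proof (rule ell2_eqI)
  fix \<alpha>
  note prepend_mem = prepend_multiwords[of i k j n, OF i j]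
  show "ell2_nth (backward_shift n m a i j (poisson h)) \<alpha> = ell2_nth (poisson (adjoint_op (A i j) h)) \<alpha>"
  proof (cases "\<alpha> \<in> multiwords k n")
    case True
    then have \<alpha>i: "\<alpha> i \<in> words (n i)" using i by (auto simp: multiwords_def)
    have mult: "op_multiword k A (prepend i j \<alpha>) = A i j \<circ> op_multiword k A \<alpha>"
    proof (rule op_multiword_prepend[OF i True], intro ballI impI)
      fix s t assume "s \<in> {1..k}" "s \<noteq> i" "t \<in> {1..n s}"
      then show "A i j \<circ> A s t = A s t \<circ> A i j"
        by (intro A_commute[rule_format]) (use i j in auto)
    qed
    have adj: "adjoint_op (op_multiword k A (prepend i j \<alpha>)) h
        = adjoint_op (op_multiword k A \<alpha>) (adjoint_op (A i j) h)"
      unfolding mult using A_bounded i j bounded_op_multiword[OF True]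
      by (subst adjoint_op_comp) auto
    have pos: "0 < b_coeff (a i) (m i) (\<alpha> i)" "0 < b_coeff (a i) (m i) (j # \<alpha> i)"
      using b_coeff_pos[OF bspec[OF f i]] \<alpha>i j by auto
    have split: "b_multi \<beta> = b_coeff (a i) (m i) (\<beta> i) * (\<Prod>l\<in>{1..k} - {i}. b_coeff (a l) (m l) (\<beta> l))"
      for \<beta> using i by (simp add: prod.remove)
    have "(\<Prod>l\<in>{1..k} - {i}. b_coeff (a l) (m l) (prepend i j \<alpha> l))
        = (\<Prod>l\<in>{1..k} - {i}. b_coeff (a l) (m l) (\<alpha> l))"
      by (rule prod.cong) (auto simp: prepend_def)
    then have "shift_weight (a i) (m i) j (\<alpha> i) * sqrt (b_multi (prepend i j \<alpha>)) = sqrt (b_multi \<alpha>)"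
      using pos unfolding split[of \<alpha>] split[of "prepend i j \<alpha>"] shift_weight_def
      by (simp add: prepend_def real_sqrt_mult[symmetric])
    then show ?thesis
      using True \<alpha>i
      by (simp add: ell2_nth_backward_shift[OF f i j] ell2_nth_poisson_kernel prepend_mem adj)
  next
    case False
    then show ?thesis
      by (simp add: ell2_nth_backward_shift[OF f i j] ell2_nth_poisson_kernel prepend_mem)
  qed
qed

text \<open>Letter by letter, a shift in the right slot becomes a backward shift in the left slot
  and then, through the kernel, an adjoint acting on \<open>h\<close>; hence \<open>h\<close> varies
  in the induction.\<close>

lemma cinner_poisson_kernel_op_word:
  assumes i: "i \<in> {1..k}" and w: "w \<in> words (n i)"
  shows "cinner (partial_cinner g (poisson h)) (op_word (wshift i) w x)
    = cinner (partial_cinner g (poisson (adjoint_op (op_word (A i) w) h))) x"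
  using w
proof (induct w arbitrary: h)
  case Nil
  show ?case unfolding op_word_Nil adjoint_op_id by simp
next
  case (Cons j w)
  then have j: "j \<in> {1..n i}" and w: "w \<in> words (n i)" by auto
  let ?u = "op_word (wshift i) w x"
  have "cinner (partial_cinner g (poisson h)) (wshift i j ?u)
      = cnj (cinner ?u (backward_shift n m a i j (partial_cinner g (poisson h))))"
    using cinner_commute cinner_multishift[OF f i j] by metis
  also have "\<dots> = cinner (partial_cinner g (poisson (adjoint_op (A i j) h))) ?u"
    unfolding partial_cinner_backward_shift[OF f i j, symmetric] backward_shift_poisson_kernel[OF i j]
    by (rule cinner_commute[symmetric])
  also have "\<dots> = cinner (partial_cinner g (poisson (adjoint_op (op_word (A i) w) (adjoint_op (A i j) h)))) x"
    by (rule Cons.hyps[OF w])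
  also have "adjoint_op (op_word (A i) w) (adjoint_op (A i j) h) = adjoint_op (op_word (A i) (j # w)) h"
  proof -
    have "bounded_op (op_word (A i) w)"
      by (rule bounded_op_word[where n="n i"]) (use A_bounded i w in auto)
    then show ?thesis using A_bounded i j by (simp add: op_word_Cons adjoint_op_comp)
  qed
  finally show ?case by (simp only: op_word_Cons[of "wshift i"] o_apply)
qed

lemma cinner_poisson_kernel_op_multiword:
  assumes \<alpha>: "\<alpha> \<in> multiwords k n"
  shows "cinner (partial_cinner g (poisson h)) (op_multiword k wshift \<alpha> x)
    = cinner (partial_cinner g (poisson (adjoint_op (op_multiword k A \<alpha>) h))) x"
proof -
  have "cinner (partial_cinner g (poisson h)) (op_along wshift \<alpha> l x)
      = cinner (partial_cinner g (poisson (adjoint_op (op_along A \<alpha> l) h))) x"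
    if "set l \<subseteq> {1..k}" for l
    using that
  proof (induct l arbitrary: h)
    case Nil
    show ?case unfolding op_along.simps adjoint_op_id by simp
  next
    case (Cons i l)
    then have i: "i \<in> {1..k}" and l: "set l \<subseteq> {1..k}" by auto
    have \<alpha>i: "\<alpha> i \<in> words (n i)" using \<alpha> i by (auto simp: multiwords_def)
    have "bounded_op (op_word (A i) (\<alpha> i))"
      by (rule bounded_op_word[where n="n i"]) (use A_bounded i \<alpha>i in auto)
    moreover have "bounded_op (op_along A \<alpha> l)"
      by (rule bounded_op_along[where n=n])
        (use A_bounded l \<alpha> in \<open>auto simp: multiwords_def PiE_iff subset_iff\<close>)
    ultimately have A: "adjoint_op (op_along A \<alpha> (i # l))
        = adjoint_op (op_along A \<alpha> l) \<circ> adjoint_op (op_word (A i) (\<alpha> i))"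
      unfolding op_along.simps by (rule adjoint_op_comp)
    show ?case
      unfolding A o_apply op_along.simps(2)[of wshift] cinner_poisson_kernel_op_word[OF i \<alpha>i]
      by (rule Cons.hyps[OF l])
  qed
  from this[of "[1..<Suc k]"] show ?thesis
    unfolding op_multiword_eq_op_along by (simp del: upt_Suc add: atLeastLessThanSuc_atLeastAtMost)
qed

text \<open>The shifts of a generator of \<open>M_space\<close> turn into adjoints acting on
  \<open>h\<close>. Those from \<open>q\<close> and \<open>\<beta>\<close> are moved back to the
  right, where the pairing contains \<open>poly_op k q A\<close> and vanishes.\<close>

lemma poisson_kernel_tensor_space:
  assumes Q: "Q \<subseteq> nc_polys k n" and A_variety: "\<forall>q\<in>Q. \<forall>x. poly_op k q A x = 0"
  shows "poisson h \<in> tensor_space (N_space k n m a Q)"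
proof -
  have "partial_cinner g (poisson h) \<in> N_space k n m a Q" for g
    unfolding N_space_iff
  proof (intro conjI ballI allI)
    show "partial_cinner g (poisson h) \<in> fock_tensor k n"
      by (simp add: fock_tensor_def ell2_nth_partial_cinner ell2_nth_poisson_kernel cinner.zero_left)
    fix \<alpha> \<beta> q c assume \<alpha>: "\<alpha> \<in> multiwords k n" and \<beta>: "\<beta> \<in> multiwords k n" and q: "q \<in> Q"
    define h' where "h' = adjoint_op (op_multiword k A \<alpha>) h"
    have keys: "\<gamma> \<in> Poly_Mapping.keys q \<Longrightarrow> \<gamma> \<in> multiwords k n" for \<gamma>
      using Q q by (auto simp: nc_polys_def)
    \<comment> \<open>The vacuum reads off the coordinate at the empty multiword, where the kernel
      returns \<open>u\<close> itself.\<close>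
    have coeff: "cinner (partial_cinner g (poisson u)) (c *\<^sub>C vacuum k) = cnj c * cinner u g" for u
    proof -
      have "b_multi (\<lambda>i\<in>{1..k}. []) = 1" by (simp add: b_coeff_def)
      then have "ell2_nth (poisson u) (\<lambda>i\<in>{1..k}. []) = u"
        unfolding ell2_nth_poisson_kernel op_multiword_vacuum_index adjoint_op_id
        using vacuum_index[of k n] by simp
      then show ?thesis
        by (simp add: vacuum_def cinner_scaleC_right cinner_ket_right ell2_nth_partial_cinner)
    qed
    have summand: "cinner (partial_cinner g (poisson h')) (op_multiword k wshift \<gamma> (op_multiword k wshift \<beta> (c *\<^sub>C vacuum k)))
        = cnj c * cinner h' (op_multiword k A \<gamma> (op_multiword k A \<beta> g))" if "\<gamma> \<in> multiwords k n" for \<gamma>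
      unfolding cinner_poisson_kernel_op_multiword[OF that] cinner_poisson_kernel_op_multiword[OF \<beta>] coeff
      by (simp add: cinner_adjoint_op_right[OF bounded_op_multiword[OF that]]
          cinner_adjoint_op_right[OF bounded_op_multiword[OF \<beta>]])
    have "cinner (partial_cinner g (poisson h)) (op_multiword k wshift \<alpha> (poly_op k q wshift
        (op_multiword k wshift \<beta> (c *\<^sub>C vacuum k))))
      = cinner (partial_cinner g (poisson h')) (poly_op k q wshift (op_multiword k wshift \<beta> (c *\<^sub>C vacuum k)))"
      unfolding h'_def by (rule cinner_poisson_kernel_op_multiword[OF \<alpha>])
    also have "\<dots> = (\<Sum>\<gamma>\<in>Poly_Mapping.keys q. cnj (Poly_Mapping.lookup q \<gamma>) *
        (cnj c * cinner h' (op_multiword k A \<gamma> (op_multiword k A \<beta> g))))"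
      unfolding poly_op_def cinner.sum_right
      by (rule sum.cong) (simp_all add: cinner_scaleC_right summand keys)
    \<comment> \<open>The conjugated coefficients re-enter the second slot and assemble the
      polynomial at \<open>A\<close>.\<close>
    also have "\<dots> = cnj c * cinner h' (poly_op k q A (op_multiword k A \<beta> g))"
      unfolding poly_op_def cinner.sum_right
      by (simp add: cinner_scaleC_right sum_distrib_left mult.left_commute)
    also have "\<dots> = 0" using A_variety q by (simp add: cinner.zero_right)
    finally show "cinner (partial_cinner g (poisson h)) (op_multiword k wshift \<alpha> (poly_op k q wshift
        (op_multiword k wshift \<beta> (c *\<^sub>C vacuum k)))) = 0" .
  qed
  then show ?thesis by (simp add: tensor_space_iff[OF closed_csubspace_N_space])
qed

text \<open>The kernel is bounded below by 1, so the image of the complete space is complete and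
  therefore closed.\<close>

lemma closed_csubspace_range_poisson_kernel: "closed_csubspace (range poisson)"
proof -
  have "complete (range poisson)"
    by (rule complete_isometric_image[where e=1])
      (simp_all add: bounded_op_imp_bounded_linear[OF bounded_op_poisson_kernel] poisson_kernel_norm_ge
        complete_UNIV)
  moreover have "complex_vector.subspace (range poisson)"
  proof (rule complex_vector.subspaceI)
    have "poisson 0 = 0"
      by (rule linear_0[OF bounded_linear.linear[OF bounded_op_imp_bounded_linear[OF bounded_op_poisson_kernel]]])
    then show "0 \<in> range poisson" by (metis rangeI)
  qed (auto simp: bounded_op_addD[OF bounded_op_poisson_kernel, symmetric]
      bounded_op_scaleD[OF bounded_op_poisson_kernel, symmetric])
  ultimately show ?thesis by (simp add: closed_csubspace_def complete_imp_closed)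
qed

end

theorem corollary3p3:
  fixes k :: nat and n m :: "nat \<Rightarrow> nat"
    and a :: "nat \<Rightarrow> nat list \<Rightarrow> real"
    and Q :: "nc_poly set"
    and A :: "nat \<Rightarrow> nat \<Rightarrow> 'h::complex_hilbert \<Rightarrow> 'h"
    and b :: real
  assumes separable: "separable_space (euclidean :: 'h topology)"
    and k: "1 \<le> k"
    and n: "\<forall>i\<in>{1..k}. 1 \<le> n i"
    and m: "\<forall>i\<in>{1..k}. 1 \<le> m i"
    and f: "\<forall>i\<in>{1..k}. positive_regular (n i) (a i)"
    and Q: "Q \<subseteq> nc_polys k n"
    and N_nonzero: "N_space k n m a Q \<noteq> {0}"
    and A_bounded: "\<forall>i\<in>{1..k}. \<forall>j\<in>{1..n i}. bounded_clinear_on UNIV (A i j)"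
    and A_commute: "\<forall>s\<in>{1..k}. \<forall>t\<in>{1..k}. s \<noteq> t \<longrightarrow>
          (\<forall>j\<in>{1..n s}. \<forall>l\<in>{1..n t}. A s j \<circ> A t l = A t l \<circ> A s j)"
    and A_convergent: "\<forall>i\<in>{1..k}. wot_summable
          (\<lambda>\<alpha> x. a i \<alpha> *\<^sub>R op_word (A i) \<alpha> (adjoint_op (op_word (A i) \<alpha>) x)) (words (n i))"
    and A_variety: "\<forall>q\<in>Q. \<forall>x. poly_op k q A x = 0"
    and b: "0 < b"
    and sum_convergent: "wot_summable
          (\<lambda>s x. (\<Prod>i=1..k. real ((s i + m i - 1) choose (m i - 1))) *\<^sub>R Phi_multi k n a A s id x)
          ({1..k} \<rightarrow>\<^sub>E UNIV)"
    and sum_bounded: "op_le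
          (wot_sum
            (\<lambda>s x. (\<Prod>i=1..k. real ((s i + m i - 1) choose (m i - 1))) *\<^sub>R Phi_multi k n a A s id x)
            ({1..k} \<rightarrow>\<^sub>E UNIV))
          (\<lambda>x. b *\<^sub>R x)"
  shows "\<exists>(G :: (nat \<Rightarrow> nat list, 'h) ell2 set) Y Yinv.
          closed_csubspace G \<and> G \<subseteq> tensor_space (N_space k n m a Q) \<and>
          (\<forall>i\<in>{1..k}. \<forall>j\<in>{1..n i}. universal_model_adj k n m a Q i j ` G \<subseteq> G) \<and>
          bounded_clinear_on UNIV Y \<and> range Y \<subseteq> G \<and>
          bounded_clinear_on G Yinv \<and>
          (\<forall>h. Yinv (Y h) = h) \<and> (\<forall>g\<in>G. Y (Yinv g) = g) \<and>
          (\<forall>i\<in>{1..k}. \<forall>j\<in>{1..n i}. \<forall>h.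
             adjoint_op (A i j) h = Yinv (universal_model_adj k n m a Q i j (Y h)))"
proof -
  note norm_bound = b_coeff_weighted_norm_bound[OF f A_bounded A_convergent sum_convergent sum_bounded]
  note ctx = f A_bounded A_commute b norm_bound
  let ?Y = "poisson_kernel k n m a A" and ?N = "N_space k n m a Q"
  note Y = bounded_op_poisson_kernel[OF ctx] and Y_ge = poisson_kernel_norm_ge[OF ctx]
  have Y_mem: "?Y h \<in> tensor_space ?N" for h
    by (rule poisson_kernel_tensor_space[OF ctx Q A_variety])
  have inj: "inj ?Y"
  proof (rule injI)
    fix x y assume "?Y x = ?Y y"
    then have "?Y (x - y) = 0"
      by (simp add: linear_diff[OF bounded_linear.linear[OF bounded_op_imp_bounded_linear[OF Y]]])
    then show "x = y" using Y_ge[of "x - y"] by simp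
  qed
  \<comment> \<open>This relation gives both the invariance of the range and, after applying the
    inverse, the similarity.\<close>
  have S: "universal_model_adj k n m a Q i j (?Y h) = ?Y (adjoint_op (A i j) h)"
    if "i \<in> {1..k}" "j \<in> {1..n i}" for i j h
    unfolding universal_model_adj_eq[OF f that Y_mem] by (rule backward_shift_poisson_kernel[OF ctx that])
  have "bounded_clinear_on (range ?Y) (inv ?Y)"
    unfolding bounded_clinear_on_def
  proof (intro conjI)
    show "\<forall>x\<in>range ?Y. \<forall>y\<in>range ?Y. inv ?Y (x + y) = inv ?Y x + inv ?Y y"
      using inj by (auto simp: bounded_op_addD[OF Y, symmetric])
    show "\<forall>c. \<forall>x\<in>range ?Y. inv ?Y (c *\<^sub>C x) = c *\<^sub>C inv ?Y x"
      using inj by (auto simp: bounded_op_scaleD[OF Y, symmetric])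
    \<comment> \<open>The lower bound \<open>norm h \<le> norm (?Y h)\<close> is a bound by 1 for
      the inverse.\<close>
    show "\<exists>K. \<forall>x\<in>range ?Y. norm (inv ?Y x) \<le> K * norm x"
      using inj Y_ge by (intro exI[of _ 1]) auto
  qed
  then show ?thesis
    using closed_csubspace_range_poisson_kernel[OF ctx] Y_mem Y inj S
    by (intro exI[of _ "range ?Y"] exI[of _ ?Y] exI[of _ "inv ?Y"]) (auto simp: f_inv_into_f)
qed

end
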